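(* Let $H=\mathcal{A}/\mathbb{F}$ be the generalized Lie algebra of Hamiltonian type built, as in the context, from data $(\mathbb{F},m,m_1,\mathcal{J}_p,\Gamma,\varphi_p,\phi,\sigma_p)$ satisfying all the conditions listed there, and let $\sigma=\sum_{p=1}^{m_1}\sigma_p$. Then: (1) If $\vec{\mathcal{J}}\ne\{\vec 0\}$ or $\sigma=0$, then $H$ is a simple Lie algebra. (2) If $\vec{\mathcal{J}}=\{\vec 0\}$ and $\sigma\ne 0$, then $H^{(1)}=[H,H]$ is a simple Lie algebra and $H=H^{(1)}\oplus\big((\mathbb{F}x^{\sigma,\vec 0}+\mathbb{F})/\mathbb{F}\big)$ as vector spaces.
   Context: **Data.** $\mathbb{F}$ is a field of characteristic $0$, $\mathbb{N}=\{0,1,2,\dots\}$, $n=2m$ with $m\in\mathbb{N}$ ($m=0$ allowed), and $m_1\in\mathbb{N}$ with $m_1\le m$. For $1\le p\le n$, $\mathcal{J}_p\in\{\{0\},\mathbb{N}\}$, and $\vec{\mathcal{J}}=\mathcal{J}_1\times\cdots\times\mathcal{J}_n$ with componentwise addition. $\Gamma$ is a torsion-free abelian group, $\varphi_1,\dots,\varphi_n:\Gamma\to\mathbb{F}$ are additive homomorphisms, and $\phi:\Gamma\times\Gamma\to\mathbb{F}$ is a skew-symmetric $\mathbb{Z}$-bilinear form with radical $\operatorname{Rad}_\phi=\{\alpha\in\Gamma\mid\phi(\alpha,\beta)=0\ \forall\beta\in\Gamma\}$. Empty intersections of subsets of $\Gamma$ are $\Gamma$, and empty sums are $0$. **Conditions.**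 - For every $p\in\{1,\dots,n\}$: $\varphi_p\ne0$ or $\mathcal{J}_p\ne\{0\}$. - For every $p\in\{1,\dots,m_1\}$: $\varphi_p\neq0$ or $\varphi_{m+p}\ne0$. - For every $q\in\{m_1+1,\dots,m\}$: $\varphi_{m+q}=0$ if $\mathcal{J}_q=\{0\}$, and $\varphi_q=0$ if $\mathcal{J}_{m+q}=\{0\}$. - If $p\in\{m_1+1,\dots,m\}\cup\{m+m_1+1,\dots,n\}$ and $\varphi_p\ne0$, then $\big(\bigcap_{q\ne p}\ker\varphi_q\big)\setminus\ker\varphi_p\ne\emptyset$. - If $p\in\{1,\dots,m_1\}\cup\{m+1,\dots,m+m_1\}$ and $\varphi_p\neq0$, then $\big(\operatorname{Rad}_\phi\cap\bigcap_{q\ne p}\ker\varphi_q\big)\setminus\ker\varphi_p\neq\emptyset$. - With $\mho=\{p,\,m+p\mid 1\le p\le m_1,\ \varphi_p\ne0,\ \varphi_{m+p}\ne0\}$, $$\Big\{\alpha\in\Gamma\;\Big|\;\phi(\alpha,\beta)=0\ \text{for all}\ \beta\in\bigcap_{q\in\mho}\ker\varphi_q\Big\}\cap\bigcap_{p=1}^n\ker\varphi_p=\{0\}.$$ - For each $p\in\{1,\dots,m_1\}$ a fixed element is chosen: $0\ne\sigma_p=\sigma_{m+p}\in\operatorname{Rad}_\phi\cap\bigcap_{q\in\{1,\dots,n\}\setminus\{p,m+p\}}\ker\varphi_q$. (In the intersections above, $q$ ranges over $\{1,\dots,n\}$ unless indicated otherwise.) **Construction.** $\mathcal{A}$ is the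 $\mathbb{F}$-vector space with basis $\{x^{\alpha,\vec i}\mid(\alpha,\vec i)\in\Gamma\times\vec{\mathcal{J}}\}$ and commutative associative product $x^{\alpha,\vec i}\cdot x^{\beta,\vec j}=x^{\alpha+\beta,\vec i+\vec j}$, with identity $1=x^{0,\vec0}$; $\mathbb{F}$ is identified with $\mathbb{F}1$. (When $n=0$, $\vec{\mathcal{J}}=\{\vec0\}$ and $\mathcal{A}$ is the group algebra of $\Gamma$.) Write $x_1^{\alpha}=x^{\alpha,\vec0}$, and let $1_{[p]}$ be the vector with $1$ in position $p$ and $0$ elsewhere. Define $$\partial_{\varphi_p}(x^{\alpha,\vec i})=\varphi_p(\alpha)x^{\alpha,\vec i},\quad\hat\partial_p(x^{\alpha,\vec i})=i_px^{\alpha,\vec i-1_{[p]}},\quad\partial_p=\partial_{\varphi_p}+\hat\partial_p,$$ where a basis symbol whose index is not in $\vec{\mathcal{J}}$ is treated as $0$. Let $\mathcal{A}_\alpha=\operatorname{span}\{x^{\alpha,\vec j}\mid\vec j\in\vec{\mathcal{J}}\}$. The bilinear bracket on $\mathcal{A}$ is given, for $u\in\mathcal{A}_\alpha$ and $v\in\mathcal{A}_\beta$, by $$\begin{aligned}[u,v]=&\sum_{q=m_1+1}^m\big[\partial_q(u)\hat\partial_{m+q}(v)+\hat\partial_q(u)\partial_{\varphi_{m+q}}(v)-\hat\partial_{m+q}(u)\partial_q(v)-\partial_{\varphi_{m+q}}(u)\hat\partial_q(v)\big]\\&+\sum_{p=1}^{m_1}x_1^{\sigma_p}\big[\partial_p(u)\partial_{m+p}(v)-\partial_{m+p}(u)\partial_p(v)\big]+\phi(\alpha,\beta)uv.\end{aligned}$$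 This makes $\mathcal{A}$ a Lie algebra in which $1$ is central, and $H=\mathcal{A}/\mathbb{F}$ carries the induced bracket. **Convention.** "$H$ is simple" means that every ideal of $\mathcal{A}$ strictly containing $\mathbb{F}$ equals $\mathcal{A}$ (equivalently, every nonzero ideal of $H$ equals $H$). *)

theory Defs
  imports
    Complex_Main
    "HOL-Library.Poly_Mapping"
    "HOL-Library.Function_Algebras"
    "HOL-Library.Product_Plus"
begin

section \<open>Lie algebras carried by a subspace\<close>

text \<open>The carrier \<open>L\<close> is a subspace of the type \<open>'v\<close>, and the bracket \<open>B\<close> matters only on \<open>L\<close>.\<close>

locale lie_algebra = vector_space scale
  for scale :: "'k::field \<Rightarrow> 'v::ab_group_add \<Rightarrow> 'v" +
  fixes B :: "'v \<Rightarrow> 'v \<Rightarrow> 'v" and L :: "'v set"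
  assumes subspace_carrier: "subspace L"
    and bracket_closed: "x \<in> L \<Longrightarrow> y \<in> L \<Longrightarrow> B x y \<in> L"
    and bracket_add_left: "x \<in> L \<Longrightarrow> y \<in> L \<Longrightarrow> z \<in> L \<Longrightarrow> B (x + y) z = B x z + B y z"
    and bracket_add_right: "x \<in> L \<Longrightarrow> y \<in> L \<Longrightarrow> z \<in> L \<Longrightarrow> B x (y + z) = B x y + B x z"
    and bracket_scale_left: "x \<in> L \<Longrightarrow> y \<in> L \<Longrightarrow> B (scale c x) y = scale c (B x y)"
    and bracket_scale_right: "x \<in> L \<Longrightarrow> y \<in> L \<Longrightarrow> B x (scale c y) = scale c (B x y)"
    and bracket_self: "x \<in> L \<Longrightarrow> B x x = 0"
    and jacobi: "x \<in> L \<Longrightarrow> y \<in> L \<Longrightarrow> z \<in> L \<Longrightarrow>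
      B x (B y z) + B y (B z x) + B z (B x y) = 0"

definition lie_ideal ::
  "('k::field \<Rightarrow> 'v::ab_group_add \<Rightarrow> 'v) \<Rightarrow> ('v \<Rightarrow> 'v \<Rightarrow> 'v) \<Rightarrow> 'v set \<Rightarrow> 'v set \<Rightarrow> bool" where
  "lie_ideal scale B L I \<longleftrightarrow>
     module.subspace scale I \<and> I \<subseteq> L \<and> (\<forall>x\<in>L. \<forall>y\<in>I. B x y \<in> I)"

text \<open>Simplicity means that every nonzero ideal is the whole algebra; non-commutativity is not
  required, and the zero algebra is allowed.\<close>

definition simple_lie_algebra ::
  "('k::field \<Rightarrow> 'v::ab_group_add \<Rightarrow> 'v) \<Rightarrow> ('v \<Rightarrow> 'v \<Rightarrow> 'v) \<Rightarrow> 'v set \<Rightarrow> bool" where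
  "simple_lie_algebra scale B L \<longleftrightarrow>
     lie_algebra scale B L \<and> (\<forall>I. lie_ideal scale B L I \<and> I \<noteq> {0} \<longrightarrow> I = L)"

definition derived_algebra ::
  "('k::field \<Rightarrow> 'v::ab_group_add \<Rightarrow> 'v) \<Rightarrow> ('v \<Rightarrow> 'v \<Rightarrow> 'v) \<Rightarrow> 'v set \<Rightarrow> 'v set" where
  "derived_algebra scale B L = module.span scale {B x y | x y. x \<in> L \<and> y \<in> L}"

definition internal_direct_sum ::
  "('k::field \<Rightarrow> 'v::ab_group_add \<Rightarrow> 'v) \<Rightarrow> 'v set \<Rightarrow> 'v set \<Rightarrow> 'v set \<Rightarrow> bool" where
  "internal_direct_sum scale V U W \<longleftrightarrow>
     module.subspace scale U \<and> module.subspace scale W \<and>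
     V = {u + w | u w. u \<in> U \<and> w \<in> W} \<and> U \<inter> W = {0}"


section \<open>The data\<close>

definition ker :: "('a \<Rightarrow> 'b::zero) \<Rightarrow> 'a set" where
  "ker f = {\<alpha>. f \<alpha> = 0}"

definition radical :: "('g \<Rightarrow> 'g \<Rightarrow> 'k::zero) \<Rightarrow> 'g set" where
  "radical \<Phi> = {\<alpha>. \<forall>\<beta>. \<Phi> \<alpha> \<beta> = 0}"

definition mho :: "nat \<Rightarrow> nat \<Rightarrow> (nat \<Rightarrow> 'g \<Rightarrow> 'k::zero) \<Rightarrow> nat set" where
  "mho m m1 \<phi> = (\<Union>p\<in>{p \<in> {1..m1}. \<phi> p \<noteq> 0 \<and> \<phi> (m + p) \<noteq> 0}. {p, m + p})"

text \<open>The group \<open>\<Gamma>\<close> is the type \<open>'g\<close> and \<open>n = 2 * m\<close>; the maps \<open>\<phi>\<close> and \<open>J\<close> are relevant only on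
  \<open>{1..2 * m}\<close>, and \<open>\<sigma>\<close> only on \<open>{1..m1} \<union> {m + 1..m + m1}\<close>. The homomorphisms are \<open>\<phi> p\<close>, the
  bilinear form is \<open>\<Phi>\<close>.\<close>

locale hamiltonian_data =
  fixes m m1 :: nat
    and J :: "nat \<Rightarrow> nat set"
    and \<phi> :: "nat \<Rightarrow> 'g::ab_group_add \<Rightarrow> 'k::field_char_0"
    and \<Phi> :: "'g \<Rightarrow> 'g \<Rightarrow> 'k"
    and \<sigma> :: "nat \<Rightarrow> 'g"
  assumes m1_le_m: "m1 \<le> m"
    and J_cases: "p \<in> {1..2 * m} \<Longrightarrow> J p = {0} \<or> J p = UNIV"
    and torsion_free: "0 < k \<Longrightarrow> (\<Sum>_::nat<k. \<alpha> :: 'g) = 0 \<Longrightarrow> \<alpha> = 0"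
    and phi_additive: "p \<in> {1..2 * m} \<Longrightarrow> additive (\<phi> p)"
    and Phi_additive_left: "additive (\<lambda>\<alpha>. \<Phi> \<alpha> \<beta>)"
    and Phi_additive_right: "additive (\<lambda>\<beta>. \<Phi> \<alpha> \<beta>)"
    and Phi_skew: "\<Phi> \<alpha> \<beta> = - \<Phi> \<beta> \<alpha>"
    and phi_or_J: "p \<in> {1..2 * m} \<Longrightarrow> \<phi> p \<noteq> 0 \<or> J p \<noteq> {0}"
    and phi_or_phi: "p \<in> {1..m1} \<Longrightarrow> \<phi> p \<noteq> 0 \<or> \<phi> (m + p) \<noteq> 0"
    and phi_zero_right: "q \<in> {m1 + 1..m} \<Longrightarrow> J q = {0} \<Longrightarrow> \<phi> (m + q) = 0"
    and phi_zero_left: "q \<in> {m1 + 1..m} \<Longrightarrow> J (m + q) = {0} \<Longrightarrow> \<phi> q = 0"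
    and phi_independent:
      "p \<in> {m1 + 1..m} \<union> {m + m1 + 1..2 * m} \<Longrightarrow> \<phi> p \<noteq> 0 \<Longrightarrow>
        (\<Inter>q\<in>{1..2 * m} - {p}. ker (\<phi> q)) - ker (\<phi> p) \<noteq> {}"
    and phi_independent_radical:
      "p \<in> {1..m1} \<union> {m + 1..m + m1} \<Longrightarrow> \<phi> p \<noteq> 0 \<Longrightarrow>
        (radical \<Phi> \<inter> (\<Inter>q\<in>{1..2 * m} - {p}. ker (\<phi> q))) - ker (\<phi> p) \<noteq> {}"
    and nondegenerate:
      "{\<alpha>. \<forall>\<beta>\<in>(\<Inter>q\<in>mho m m1 \<phi>. ker (\<phi> q)). \<Phi> \<alpha> \<beta> = 0} \<inter> (\<Inter>p\<in>{1..2 * m}. ker (\<phi> p)) = {0}"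
    and sigma_nonzero: "p \<in> {1..m1} \<Longrightarrow> \<sigma> p \<noteq> 0"
    and sigma_pair: "p \<in> {1..m1} \<Longrightarrow> \<sigma> (m + p) = \<sigma> p"
    and sigma_mem: "p \<in> {1..m1} \<Longrightarrow>
      \<sigma> p \<in> radical \<Phi> \<inter> (\<Inter>q\<in>{1..2 * m} - {p, m + p}. ker (\<phi> q))"


section \<open>The algebra \<open>\<A>\<close> and its bracket\<close>

text \<open>All algebras \<open>\<A>\<close> over the group \<open>'g\<close> live in the monoid algebra of \<open>'g \<times> (nat \<Rightarrow> nat)\<close>, whose
  multiplication is the convolution product \<open>x\<^bsup>\<alpha>,i\<^esup> x\<^bsup>\<beta>,j\<^esup> = x\<^bsup>\<alpha>+\<beta>,i+j\<^esup>\<close> of the library; a multi-index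
  is a function on \<open>nat\<close> vanishing outside \<open>{1..2 * m}\<close>. The scalar \<open>c\<close> is \<open>single 0 c\<close>.\<close>

type_synonym ('g, 'k) monoid_alg = "('g \<times> (nat \<Rightarrow> nat)) \<Rightarrow>\<^sub>0 'k"

definition multi_indices :: "nat \<Rightarrow> (nat \<Rightarrow> nat set) \<Rightarrow> (nat \<Rightarrow> nat) set" where
  "multi_indices m J = {i. (\<forall>p\<in>{1..2 * m}. i p \<in> J p) \<and> (\<forall>p. p \<notin> {1..2 * m} \<longrightarrow> i p = 0)}"

definition ham_A :: "nat \<Rightarrow> (nat \<Rightarrow> nat set) \<Rightarrow> ('g::ab_group_add, 'k::field_char_0) monoid_alg set" where
  "ham_A m J = {u. Poly_Mapping.keys u \<subseteq> UNIV \<times> multi_indices m J}"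

definition d_phi ::
  "(nat \<Rightarrow> 'g \<Rightarrow> 'k) \<Rightarrow> nat \<Rightarrow> ('g::ab_group_add, 'k::field_char_0) monoid_alg \<Rightarrow> ('g, 'k) monoid_alg" where
  "d_phi \<phi> p u = (\<Sum>(\<alpha>, i)\<in>Poly_Mapping.keys u.
     Poly_Mapping.single (\<alpha>, i) (\<phi> p \<alpha> * Poly_Mapping.lookup u (\<alpha>, i)))"

text \<open>On \<open>ham_A m J\<close> the index \<open>i - 1\<^sub>[\<^sub>p\<^sub>]\<close> leaves the multi-indices only if \<open>i p = 0\<close>, and then the
  coefficient vanishes, so truncated subtraction is harmless.\<close>

definition d_hat :: "nat \<Rightarrow> ('g::ab_group_add, 'k::field_char_0) monoid_alg \<Rightarrow> ('g, 'k) monoid_alg" where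
  "d_hat p u = (\<Sum>(\<alpha>, i)\<in>Poly_Mapping.keys u.
     Poly_Mapping.single (\<alpha>, i(p := i p - 1)) (of_nat (i p) * Poly_Mapping.lookup u (\<alpha>, i)))"

definition d_full ::
  "(nat \<Rightarrow> 'g \<Rightarrow> 'k) \<Rightarrow> nat \<Rightarrow> ('g::ab_group_add, 'k::field_char_0) monoid_alg \<Rightarrow> ('g, 'k) monoid_alg" where
  "d_full \<phi> p u = d_phi \<phi> p u + d_hat p u"

text \<open>The bilinear extension of \<open>(u, v) \<mapsto> \<Phi> \<alpha> \<beta> u v\<close> for \<open>u \<in> \<A>\<^sub>\<alpha>\<close>, \<open>v \<in> \<A>\<^sub>\<beta>\<close>.\<close>

definition form_product ::
  "('g \<Rightarrow> 'g \<Rightarrow> 'k) \<Rightarrow> ('g::ab_group_add, 'k::field_char_0) monoid_alg \<Rightarrow> ('g, 'k) monoid_alg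
    \<Rightarrow> ('g, 'k) monoid_alg" where
  "form_product \<Phi> u v = (\<Sum>(\<alpha>, i)\<in>Poly_Mapping.keys u. \<Sum>(\<beta>, j)\<in>Poly_Mapping.keys v.
     Poly_Mapping.single (\<alpha> + \<beta>, i + j)
       (\<Phi> \<alpha> \<beta> * (Poly_Mapping.lookup u (\<alpha>, i) * Poly_Mapping.lookup v (\<beta>, j))))"

definition ham_bracket ::
  "nat \<Rightarrow> nat \<Rightarrow> (nat \<Rightarrow> 'g \<Rightarrow> 'k) \<Rightarrow> ('g \<Rightarrow> 'g \<Rightarrow> 'k) \<Rightarrow> (nat \<Rightarrow> 'g)
    \<Rightarrow> ('g::ab_group_add, 'k::field_char_0) monoid_alg \<Rightarrow> ('g, 'k) monoid_alg \<Rightarrow> ('g, 'k) monoid_alg" where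
  "ham_bracket m m1 \<phi> \<Phi> \<sigma> u v =
     (\<Sum>q\<in>{m1 + 1..m}.
        d_full \<phi> q u * d_hat (m + q) v + d_hat q u * d_phi \<phi> (m + q) v
        - d_hat (m + q) u * d_full \<phi> q v - d_phi \<phi> (m + q) u * d_hat q v)
     + (\<Sum>p\<in>{1..m1}. Poly_Mapping.single (\<sigma> p, 0) 1 *
        (d_full \<phi> p u * d_full \<phi> (m + p) v - d_full \<phi> (m + p) u * d_full \<phi> p v))
     + form_product \<Phi> u v"


section \<open>The quotient \<open>H = \<A> / \<F>\<close>\<close>

text \<open>The type is the monoid algebra modulo the scalars; \<open>H\<close> is the image of \<open>\<A>\<close> in it.\<close>

quotient_type (overloaded) ('g, 'k) mod_scalars =
  "('g::ab_group_add \<times> (nat \<Rightarrow> nat)) \<Rightarrow>\<^sub>0 'k::field_char_0" /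
  "\<lambda>u v. \<exists>c. u - v = Poly_Mapping.single 0 c"
  morphisms rep_mod_scalars to_mod_scalars
proof (rule equivpI)
  show "reflp (\<lambda>u v. \<exists>c. u - v = Poly_Mapping.single (0 :: 'g \<times> (nat \<Rightarrow> nat)) (c :: 'k))"
    by (rule reflpI) (auto intro: exI[of _ 0])
  show "symp (\<lambda>u v. \<exists>c. u - v = Poly_Mapping.single (0 :: 'g \<times> (nat \<Rightarrow> nat)) (c :: 'k))"
    proof (rule sympI)
    fix u v :: "('g, 'k) monoid_alg"
    assume "\<exists>c. u - v = Poly_Mapping.single 0 c"
    then obtain c where "u - v = Poly_Mapping.single 0 c" ..
    then have "v - u = Poly_Mapping.single 0 (- c)"
      by (metis minus_diff_eq single_uminus)
    then show "\<exists>c. v - u = Poly_Mapping.single 0 c" ..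
  qed
  show "transp (\<lambda>u v. \<exists>c. u - v = Poly_Mapping.single (0 :: 'g \<times> (nat \<Rightarrow> nat)) (c :: 'k))"
    proof (rule transpI)
    fix u v w :: "('g, 'k) monoid_alg"
    assume "\<exists>c. u - v = Poly_Mapping.single 0 c" "\<exists>c. v - w = Poly_Mapping.single 0 c"
    then obtain c d where "u - v = Poly_Mapping.single 0 c" "v - w = Poly_Mapping.single 0 d"
      by blast
    then have "(u - v) + (v - w) = Poly_Mapping.single 0 (c + d)"
      by (simp only: single_add)
    then show "\<exists>c. u - w = Poly_Mapping.single 0 c" by auto
  qed
qed

instantiation mod_scalars :: (ab_group_add, field_char_0) ab_group_add
begin

lift_definition zero_mod_scalars :: "('a, 'b) mod_scalars" is 0 .

lift_definition plus_mod_scalars ::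
  "('a, 'b) mod_scalars \<Rightarrow> ('a, 'b) mod_scalars \<Rightarrow> ('a, 'b) mod_scalars" is "(+)"
  proof -
  fix u u' v v' :: "('a \<times> (nat \<Rightarrow> nat)) \<Rightarrow>\<^sub>0 'b"
  assume "\<exists>c. u - u' = Poly_Mapping.single 0 c" "\<exists>c. v - v' = Poly_Mapping.single 0 c"
  then obtain c d where "u - u' = Poly_Mapping.single 0 c" "v - v' = Poly_Mapping.single 0 d"
    by blast
  then have "(u - u') + (v - v') = Poly_Mapping.single 0 (c + d)"
    by (simp only: single_add)
  then show "\<exists>c. (u + v) - (u' + v') = Poly_Mapping.single 0 c"
    by (auto simp: algebra_simps)
qed

lift_definition uminus_mod_scalars :: "('a, 'b) mod_scalars \<Rightarrow> ('a, 'b) mod_scalars" is uminus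
  proof -
  fix u u' :: "('a \<times> (nat \<Rightarrow> nat)) \<Rightarrow>\<^sub>0 'b"
  assume "\<exists>c. u - u' = Poly_Mapping.single 0 c"
  then obtain c where "u - u' = Poly_Mapping.single 0 c" ..
  then have "- u - - u' = Poly_Mapping.single 0 (- c)"
    by (simp only: minus_diff_minus single_uminus)
  then show "\<exists>c. - u - - u' = Poly_Mapping.single 0 c" ..
qed

lift_definition minus_mod_scalars ::
  "('a, 'b) mod_scalars \<Rightarrow> ('a, 'b) mod_scalars \<Rightarrow> ('a, 'b) mod_scalars" is "(-)"
  proof -
  fix u u' v v' :: "('a \<times> (nat \<Rightarrow> nat)) \<Rightarrow>\<^sub>0 'b"
  assume "\<exists>c. u - u' = Poly_Mapping.single 0 c" "\<exists>c. v - v' = Poly_Mapping.single 0 c"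
  then obtain c d where "u - u' = Poly_Mapping.single 0 c" "v - v' = Poly_Mapping.single 0 d"
    by blast
  then have "(u - u') - (v - v') = Poly_Mapping.single 0 (c - d)"
    by (simp only: single_diff)
  then show "\<exists>c. (u - v) - (u' - v') = Poly_Mapping.single 0 c"
    by (auto simp: algebra_simps)
qed

instance
proof
  fix a b c :: "('a, 'b) mod_scalars"
  show "a + b + c = a + (b + c)"
    by transfer (auto simp: add.assoc intro: exI[of _ 0])
  show "a + b = b + a"
    by transfer (auto simp: add.commute intro: exI[of _ 0])
  show "0 + a = a"
    by transfer (auto intro: exI[of _ 0])
  show "- a + a = 0"
    by transfer (auto intro: exI[of _ 0])
  show "a - b = a + - b"
    by transfer (auto intro: exI[of _ 0])
qed

end

lift_definition scale_mod_scalars ::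
  "'k::field_char_0 \<Rightarrow> ('g::ab_group_add, 'k) mod_scalars \<Rightarrow> ('g, 'k) mod_scalars"
  is "\<lambda>c u. Poly_Mapping.single 0 c * u"
  proof -
  fix c :: 'k and u u' :: "('g, 'k) monoid_alg"
  assume "\<exists>d. u - u' = Poly_Mapping.single 0 d"
  then obtain d where "u - u' = Poly_Mapping.single 0 d" ..
  then have "Poly_Mapping.single 0 c * u - Poly_Mapping.single 0 c * u' = Poly_Mapping.single 0 (c * d)"
    by (simp add: right_diff_distrib [symmetric] mult_single)
  then show "\<exists>d. Poly_Mapping.single 0 c * u - Poly_Mapping.single 0 c * u' = Poly_Mapping.single 0 d" ..
qed

definition ham_H :: "nat \<Rightarrow> (nat \<Rightarrow> nat set) \<Rightarrow> ('g::ab_group_add, 'k::field_char_0) mod_scalars set" where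
  "ham_H m J = to_mod_scalars ` ham_A m J"

text \<open>The induced bracket is computed on representatives; the choice is irrelevant by
  \<open>ham_bracket_H_to_mod_scalars\<close> below.\<close>

definition ham_bracket_H ::
  "nat \<Rightarrow> nat \<Rightarrow> (nat \<Rightarrow> 'g \<Rightarrow> 'k) \<Rightarrow> ('g \<Rightarrow> 'g \<Rightarrow> 'k) \<Rightarrow> (nat \<Rightarrow> 'g)
    \<Rightarrow> ('g::ab_group_add, 'k::field_char_0) mod_scalars \<Rightarrow> ('g, 'k) mod_scalars \<Rightarrow> ('g, 'k) mod_scalars" where
  "ham_bracket_H m m1 \<phi> \<Phi> \<sigma> X Y =
     to_mod_scalars (ham_bracket m m1 \<phi> \<Phi> \<sigma> (rep_mod_scalars X) (rep_mod_scalars Y))"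


lemma d_phi_add: "d_phi \<phi> p (u + v) = d_phi \<phi> p u + d_phi \<phi> p v"
  unfolding d_phi_def case_prod_unfold prod.collapse
  by (rule setsum_keys_plus_distrib
      [where f = "\<lambda>k a. Poly_Mapping.single k (\<phi> p (fst k) * a)"])
    (simp_all add: distrib_left single_add)

lemma d_hat_add: "d_hat p (u + v) = d_hat p u + d_hat p v"
  unfolding d_hat_def case_prod_unfold prod.collapse
  by (rule setsum_keys_plus_distrib
      [where f = "\<lambda>k a. Poly_Mapping.single (fst k, (snd k)(p := snd k p - 1)) (of_nat (snd k p) * a)"])
    (simp_all add: distrib_left single_add)

lemma form_product_add_left: "form_product \<Phi> (u + u') v = form_product \<Phi> u v + form_product \<Phi> u' v"
  unfolding form_product_def case_prod_unfold prod.collapse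
  by (rule setsum_keys_plus_distrib
      [where f = "\<lambda>k a. \<Sum>l\<in>Poly_Mapping.keys v. Poly_Mapping.single (fst k + fst l, snd k + snd l)
        (\<Phi> (fst k) (fst l) * (a * Poly_Mapping.lookup v l))"])
    (simp_all add: distrib_left distrib_right single_add sum.distrib)

lemma form_product_add_right: "form_product \<Phi> u (v + v') = form_product \<Phi> u v + form_product \<Phi> u v'"
  unfolding form_product_def case_prod_unfold prod.collapse sum.distrib [symmetric]
  by (rule sum.cong [OF refl], rule setsum_keys_plus_distrib
      [where f = "\<lambda>l a. Poly_Mapping.single (fst k + fst l, snd k + snd l)
        (\<Phi> (fst k) (fst l) * (Poly_Mapping.lookup u k * a))" for k])
    (simp_all add: distrib_left single_add)

context hamiltonian_data
begin

lemma d_phi_scalar: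
  assumes "p \<in> {1..2 * m}"
  shows "d_phi \<phi> p (Poly_Mapping.single 0 c) = 0"
  using additive.zero[OF phi_additive[OF assms]]
  by (simp add: d_phi_def zero_prod_def)

lemma d_hat_scalar: "d_hat p (Poly_Mapping.single 0 c) = 0"
  by (simp add: d_hat_def zero_prod_def)

lemma form_product_scalar:
  "form_product \<Phi> (Poly_Mapping.single 0 c) v = 0"
  "form_product \<Phi> u (Poly_Mapping.single 0 c) = 0"
  using additive.zero[OF Phi_additive_left] additive.zero[OF Phi_additive_right]
  by (simp_all add: form_product_def zero_prod_def case_prod_unfold)

lemma ham_bracket_scalar_left:
  "ham_bracket m m1 \<phi> \<Phi> \<sigma> (u + Poly_Mapping.single 0 c) v = ham_bracket m m1 \<phi> \<Phi> \<sigma> u v"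
  using m1_le_m unfolding ham_bracket_def d_full_def
  by (intro arg_cong2[where f = "(+)"] sum.cong)
    (auto simp: d_phi_add d_hat_add form_product_add_left d_phi_scalar d_hat_scalar form_product_scalar)

lemma ham_bracket_scalar_right:
  "ham_bracket m m1 \<phi> \<Phi> \<sigma> u (v + Poly_Mapping.single 0 c) = ham_bracket m m1 \<phi> \<Phi> \<sigma> u v"
  using m1_le_m unfolding ham_bracket_def d_full_def
  by (intro arg_cong2[where f = "(+)"] sum.cong)
    (auto simp: d_phi_add d_hat_add form_product_add_right d_phi_scalar d_hat_scalar form_product_scalar)

lemma ham_bracket_H_to_mod_scalars:
  "ham_bracket_H m m1 \<phi> \<Phi> \<sigma> (to_mod_scalars u) (to_mod_scalars v) =
     to_mod_scalars (ham_bracket m m1 \<phi> \<Phi> \<sigma> u v)"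
proof -
  have rep: "\<exists>c. rep_mod_scalars (to_mod_scalars w) = w + Poly_Mapping.single 0 c"
    for w :: "('g, 'k) monoid_alg"
  proof -
    have "to_mod_scalars (rep_mod_scalars (to_mod_scalars w)) = to_mod_scalars w"
      by (rule Quotient_abs_rep[OF Quotient_mod_scalars])
    then obtain c where "rep_mod_scalars (to_mod_scalars w) - w = Poly_Mapping.single 0 c"
      unfolding mod_scalars.abs_eq_iff by blast
    then show ?thesis by (metis add.commute diff_add_cancel)
  qed
  obtain c d where "rep_mod_scalars (to_mod_scalars u) = u + Poly_Mapping.single 0 c"
    "rep_mod_scalars (to_mod_scalars v) = v + Poly_Mapping.single 0 d"
    using rep by blast
  then show ?thesis
    by (simp add: ham_bracket_H_def ham_bracket_scalar_left ham_bracket_scalar_right)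
qed

end

end

theory Submission
  imports Defs
begin

text \<open>
  The bracket of \<open>\<A>\<close> is a derivation in each argument, so \<open>\<A>\<close> is a Poisson algebra, and the proof
  exploits the commutative product throughout. It rests on two ideas.

  The first is an analogue for Poisson algebras of Herstein's theorem on Lie ideals of simple rings
  (\<open>lie_ideal_dichotomy\<close>): if no proper nonzero associative ideal of \<open>\<A>\<close> is stable under the inner
  derivations from \<open>{\<A>, \<A>}\<close>, then a subspace stable under these derivations is central or contains
  \<open>{\<A>, \<A>}\<close>. Its proof uses that \<open>\<A>\<close> is reduced, which holds because the nilradical is itself a
  stable ideal. The dichotomy treats the ideals of \<open>H\<close> and of \<open>[H, H]\<close> alike, and reduces the theorem to three facts: \<open>\<A>\<close> is simple in the above sense, its centre consists of the
  scalars, and \<open>{\<A>, \<A>}\<close> together with the scalars is all of \<open>\<A>\<close>, except that it omits exactly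
  \<open>x\<^sup>s\<close>, where \<open>s\<close> is the sum of the \<open>\<sigma>\<^sub>p\<close>, if there are no polynomial variables and \<open>s \<noteq> 0\<close>.

  The second idea is that all three facts follow from one family of operators. Every \<open>x\<^sup>\<alpha>\<close> is
  invertible, so \<open>v \<mapsto> x\<^bsup>-\<alpha>\<^esup> {x\<^sup>\<alpha>, v}\<close> preserves every stable ideal, kills every central element, and has
  its image in \<open>{\<A>, \<A>}\<close>, because it is also \<open>v \<mapsto> {x\<^sup>\<alpha>, x\<^bsup>-\<alpha>\<^esup> v}\<close>. From these maps and the brackets with
  the polynomial variables one extracts commuting operators (\<open>operators_generated\<close>) that are
  triangular on monomials: \<open>x\<^bsup>\<beta>,i\<^esup>\<close> goes to \<open>l \<beta>\<close> times itself plus terms of lower degree in the variables,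
  with \<open>l\<close> some \<open>\<phi>\<^sub>p\<close> or some \<open>\<Phi> \<alpha>\<close>. By the nondegeneracy condition the weights \<open>l\<close> have no
  common zero except \<open>0\<close>, and for each variable some member of the family acts on polynomials as a
  nonzero multiple of the partial derivative. Therefore an element killed by the family is a scalar
  (\<open>annihilated_is_scalar\<close>), a nonzero stable subspace contains a common eigenvector and hence some unit
  \<open>x\<^sup>\<beta>\<close> (\<open>stable_subspace_contains_mon\<close>), and the images of the family contain every monomial but \<open>1\<close>,
  and also \<open>1\<close> if there are variables (\<open>images_contain_mon\<close>). The factors \<open>x\<^sup>\<sigma>\<close> in the bracket
  shift these images by exactly \<open>x\<^sup>s\<close>, which is where the exceptional monomial comes from.
\<close>


section \<open>Lie ideals of Poisson rings\<close>

definition add_subgroup :: "'a::ab_group_add set \<Rightarrow> bool" where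
  "add_subgroup S \<longleftrightarrow> 0 \<in> S \<and> (\<forall>x\<in>S. \<forall>y\<in>S. x - y \<in> S)"

lemma add_subgroup_zero: "add_subgroup S \<Longrightarrow> 0 \<in> S"
  and add_subgroup_diff: "add_subgroup S \<Longrightarrow> x \<in> S \<Longrightarrow> y \<in> S \<Longrightarrow> x - y \<in> S"
  by (auto simp: add_subgroup_def)

lemma add_subgroup_uminus: "add_subgroup S \<Longrightarrow> x \<in> S \<Longrightarrow> - x \<in> S"
  using add_subgroup_diff[OF _ add_subgroup_zero] by fastforce

lemma add_subgroup_add: "add_subgroup S \<Longrightarrow> x \<in> S \<Longrightarrow> y \<in> S \<Longrightarrow> x + y \<in> S"
  using add_subgroup_diff[OF _ _ add_subgroup_uminus] by fastforce

locale poisson_bracket =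
  fixes B :: "'a::comm_ring_1 \<Rightarrow> 'a \<Rightarrow> 'a"
  assumes add_right: "B u (v + w) = B u v + B u w"
    and skew: "B u v = - B v u"
    and leibniz: "B u (v * w) = v * B u w + w * B u v"
    and jacobi: "B u (B v w) + B v (B w u) + B w (B u v) = 0"
    and torsion_free: "0 < n \<Longrightarrow> of_nat n * u = 0 \<Longrightarrow> u = 0"
begin

lemma add_left: "B (u + v) w = B u w + B v w"
  using add_right skew by (metis minus_add_distrib)

lemma zero_right: "B u 0 = 0"
  using add_right[of u 0 0] by simp

lemma zero_left: "B 0 u = 0"
  using skew[of 0 u] zero_right by simp

lemma uminus_right: "B u (- v) = - B u v"
  using add_right[of u v "- v"] zero_right by (simp add: eq_neg_iff_add_eq_0 add.commute)

lemma uminus_left: "B (- u) v = - B u v"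
  using skew uminus_right by metis

lemma diff_left: "B (u - v) w = B u w - B v w"
  using add_left[of u "- v"] uminus_left by simp

lemma self: "B u u = 0"
proof -
  have "of_nat 2 * B u u = 0"
    using iffD1[OF eq_neg_iff_add_eq_0 skew[of u u]] by simp
  then show ?thesis using torsion_free[of 2] by simp
qed

lemma jacobi_derivation: "B u (B v w) = B (B u v) w + B v (B u w)"
  using jacobi[of u v w] skew[of w "B u v"] skew[of w u] uminus_right[of v "B u w"]
  by (simp add: algebra_simps eq_neg_iff_add_eq_0)

text \<open>On the right \<open>u\<close> and \<open>v\<close> stand alone in one argument of the bracket, whatever \<open>w\<close> is. This is
  why the elements that bracket the whole ring into a given subgroup form a subring.\<close>

lemma cyclic: "B (u * v) w = B u (v * w) + B v (w * u)"
proof -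
  have "B (u * v) w = - (u * B w v + v * B w u)"
    using skew[of "u * v" w] by (simp add: leibniz)
  also have "\<dots> = u * B v w + v * B u w"
    using skew[of w v] skew[of w u] by simp
  finally show ?thesis
    using skew[of v u] by (simp add: leibniz algebra_simps)
qed

lemma power_right: "B d (f ^ Suc n) = of_nat (Suc n) * f ^ n * B d f"
proof (induction n)
  case (Suc n)
  have "B d (f ^ Suc (Suc n)) = f * B d (f ^ Suc n) + f ^ Suc n * B d f"
    by (simp add: leibniz[of d f "f ^ Suc n", simplified])
  then show ?case
    unfolding Suc by (simp add: algebra_simps)
qed simp

text \<open>Differentiating \<open>f\<^sup>n = 0\<close> and multiplying by the derivative trades one factor \<open>f\<close> for two
  factors \<open>B d f\<close>.\<close>

lemma nilpotent_derivative:
  assumes "f ^ n = 0"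
  shows "B d f ^ (2 * n) = 0"
proof -
  let ?g = "B d f"
  have "f ^ (n - k) * ?g ^ (2 * k) = 0" if "k \<le> n" for k
    using that
  proof (induction k)
    case 0
    then show ?case using assms by simp
  next
    case (Suc k)
    define j where "j = n - Suc k"
    have j: "n - k = Suc j" using Suc.prems by (simp add: j_def)
    have z: "f ^ Suc j * ?g ^ (2 * k) = 0" using Suc by (simp add: j)
    have "of_nat (Suc j) * (f ^ j * ?g ^ (2 * Suc k)) = 0"
    proof (cases k)
      case 0
      have "0 = B d (f ^ Suc j * ?g ^ (2 * k)) * ?g" using z zero_right by simp
      then show ?thesis using 0 power_right[of d f j] by (simp add: power2_eq_square mult.assoc)
    next
      case (Suc l)
      then obtain e where e: "2 * k = Suc e" by auto
      have "0 = B d (f ^ Suc j * ?g ^ Suc e) * ?g" using z zero_right e by simp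
      also have "\<dots> = of_nat (Suc j) * (f ^ j * ?g ^ (2 * Suc k))
          + of_nat (Suc e) * (f ^ Suc j * ?g ^ Suc e) * B d ?g"
        unfolding leibniz power_right using e by (simp add: algebra_simps)
      finally show ?thesis using z e by simp
    qed
    then show ?case using torsion_free[of "Suc j"] by (simp add: j_def)
  qed
  from this[of n] show ?thesis by simp
qed

lemma nilpotent_diff:
  fixes f g :: 'a
  assumes "f ^ n = 0" "g ^ k = 0"
  shows "(f - g) ^ (n + k) = 0"
proof -
  have "f ^ i * (- g) ^ (n + k - i) = 0" for i
  proof (cases "n \<le> i")
    case True
    then have "f ^ i = f ^ n * f ^ (i - n)" by (metis le_add_diff_inverse power_add)
    then show ?thesis using assms by simp
  next
    case False
    then have "g ^ (n + k - i) = g ^ k * g ^ (n - i)"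
      by (simp add: power_add[symmetric] add.commute)
    then show ?thesis using assms by (simp add: power_minus[of g])
  qed
  then show ?thesis
    using binomial_ring[of f "- g" "n + k"] by (simp add: mult.assoc)
qed

end

text \<open>Simplicity is required with respect to the derivations from \<open>D\<close> alone. With \<open>D\<close> spanned by
  \<open>{A, A}\<close>, the dichotomy below then applies to the ideals of the derived algebra as well as to
  those of \<open>A\<close>.\<close>

locale poisson_simple = poisson_bracket B
  for B :: "'a::comm_ring_1 \<Rightarrow> 'a \<Rightarrow> 'a" +
  fixes A D :: "'a set"
  assumes subgroup_A: "add_subgroup A"
    and one_A: "1 \<in> A"
    and mult_A: "u \<in> A \<Longrightarrow> v \<in> A \<Longrightarrow> u * v \<in> A"
    and D_subset_A: "D \<subseteq> A"
    and bracket_D: "u \<in> A \<Longrightarrow> v \<in> A \<Longrightarrow> B u v \<in> D"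
    and no_stable_ideal: "K \<subseteq> A \<Longrightarrow> add_subgroup K \<Longrightarrow> (\<And>a k. a \<in> A \<Longrightarrow> k \<in> K \<Longrightarrow> a * k \<in> K) \<Longrightarrow>
      (\<And>d k. d \<in> D \<Longrightarrow> k \<in> K \<Longrightarrow> B d k \<in> K) \<Longrightarrow> K \<noteq> {0} \<Longrightarrow> 1 \<in> K"
begin

lemma bracket_A: "u \<in> A \<Longrightarrow> v \<in> A \<Longrightarrow> B u v \<in> A"
  using bracket_D D_subset_A by blast

text \<open>The nilradical is an ideal stable under derivations, hence zero.\<close>

lemma reduced:
  assumes "f \<in> A" "f * f = 0"
  shows "f = 0"
proof (rule ccontr)
  assume nz: "f \<noteq> 0"
  define K where "K = {k \<in> A. \<exists>n. k ^ n = 0}"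
  have "f \<in> K" using assms by (auto simp: K_def power2_eq_square intro!: exI[of _ 2])
  have "1 \<in> K"
  proof (rule no_stable_ideal)
    show "K \<subseteq> A" by (auto simp: K_def)
    show "add_subgroup K"
      unfolding add_subgroup_def K_def mem_Collect_eq
      using nilpotent_diff add_subgroup_zero[OF subgroup_A] add_subgroup_diff[OF subgroup_A]
      by (blast intro: power_one_right)
    show "K \<noteq> {0}" using \<open>f \<in> K\<close> nz by auto
    show "a * k \<in> K" if "a \<in> A" "k \<in> K" for a k
    proof -
      obtain n where "k ^ n = 0" using \<open>k \<in> K\<close> unfolding K_def by blast
      then have "(a * k) ^ n = 0" by (simp add: power_mult_distrib)
      then show ?thesis using that mult_A by (auto simp: K_def)
    qed
    show "B d k \<in> K" if "d \<in> D" "k \<in> K" for d k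
      using that bracket_A D_subset_A nilpotent_derivative unfolding K_def by blast
  qed
  then have "(1 :: 'a) = 0" by (simp add: K_def)
  then have "f = 0" by (metis mult_1 mult_zero_left)
  then show False using nz by simp
qed

text \<open>Each step substitutes an element of the form \<open>\<delta>\<^sup>k a\<close> into \<open>\<delta>\<^sup>n (a b) = 0\<close> so that only the middle
  term survives, which lowers the order of nilpotency by one.\<close>

lemma ad_nilpotent_is_zero:
  assumes u: "u \<in> A" and nil: "\<And>a. a \<in> A \<Longrightarrow> B u (B u (B u (B u a))) = 0" and "a \<in> A"
  shows "B u a = 0"
proof -
  let ?d = "B u"
  have cl: "?d a \<in> A" if "a \<in> A" for a using bracket_A u that .
  have d0: "?d 0 = 0" by (rule zero_right)
  note ls = leibniz add_right
  \<comment> \<open>only \<open>4 \<delta>\<^sup>3(a) \<delta>\<^sup>3(a)\<close> survives in \<open>\<delta>\<^sup>4 (\<delta>\<^sup>2(a) a)\<close>\<close>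
  have nil3: "?d (?d (?d a)) = 0" if a: "a \<in> A" for a
  proof (rule reduced)
    show "?d (?d (?d a)) \<in> A" using cl a by blast
    have "?d (?d (?d (?d (?d (?d a) * a)))) = 0" using nil cl a mult_A by blast
    moreover have "?d (?d (?d (?d (?d (?d a) * a)))) = of_nat 4 * (?d (?d (?d a)) * ?d (?d (?d a)))"
      using nil[OF a] nil[OF cl[OF a]] nil[OF cl[OF cl[OF a]]]
      by (simp only: ls) (simp add: d0 algebra_simps)
    ultimately show "?d (?d (?d a)) * ?d (?d (?d a)) = 0"
      using torsion_free[of 4] by simp
  qed
  have nil2: "?d (?d a) = 0" if a: "a \<in> A" for a
  proof (rule reduced)
    show "?d (?d a) \<in> A" using cl a by blast
    have "?d (?d (?d (?d a * a))) = 0" using nil3 cl a mult_A by blast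
    moreover have "?d (?d (?d (?d a * a))) = of_nat 3 * (?d (?d a) * ?d (?d a))"
      using nil3[OF a] nil3[OF cl[OF a]] by (simp only: ls) (simp add: d0 algebra_simps)
    ultimately show "?d (?d a) * ?d (?d a) = 0"
      using torsion_free[of 3] by simp
  qed
  show ?thesis
  proof (rule reduced)
    show "?d a \<in> A" using cl assms by blast
    have "?d (?d (a * a)) = 0" using nil2 mult_A assms by blast
    moreover have "?d (?d (a * a)) = of_nat 2 * (?d a * ?d a)"
      using nil2[of a] assms by (simp only: ls) (simp add: d0 algebra_simps)
    ultimately show "?d a * ?d a = 0"
      using torsion_free[of 2] by simp
  qed
qed

text \<open>Let \<open>M\<close> consist of the elements whose brackets with \<open>A\<close> lie in \<open>I\<close>. It is a subring, stable under
  \<open>D\<close>, and contains \<open>{I, I}\<close>. As in Herstein's argument, a subring that is also a Lie ideal is large: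
  iterated brackets of its elements generate an ideal inside it. The bracket \<open>{w, a v}\<close> expands into
  \<open>a {w, v} + v {w, a}\<close>, so \<open>a {w, v} \<in> M\<close> for all \<open>a\<close> once \<open>{w, A} \<subseteq> M\<close> and \<open>v \<in> M\<close>; and \<open>{M, M}\<close> consists of such
  \<open>w\<close>. Thus \<open>{{M, M}, M}\<close> lies in the largest ideal \<open>K\<close> contained in \<open>M\<close>, which is stable and so \<open>0\<close> or
  \<open>A\<close>. If \<open>K = A\<close> then \<open>{A, A} \<subseteq> I\<close>. If \<open>K = 0\<close>, then \<open>ad u\<close> is nilpotent for \<open>u \<in> M\<close>, so \<open>M\<close> is central;
  then \<open>{I, I}\<close> is central, and \<open>ad u\<close> is nilpotent for \<open>u \<in> I\<close> too.\<close>

theorem lie_ideal_dichotomy: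
  assumes I: "I \<subseteq> A" "add_subgroup I"
    and stable: "\<And>d u. d \<in> D \<Longrightarrow> u \<in> I \<Longrightarrow> B d u \<in> I"
  shows "(\<forall>u\<in>I. \<forall>a\<in>A. B u a = 0) \<or> (\<forall>a\<in>A. \<forall>b\<in>A. B a b \<in> I)"
proof (rule disjCI)
  assume not_all: "\<not> (\<forall>a\<in>A. \<forall>b\<in>A. B a b \<in> I)"
  define M where "M = {u \<in> A. \<forall>a\<in>A. B u a \<in> I}"
  define M' where "M' = {w \<in> A. \<forall>a\<in>A. B w a \<in> M}"
  define K where "K = {k \<in> A. \<forall>a\<in>A. k * a \<in> M}"
  note clI = add_subgroup_zero[OF I(2)] add_subgroup_add[OF I(2)] add_subgroup_diff[OF I(2)]
    add_subgroup_uminus[OF I(2)]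
  note clA = add_subgroup_zero[OF subgroup_A] add_subgroup_add[OF subgroup_A]
    add_subgroup_diff[OF subgroup_A] add_subgroup_uminus[OF subgroup_A]
  have swap: "B u d \<in> I" if "u \<in> I" "d \<in> D" for u d
    using stable[OF that(2,1)] clI(4) skew[of u d] by simp
  have sgM: "add_subgroup M"
    using clI clA by (auto simp: add_subgroup_def M_def zero_left diff_left)
  note clM = add_subgroup_zero[OF sgM] add_subgroup_add[OF sgM] add_subgroup_diff[OF sgM]
    add_subgroup_uminus[OF sgM]
  have multM: "u * v \<in> M" if "u \<in> M" "v \<in> M" for u v
    using that clI mult_A unfolding M_def by (auto simp: cyclic[of u v])
  have M_D: "B d u \<in> M" if "u \<in> M" "d \<in> D" for u d
  proof -
    have dA: "d \<in> A" using that D_subset_A by blast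
    have "B (B d u) a \<in> I" if a: "a \<in> A" for a
    proof -
      have "B (B d u) a = B d (B u a) - B u (B d a)"
        using jacobi_derivation[of d u a] by simp
      then show ?thesis
        using stable[OF \<open>d \<in> D\<close>] \<open>u \<in> M\<close> bracket_A[OF dA a] a clI(3) by (simp add: M_def)
    qed
    then show ?thesis using that dA bracket_A by (simp add: M_def)
  qed
  have I_I: "B u v \<in> M" if "u \<in> I" "v \<in> I" for u v
  proof -
    have uv: "u \<in> A" "v \<in> A" using that I by auto
    have "B (B u v) a \<in> I" if a: "a \<in> A" for a
    proof -
      have "B (B u v) a = B u (B v a) - B v (B u a)"
        using jacobi_derivation[of u v a] by simp
      then show ?thesis
        using swap \<open>u \<in> I\<close> \<open>v \<in> I\<close> bracket_D uv a clI(3) by simp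
    qed
    then show ?thesis using uv bracket_A by (simp add: M_def)
  qed
  have M_M: "B u v \<in> M'" if "u \<in> M" "v \<in> M" for u v
  proof -
    have uv: "u \<in> A" "v \<in> A" using that by (auto simp: M_def)
    have "B (B u v) a \<in> M" if a: "a \<in> A" for a
    proof -
      have "B (B u v) a = B (B v a) (- u) - B (B u a) (- v)"
        using jacobi_derivation[of u v a] skew[of u "B v a"] skew[of v "B u a"]
        by (simp add: uminus_right)
      then show ?thesis
        using M_D[of "- u" "B v a"] M_D[of "- v" "B u a"] bracket_D uv a clM
          \<open>u \<in> M\<close> \<open>v \<in> M\<close> by simp
    qed
    then show ?thesis using uv bracket_A by (simp add: M'_def)
  qed
  have M'_M: "B w v \<in> K" if w: "w \<in> M'" and v: "v \<in> M" for w v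
  proof -
    have wv: "w \<in> A" "v \<in> A" using that by (auto simp: M_def M'_def)
    have "B w v * a \<in> M" if a: "a \<in> A" for a
    proof -
      have "B w v * a = B w (a * v) - v * B w a" by (simp add: leibniz)
      then show ?thesis
        using w v a wv mult_A multM clM(3) by (simp add: M'_def)
    qed
    then show ?thesis using wv bracket_A by (simp add: K_def)
  qed
  have K0: "K = {0}"
  proof (rule ccontr)
    assume "K \<noteq> {0}"
    have "1 \<in> K"
    proof (rule no_stable_ideal[OF _ _ _ _ \<open>K \<noteq> {0}\<close>])
      show "K \<subseteq> A" by (auto simp: K_def)
      show "add_subgroup K"
        using clM clA by (auto simp: add_subgroup_def K_def left_diff_distrib)
      show "a * k \<in> K" if "a \<in> A" "k \<in> K" for a k
        using that mult_A by (auto simp: K_def mult.assoc mult.left_commute[of a])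
      show "B d k \<in> K" if d: "d \<in> D" and k: "k \<in> K" for d k
      proof -
        have dk: "d \<in> A" "k \<in> A" using d k D_subset_A by (auto simp: K_def)
        have "B d k * a \<in> M" if a: "a \<in> A" for a
        proof -
          have "B d k * a = B d (k * a) - k * B d a" by (simp add: leibniz algebra_simps)
          then show ?thesis
            using M_D[OF _ d] k a bracket_A[OF dk(1) a] clM(3) by (simp add: K_def)
        qed
        then show ?thesis using dk bracket_A by (simp add: K_def)
      qed
    qed
    then have "A \<subseteq> M" by (auto simp: K_def)
    then show False using not_all by (auto simp: M_def)
  qed
  have M_central: "B u a = 0" if u: "u \<in> M" and "a \<in> A" for u a
  proof (rule ad_nilpotent_is_zero)
    show uA: "u \<in> A" using u by (simp add: M_def)
    fix b assume b: "b \<in> A"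
    have "B (B u b) u \<in> M" using M_D[OF u] bracket_D uA b by simp
    then have 2: "B u (B u b) \<in> M" using clM(4) skew[of u "B u b"] by simp
    have "B (B u (B u (B u b))) u = 0" using M'_M[OF M_M[OF u 2] u] K0 by simp
    then show "B u (B u (B u (B u b))) = 0" using skew[of u "B u (B u (B u b))"] by simp
  qed fact
  show "\<forall>u\<in>I. \<forall>a\<in>A. B u a = 0"
  proof (intro ballI)
    fix u a assume u: "u \<in> I" and "a \<in> A"
    have uA: "u \<in> A" using u I by auto
    show "B u a = 0"
    proof (rule ad_nilpotent_is_zero[OF uA])
      fix b assume "b \<in> A"
      then have "B u (B u b) \<in> I" using swap[OF u] bracket_D uA by simp
      then have "B u (B u (B u b)) \<in> M" by (rule I_I[OF u])
      then have "B (B u (B u (B u b))) u = 0" using uA by (rule M_central)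
      then show "B u (B u (B u (B u b))) = 0" using skew[of u "B u (B u (B u b))"] by simp
    qed fact
  qed
qed

end


section \<open>Compatible brackets\<close>

text \<open>A bracket given as a finite sum satisfies the Jacobi identity as soon as any two summands,
  equal or not, are compatible, provided there is no 2-torsion: this is the polarised form of the
  identity.\<close>

definition jacobiator :: "('a \<Rightarrow> 'a \<Rightarrow> 'a) \<Rightarrow> ('a \<Rightarrow> 'a \<Rightarrow> 'a) \<Rightarrow> 'a \<Rightarrow> 'a \<Rightarrow> 'a \<Rightarrow> 'a::comm_ring_1" where
  "jacobiator P Q u v w = P u (Q v w) + P v (Q w u) + P w (Q u v)"

definition compatible :: "('a::comm_ring_1 \<Rightarrow> 'a \<Rightarrow> 'a) \<Rightarrow> ('a \<Rightarrow> 'a \<Rightarrow> 'a) \<Rightarrow> bool" where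
  "compatible P Q \<longleftrightarrow> (\<forall>u v w. jacobiator P Q u v w + jacobiator Q P u v w = 0)"

lemma compatible_sym: "compatible P Q \<Longrightarrow> compatible Q P"
  by (auto simp: compatible_def add.commute)

lemma compatible_add:
  assumes "\<And>u v w. P u (v + w) = P u v + P u w" "compatible P Q" "compatible P R"
  shows "compatible P (\<lambda>u v. Q u v + R u v)"
  unfolding compatible_def
proof (intro allI)
  fix u v w
  have "jacobiator P (\<lambda>u v. Q u v + R u v) u v w + jacobiator (\<lambda>u v. Q u v + R u v) P u v w
      = (jacobiator P Q u v w + jacobiator Q P u v w) + (jacobiator P R u v w + jacobiator R P u v w)"
    by (simp add: jacobiator_def assms(1) algebra_simps)
  then show "jacobiator P (\<lambda>u v. Q u v + R u v) u v w + jacobiator (\<lambda>u v. Q u v + R u v) P u v w = 0"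
    using assms(2,3) by (simp add: compatible_def)
qed

lemma compatible_sum:
  assumes add: "\<And>u v w. P u (v + w) = P u v + P u w" and "finite I"
    and "\<And>i. i \<in> I \<Longrightarrow> compatible P (Q i)"
  shows "compatible P (\<lambda>u v. \<Sum>i\<in>I. Q i u v)"
  using assms(2,3)
proof (induction I rule: finite_induct)
  case empty
  have "P u 0 = 0" for u using add[of u 0 0] by simp
  then show ?case by (simp add: compatible_def jacobiator_def)
next
  case (insert i I)
  then show ?case using compatible_add[of P "Q i" "\<lambda>u v. \<Sum>i\<in>I. Q i u v"] add by simp
qed

definition derivation :: "('a::comm_ring_1 \<Rightarrow> 'a) \<Rightarrow> bool" where
  "derivation d \<longleftrightarrow> (\<forall>u v. d (u + v) = d u + d v) \<and> (\<forall>u v. d (u * v) = u * d v + v * d u)"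

lemma derivation_add: "derivation d \<Longrightarrow> d (u + v) = d u + d v"
  and derivation_mult: "derivation d \<Longrightarrow> d (u * v) = u * d v + v * d u"
  by (simp_all add: derivation_def)

lemma derivation_zero: "derivation d \<Longrightarrow> d 0 = 0"
  using derivation_add[of d 0 0] by simp

lemma derivation_diff: "derivation d \<Longrightarrow> d (u - v) = d u - d v"
  using derivation_add[of d "u - v" v] by simp

lemma derivation_uminus: "derivation d \<Longrightarrow> d (- v) = - d v"
  using derivation_diff[of d 0 v] by (simp add: derivation_zero)

lemma derivation_plus:
  "derivation d \<Longrightarrow> derivation e \<Longrightarrow> derivation (\<lambda>u. d u + e u)"
  by (simp add: derivation_def algebra_simps)

lemma derivation_scaled: "derivation d \<Longrightarrow> derivation (\<lambda>u. a * d u)"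
  by (simp add: derivation_def algebra_simps)

lemma derivation_sum:
  "finite I \<Longrightarrow> (\<And>i. i \<in> I \<Longrightarrow> derivation (d i)) \<Longrightarrow> derivation (\<lambda>u. \<Sum>i\<in>I. d i u)"
  by (induction I rule: finite_induct)
    (auto intro: derivation_plus simp: derivation_def[of "\<lambda>_. 0"])

definition wedge :: "'a::comm_ring_1 \<Rightarrow> ('a \<Rightarrow> 'a) \<Rightarrow> ('a \<Rightarrow> 'a) \<Rightarrow> 'a \<Rightarrow> 'a \<Rightarrow> 'a" where
  "wedge a d e u v = a * (d u * e v - e u * d v)"

lemma compatible_wedge_wedge:
  assumes "derivation d" "derivation e" "derivation d'" "derivation e'"
    and "\<And>u. d (e u) = e (d u)" "\<And>u. d' (e' u) = e' (d' u)"
    and "\<And>u. d (d' u) = d' (d u)" "\<And>u. d (e' u) = e' (d u)"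
    and "\<And>u. e (d' u) = d' (e u)" "\<And>u. e (e' u) = e' (e u)"
    and "d b = 0" "e b = 0" "d' a = 0" "e' a = 0"
  shows "compatible (wedge a d e) (wedge b d' e')"
  unfolding compatible_def jacobiator_def wedge_def
  by (intro allI, simp add: derivation_mult derivation_diff assms, simp add: algebra_simps)

text \<open>For commuting \<open>d\<close> and \<open>e\<close> the coefficient \<open>a\<close> may be arbitrary: in rank two the terms that contain
  derivatives of \<open>a\<close> cancel cyclically.\<close>

lemma compatible_wedge_self:
  assumes "derivation d" "derivation e" and "\<And>u. d (e u) = e (d u)"
  shows "compatible (wedge a d e) (wedge a d e)"
  unfolding compatible_def jacobiator_def wedge_def
  by (intro allI, simp add: derivation_mult derivation_diff assms, simp add: algebra_simps)

lemma compatible_wedge_form: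
  assumes d: "derivation d" "derivation e" and P: "\<And>u. derivation (P u)" "\<And>u v. P u v = - P v u"
    and inv: "\<And>u v. d (P u v) = P (d u) v + P u (d v)" "\<And>u v. e (P u v) = P (e u) v + P u (e v)"
    and "\<And>u. P u a = 0"
  shows "compatible (wedge a d e) P"
  unfolding compatible_def
proof (intro allI)
  fix u v w
  \<comment> \<open>fix one order of the two arguments of \<open>P\<close>, so that opposite terms cancel\<close>
  note s = P(2)[of v u] P(2)[of w u] P(2)[of w v]
    P(2)[of "d v" u] P(2)[of "d w" u] P(2)[of "d w" v]
    P(2)[of v "d u"] P(2)[of w "d u"] P(2)[of w "d v"]
    P(2)[of "e v" u] P(2)[of "e w" u] P(2)[of "e w" v]
    P(2)[of v "e u"] P(2)[of w "e u"] P(2)[of w "e v"]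
  show "jacobiator (wedge a d e) P u v w + jacobiator P (wedge a d e) u v w = 0"
    unfolding jacobiator_def wedge_def
    by (simp add: derivation_mult derivation_diff P(1) inv assms(7) s derivation_uminus d, simp add: algebra_simps)
qed


section \<open>Derivations of the monoid algebra\<close>

abbreviation mon :: "'g \<Rightarrow> (nat \<Rightarrow> nat) \<Rightarrow> ('g::ab_group_add, 'k::field_char_0) monoid_alg" where
  "mon \<alpha> i \<equiv> Poly_Mapping.single (\<alpha>, i) 1"

abbreviation scalar :: "'k \<Rightarrow> ('g::ab_group_add, 'k::field_char_0) monoid_alg" where
  "scalar c \<equiv> Poly_Mapping.single 0 c"

lemma poly_mapping_additive_induct [case_names single add]:
  fixes u :: "'a \<Rightarrow>\<^sub>0 'b::ab_group_add"
  assumes "\<And>k c. P (Poly_Mapping.single k c)" "\<And>u v. P u \<Longrightarrow> P v \<Longrightarrow> P (u + v)"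
  shows "P u"
proof (induction u rule: Poly_Mapping.update_induct)
  case const
  then show ?case using assms(1)[of undefined 0] by simp
next
  case (update f a b)
  have "Poly_Mapping.update a b f = f + Poly_Mapping.single a b"
    using update(1) by (intro poly_mapping_eqI)
      (auto simp: lookup_update lookup_add lookup_single in_keys_iff when_def)
  then show ?case using assms update by simp
qed

lemma scalar_mult_single:
  fixes k :: "'g::ab_group_add \<times> (nat \<Rightarrow> nat)"
  shows "scalar c * Poly_Mapping.single k d = Poly_Mapping.single k (c * d)"
  using mult_single[of "0 :: 'g \<times> (nat \<Rightarrow> nat)" c k d] by simp

lemma lookup_scalar_mult:
  fixes u :: "('g::ab_group_add, 'k::field_char_0) monoid_alg"
  shows "Poly_Mapping.lookup (scalar c * u) k = c * Poly_Mapping.lookup u k"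
proof (induction u rule: poly_mapping_additive_induct)
  case (single k' d)
  show ?case by (simp add: scalar_mult_single lookup_single when_def)
qed (simp add: distrib_left lookup_add)

lemma single_eq_scalar_mult_mon: "Poly_Mapping.single (\<alpha>, i) c = scalar c * mon \<alpha> i"
  by (intro poly_mapping_eqI) (simp add: lookup_scalar_mult lookup_single when_def)

lemma mon_mult_mon: "mon \<alpha> i * mon \<beta> j = mon (\<alpha> + \<beta>) (i + j)"
  by (simp add: mult_single)

lemma mon_zero: "mon 0 0 = 1"
  by (metis single_one zero_prod_def)

lemma mon_inverse: "mon (- \<alpha>) 0 * (mon \<alpha> 0 * u) = u" "mon \<alpha> 0 * (mon (- \<alpha>) 0 * u) = u"
  by (simp_all add: mult.assoc[symmetric] mult_single mon_zero)

lemma mon_mult_cancel: "mon \<alpha> 0 * u = 0 \<longleftrightarrow> u = 0"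
  using mon_inverse(1)[of \<alpha> u] by auto

lemma torsion_free_monoid_alg:
  fixes u :: "('g::ab_group_add, 'k::field_char_0) monoid_alg"
  assumes "0 < n" "of_nat n * u = 0"
  shows "u = 0"
proof -
  have "of_nat n * u = scalar (of_nat n) * u"
    by (metis single_of_nat)
  then have "of_nat n * Poly_Mapping.lookup u k = 0" for k
    using assms(2) lookup_scalar_mult[of "of_nat n" u k] by simp
  then show ?thesis using assms(1) by (intro poly_mapping_eqI) simp
qed

text \<open>The derivation attached to a single map \<open>l\<close>. The arguments \<open>\<phi>\<close> and \<open>p\<close> of \<open>d_phi\<close> enter only through
  \<open>\<phi> p\<close>, but here \<open>l\<close> will also be a value \<open>\<Phi> \<alpha>\<close> of the form.\<close>

definition weight_derivation ::
  "('g \<Rightarrow> 'k) \<Rightarrow> ('g::ab_group_add, 'k::field_char_0) monoid_alg \<Rightarrow> ('g, 'k) monoid_alg" where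
  "weight_derivation l = d_phi (\<lambda>_. l) 0"

lemma d_phi_eq_weight_derivation: "d_phi \<phi> p = weight_derivation (\<phi> p)"
  by (simp add: weight_derivation_def d_phi_def fun_eq_iff)

lemma weight_derivation_add:
  "weight_derivation l (u + v) = weight_derivation l u + weight_derivation l v"
  by (simp add: weight_derivation_def d_phi_add)

lemma weight_derivation_single:
  "weight_derivation l (Poly_Mapping.single (\<alpha>, i) c) = Poly_Mapping.single (\<alpha>, i) (l \<alpha> * c)"
  by (simp add: weight_derivation_def d_phi_def)

lemma d_hat_single:
  "d_hat p (Poly_Mapping.single (\<alpha>, i) c) = Poly_Mapping.single (\<alpha>, i(p := i p - 1)) (of_nat (i p) * c)"
  by (simp add: d_hat_def)

lemma lookup_weight_derivation:
  "Poly_Mapping.lookup (weight_derivation l u) (\<alpha>, i) = l \<alpha> * Poly_Mapping.lookup u (\<alpha>, i)"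
proof (induction u rule: poly_mapping_additive_induct)
  case (single k c)
  then show ?case by (cases k) (auto simp: weight_derivation_single lookup_single when_def)
qed (simp add: weight_derivation_add lookup_add distrib_left)

lemma lookup_d_hat:
  "Poly_Mapping.lookup (d_hat p u) (\<alpha>, i) =
    of_nat (Suc (i p)) * Poly_Mapping.lookup u (\<alpha>, i(p := Suc (i p)))"
proof (induction u rule: poly_mapping_additive_induct)
  case (single k c)
  obtain \<beta> j where k: "k = (\<beta>, j)" by (cases k)
  have "j(p := j p - 1) = i \<longleftrightarrow> j = i(p := Suc (i p))" if "j p > 0"
    using that by (auto simp: fun_eq_iff)
  moreover have "j = i(p := Suc (i p)) \<Longrightarrow> j p > 0" by auto
  ultimately show ?case
    by (cases "j p > 0") (auto simp: k d_hat_single lookup_single when_def)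
qed (simp add: d_hat_add lookup_add distrib_left)

lemma derivation_weight_derivation:
  assumes "additive l"
  shows "derivation (weight_derivation l)"
proof -
  have "weight_derivation l (u * v) = u * weight_derivation l v + v * weight_derivation l u" for u v
  proof (induction u rule: poly_mapping_additive_induct)
    case (single k c)
    show ?case
    proof (induction v rule: poly_mapping_additive_induct)
      case (single k' c')
      show ?case
        by (cases k; cases k')
          (simp add: mult_single weight_derivation_single additive.add[OF assms]
            single_add[symmetric] algebra_simps)
    qed (simp add: weight_derivation_add algebra_simps)
  qed (simp add: weight_derivation_add algebra_simps)
  then show ?thesis by (simp add: derivation_def weight_derivation_add)
qed

text \<open>If \<open>i p = 0\<close> the truncated index \<open>i(p := i p - 1)\<close> is wrong but carries the coefficient \<open>0\<close>, so one index
  \<open>l\<close> serves both summands of the product rule.\<close>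

lemma derivation_d_hat:
  "derivation (d_hat p :: ('g::ab_group_add, 'k::field_char_0) monoid_alg \<Rightarrow> _)"
proof -
  have "d_hat p (u * v) = u * d_hat p v + v * d_hat p u"
    for u v :: "('g::ab_group_add, 'k::field_char_0) monoid_alg"
  proof (induction u rule: poly_mapping_additive_induct)
    case (single k c)
    show ?case
    proof (induction v rule: poly_mapping_additive_induct)
      case (single k' c')
      obtain \<alpha> i \<beta> j where k: "k = (\<alpha>, i)" "k' = (\<beta>, j)" by (cases k; cases k')
      define l where "l = (i + j)(p := i p + j p - 1)"
      have "j + i(p := i p - 1) = l" if "i p \<noteq> 0"
        using that by (auto simp: l_def fun_eq_iff)
      then have 1: "Poly_Mapping.single k' c' * d_hat p (Poly_Mapping.single k c)
          = Poly_Mapping.single (\<alpha> + \<beta>, l) (of_nat (i p) * (c * c'))"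
        by (cases "i p = 0") (auto simp: k mult_single d_hat_single ac_simps)
      have "i + j(p := j p - 1) = l" if "j p \<noteq> 0"
        using that by (auto simp: l_def fun_eq_iff)
      then have 2: "Poly_Mapping.single k c * d_hat p (Poly_Mapping.single k' c')
          = Poly_Mapping.single (\<alpha> + \<beta>, l) (of_nat (j p) * (c * c'))"
        by (cases "j p = 0") (auto simp: k mult_single d_hat_single ac_simps)
      have "d_hat p (Poly_Mapping.single k c * Poly_Mapping.single k' c')
          = Poly_Mapping.single (\<alpha> + \<beta>, l) (of_nat (i p + j p) * (c * c'))"
        by (simp add: k mult_single d_hat_single l_def)
      then show ?case
        unfolding 1 2 by (simp add: single_add[symmetric] algebra_simps)
    qed (simp add: d_hat_add algebra_simps)
  qed (simp add: d_hat_add algebra_simps)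
  then show ?thesis by (simp add: derivation_def d_hat_add)
qed

lemma weight_derivation_commute:
  "weight_derivation l (weight_derivation l' u) = weight_derivation l' (weight_derivation l u)"
  by (intro poly_mapping_eqI) (auto simp: lookup_weight_derivation split_paired_all)

lemma weight_derivation_d_hat: "weight_derivation l (d_hat p u) = d_hat p (weight_derivation l u)"
  by (intro poly_mapping_eqI) (auto simp: lookup_weight_derivation lookup_d_hat split_paired_all)

lemma d_hat_commute: "d_hat p (d_hat q u) = d_hat q (d_hat p u)"
  by (intro poly_mapping_eqI) (auto simp: lookup_d_hat fun_upd_twist split_paired_all)

lemma d_full_eq: "d_full \<phi> p u = weight_derivation (\<phi> p) u + d_hat p u"
  by (simp add: d_full_def d_phi_eq_weight_derivation)

lemma derivation_d_full: "additive (\<phi> p) \<Longrightarrow> derivation (d_full \<phi> p)"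
  unfolding d_full_eq[abs_def]
  by (intro derivation_plus derivation_weight_derivation derivation_d_hat)

lemma d_full_commute: "d_full \<phi> p (d_full \<phi> q u) = d_full \<phi> q (d_full \<phi> p u)"
  by (simp add: d_full_eq weight_derivation_add d_hat_add weight_derivation_commute[of "\<phi> p"]
      weight_derivation_d_hat d_hat_commute[of p] algebra_simps)

lemma form_product_single:
  "form_product \<Phi> (Poly_Mapping.single (\<alpha>, i) c) v
    = Poly_Mapping.single (\<alpha>, i) c * weight_derivation (\<Phi> \<alpha>) v"
proof (induction v rule: poly_mapping_additive_induct)
  case (single k d)
  then show ?case
    by (cases k) (simp add: form_product_def weight_derivation_single mult_single algebra_simps)
qed (simp add: form_product_add_right weight_derivation_add distrib_left)

lemma form_product_single_single:
  "form_product \<Phi> (Poly_Mapping.single (\<alpha>, i) c) (Poly_Mapping.single (\<beta>, j) d)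
    = Poly_Mapping.single (\<alpha> + \<beta>, i + j) (\<Phi> \<alpha> \<beta> * (c * d))"
  by (simp add: form_product_single weight_derivation_single mult_single algebra_simps)

lemma form_product_skew:
  assumes "\<And>\<alpha> \<beta>. \<Phi> \<alpha> \<beta> = - \<Phi> \<beta> \<alpha>"
  shows "form_product \<Phi> u v = - form_product \<Phi> v u"
proof (induction u rule: poly_mapping_additive_induct)
  case (single k c)
  show ?case
  proof (induction v rule: poly_mapping_additive_induct)
    case (single k' c')
    obtain \<alpha> i \<beta> j where k: "k = (\<alpha>, i)" "k' = (\<beta>, j)" by (cases k; cases k')
    show ?case
      using assms[of \<alpha> \<beta>]
      by (simp add: k form_product_single_single single_uminus[symmetric] ac_simps)
  qed (simp add: form_product_add_left form_product_add_right)
qed (simp add: form_product_add_left form_product_add_right)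

lemma derivation_form_product:
  assumes "\<And>\<alpha>. additive (\<Phi> \<alpha>)"
  shows "derivation (form_product \<Phi> u)"
proof (induction u rule: poly_mapping_additive_induct)
  case (single k c)
  show ?case
    by (cases k) (simp add: form_product_single[abs_def] derivation_scaled
        derivation_weight_derivation assms)
next
  case (add u v)
  then show ?case by (simp add: form_product_add_left derivation_plus)
qed

lemma d_full_form_product:
  assumes "additive (\<phi> p)" "\<And>\<alpha>. additive (\<Phi> \<alpha>)"
  shows "d_full \<phi> p (form_product \<Phi> u v) = form_product \<Phi> (d_full \<phi> p u) v + form_product \<Phi> u (d_full \<phi> p v)"
proof (induction u rule: poly_mapping_additive_induct)
  case (single k c)
  obtain \<alpha> i where k: "k = (\<alpha>, i)" by (cases k)
  have c: "d_full \<phi> p (weight_derivation l v) = weight_derivation l (d_full \<phi> p v)" for l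
    by (simp add: d_full_eq weight_derivation_add weight_derivation_commute[of "\<phi> p"]
        weight_derivation_d_hat)
  show ?case
    by (simp add: k form_product_single derivation_mult[OF derivation_d_full[of \<phi> p, OF assms(1)]] c)
      (simp add: d_full_eq weight_derivation_single d_hat_single form_product_add_left
        form_product_single algebra_simps)
qed (simp_all add: form_product_add_left form_product_add_right
    derivation_add[OF derivation_d_full[of \<phi> p, OF assms(1)]])

lemma compatible_form_product_self:
  assumes skew: "\<And>\<alpha> \<beta>. \<Phi> \<alpha> \<beta> = - \<Phi> \<beta> \<alpha>" and add: "\<And>\<alpha>. additive (\<Phi> \<alpha>)"
  shows "compatible (form_product \<Phi>) (form_product \<Phi>)"
proof -
  let ?J = "jacobiator (form_product \<Phi>) (form_product \<Phi>)"
  have J: "?J (u + u') v w = ?J u v w + ?J u' v w" "?J u (v + v') w = ?J u v w + ?J u v' w"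
    "?J u v (w + w') = ?J u v w + ?J u v w'" for u u' v v' w w'
    by (simp_all add: jacobiator_def form_product_add_left form_product_add_right algebra_simps)
  have "?J u v w = 0" for u v w
  proof (induction u rule: poly_mapping_additive_induct)
    case (single k c)
    show ?case
    proof (induction v rule: poly_mapping_additive_induct)
      case (single k' c')
      show ?case
      proof (induction w rule: poly_mapping_additive_induct)
        case (single k'' c'')
        obtain \<alpha> i \<beta> j \<gamma> l where k: "k = (\<alpha>, i)" "k' = (\<beta>, j)" "k'' = (\<gamma>, l)"
          by (cases k; cases k'; cases k'')
        have s: "\<Phi> \<beta> \<alpha> = - \<Phi> \<alpha> \<beta>" "\<Phi> \<gamma> \<alpha> = - \<Phi> \<alpha> \<gamma>" "\<Phi> \<gamma> \<beta> = - \<Phi> \<beta> \<gamma>"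
          using skew by blast+
        have "\<beta> + (\<gamma> + \<alpha>) = \<alpha> + (\<beta> + \<gamma>)" "\<gamma> + (\<alpha> + \<beta>) = \<alpha> + (\<beta> + \<gamma>)"
          "j + (l + i) = i + (j + l)" "l + (i + j) = i + (j + l)"
          by (simp_all add: algebra_simps)
        then show ?case
          unfolding k jacobiator_def form_product_single_single
          by (simp add: single_add[symmetric] additive.add[OF add] s algebra_simps)
      qed (simp add: J)
    qed (simp add: J)
  qed (simp add: J)
  then show ?thesis by (simp add: compatible_def)
qed


section \<open>The algebra and its monomials\<close>

lemma ham_A_iff:
  "u \<in> ham_A m J \<longleftrightarrow> (\<forall>\<alpha> i. Poly_Mapping.lookup u (\<alpha>, i) \<noteq> 0 \<longrightarrow> i \<in> multi_indices m J)"
  by (auto simp: ham_A_def subset_iff in_keys_iff)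

lemma ham_A_single: "i \<in> multi_indices m J \<Longrightarrow> Poly_Mapping.single (\<alpha>, i) c \<in> ham_A m J"
  by (auto simp: ham_A_iff lookup_single when_def)

lemma ham_A_zero: "0 \<in> ham_A m J"
  by (simp add: ham_A_iff)

lemma ham_A_add: "u \<in> ham_A m J \<Longrightarrow> v \<in> ham_A m J \<Longrightarrow> u + v \<in> ham_A m J"
  by (auto simp: ham_A_iff lookup_add) (metis add.right_neutral)

lemma ham_A_scalar_mult: "u \<in> ham_A m J \<Longrightarrow> scalar c * u \<in> ham_A m J"
  by (auto simp: ham_A_iff lookup_scalar_mult)

lemma ham_A_uminus: "u \<in> ham_A m J \<Longrightarrow> - u \<in> ham_A m J"
  by (auto simp: ham_A_iff)

lemma ham_A_diff: "u \<in> ham_A m J \<Longrightarrow> v \<in> ham_A m J \<Longrightarrow> u - v \<in> ham_A m J"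
  using ham_A_add[OF _ ham_A_uminus] by fastforce

lemma ham_A_sum: "(\<And>i. i \<in> I \<Longrightarrow> f i \<in> ham_A m J) \<Longrightarrow> (\<Sum>i\<in>I. f i) \<in> ham_A m J"
  by (induction I rule: infinite_finite_induct) (auto intro: ham_A_add ham_A_zero)

lemma ham_A_weight_derivation: "u \<in> ham_A m J \<Longrightarrow> weight_derivation l u \<in> ham_A m J"
  by (auto simp: ham_A_iff lookup_weight_derivation)

lemma ham_A_subspace_induct [consumes 1, case_names zero add mon]:
  assumes u: "u \<in> ham_A m J"
    and "0 \<in> V" "\<And>u v. u \<in> V \<Longrightarrow> v \<in> V \<Longrightarrow> u + v \<in> V"
    and "\<And>\<alpha> i c. i \<in> multi_indices m J \<Longrightarrow> Poly_Mapping.single (\<alpha>, i) c \<in> V"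
  shows "u \<in> V"
proof -
  have "(\<forall>k\<in>Poly_Mapping.keys u. snd k \<in> multi_indices m J) \<longrightarrow> u \<in> V"
  proof (induction u rule: Poly_Mapping.update_induct)
    case const
    then show ?case using assms(2) by simp
  next
    case (update f a b)
    have "Poly_Mapping.update a b f = f + Poly_Mapping.single a b"
      using update(1) by (intro poly_mapping_eqI)
        (auto simp: lookup_update lookup_add lookup_single in_keys_iff when_def)
    moreover have "Poly_Mapping.keys (Poly_Mapping.update a b f) = insert a (Poly_Mapping.keys f)"
      using update(2) by (simp add: keys_update)
    ultimately show ?case
      using assms(3)[of f "Poly_Mapping.single a b"] assms(4)[of "snd a" "fst a" b] update(3) by simp
  qed
  then show ?thesis using u by (auto simp: ham_A_def)
qed

lemma multi_indices_add:
  assumes "\<forall>p\<in>{1..2 * m}. J p = {0} \<or> J p = UNIV"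
    and "i \<in> multi_indices m J" "j \<in> multi_indices m J"
  shows "i + j \<in> multi_indices m J"
proof -
  have "i p + j p \<in> J p" if "p \<in> {1..2 * m}" for p
    using bspec[OF assms(1) that] assms(2,3) that unfolding multi_indices_def
    by (metis (mono_tags, lifting) UNIV_I add_0 mem_Collect_eq singletonD)
  then show ?thesis using assms by (simp add: multi_indices_def)
qed

lemma zero_multi_indices:
  assumes "\<forall>p\<in>{1..2 * m}. J p = {0} \<or> J p = UNIV"
  shows "0 \<in> multi_indices m J"
  using assms by (fastforce simp: multi_indices_def)

lemma multi_indices_upd:
  "i \<in> multi_indices m J \<Longrightarrow> J p = UNIV \<Longrightarrow> p \<in> {1..2 * m} \<Longrightarrow> i(p := n) \<in> multi_indices m J"
  by (auto simp: multi_indices_def)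

lemma multi_indices_nonzero:
  assumes "\<forall>p\<in>{1..2 * m}. J p = {0} \<or> J p = UNIV"
    and "i \<in> multi_indices m J" "i p \<noteq> 0"
  shows "p \<in> {1..2 * m}" "J p = UNIV"
proof -
  show p: "p \<in> {1..2 * m}"
    using assms(2,3) unfolding multi_indices_def by fastforce
  show "J p = UNIV"
    using bspec[OF assms(1) p] assms(2,3) p unfolding multi_indices_def by fastforce
qed

lemma ham_A_d_hat:
  assumes J_choice: "\<forall>p\<in>{1..2 * m}. J p = {0} \<or> J p = UNIV" and u: "u \<in> ham_A m J"
  shows "d_hat p u \<in> ham_A m J"
proof -
  have "i \<in> multi_indices m J" if "i(p := Suc (i p)) \<in> multi_indices m J" for i
    using multi_indices_upd[OF that, of p "i p"] multi_indices_nonzero[OF J_choice that, of p] by simp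
  then show ?thesis using u by (auto simp: ham_A_iff lookup_d_hat)
qed

lemma ham_A_mult:
  assumes J_choice: "\<forall>p\<in>{1..2 * m}. J p = {0} \<or> J p = UNIV"
    and "u \<in> ham_A m J" "v \<in> ham_A m J"
  shows "u * v \<in> ham_A m J"
  unfolding ham_A_def
proof (intro CollectI subsetI)
  fix k assume "k \<in> Poly_Mapping.keys (u * v)"
  then obtain a b where k: "k = a + b" and ab: "a \<in> Poly_Mapping.keys u" "b \<in> Poly_Mapping.keys v"
    using keys_mult[of u v] by blast
  have "snd a \<in> multi_indices m J" "snd b \<in> multi_indices m J"
    using assms(2,3) ab unfolding ham_A_def by auto
  then show "k \<in> UNIV \<times> multi_indices m J"
    using multi_indices_add[OF J_choice] by (simp add: k mem_Times_iff)
qed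

lemma ham_A_d_full:
  assumes "\<forall>p\<in>{1..2 * m}. J p = {0} \<or> J p = UNIV" and "u \<in> ham_A m J"
  shows "d_full \<phi> p u \<in> ham_A m J"
  unfolding d_full_eq by (intro ham_A_add ham_A_weight_derivation ham_A_d_hat assms)

lemma ham_A_form_product:
  assumes J_choice: "\<forall>p\<in>{1..2 * m}. J p = {0} \<or> J p = UNIV"
    and u: "u \<in> ham_A m J" and v: "v \<in> ham_A m J"
  shows "form_product \<Phi> u v \<in> ham_A m J"
proof -
  have "u \<in> {u. form_product \<Phi> u v \<in> ham_A m J}"
    using u
  proof (induction rule: ham_A_subspace_induct)
    case zero
    then show ?case by (simp add: form_product_def ham_A_zero)
  qed (auto simp: form_product_add_left form_product_single
      intro!: ham_A_add ham_A_mult[OF J_choice] ham_A_single ham_A_weight_derivation v)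
  then show ?thesis by simp
qed


section \<open>Triangular operators\<close>

definition triangular_op :: "nat \<Rightarrow> ('g \<Rightarrow> 'k) \<Rightarrow> (nat \<Rightarrow> 'k)
    \<Rightarrow> ('g::ab_group_add, 'k::field_char_0) monoid_alg \<Rightarrow> ('g, 'k) monoid_alg" where
  "triangular_op n l c u = weight_derivation l u + (\<Sum>p\<in>{1..n}. scalar (c p) * d_hat p u)"

lemma lookup_triangular_op:
  "Poly_Mapping.lookup (triangular_op n l c u) (\<beta>, j) = l \<beta> * Poly_Mapping.lookup u (\<beta>, j)
    + (\<Sum>p\<in>{1..n}. c p * (of_nat (Suc (j p)) * Poly_Mapping.lookup u (\<beta>, j(p := Suc (j p)))))"
  by (simp add: triangular_op_def lookup_add lookup_weight_derivation lookup_sum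
      lookup_scalar_mult lookup_d_hat)

lemma derivation_triangular_op: "additive l \<Longrightarrow> derivation (triangular_op n l c)"
  unfolding triangular_op_def[abs_def]
  by (intro derivation_plus derivation_sum derivation_scaled derivation_d_hat
      derivation_weight_derivation) simp_all

lemma triangular_op_mon:
  "triangular_op n l c (mon \<beta> j)
    = scalar (l \<beta>) * mon \<beta> j + (\<Sum>p\<in>{1..n}. scalar (c p * of_nat (j p)) * mon \<beta> (j(p := j p - 1)))"
  by (simp add: triangular_op_def weight_derivation_single d_hat_single scalar_mult_single)

lemma triangular_op_mon_mult:
  assumes "additive l"
  shows "triangular_op n l c (mon \<beta> 0 * u) = mon \<beta> 0 * (triangular_op n l c u + scalar (l \<beta>) * u)"
  using triangular_op_mon[of n l c \<beta> 0]
  by (simp add: derivation_mult[OF derivation_triangular_op[OF assms]] algebra_simps)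

text \<open>A pair \<open>(l, c)\<close> in \<open>S\<close> stands for the operator \<open>triangular_op (2 * m) l c\<close>, which acts on the span
  of the \<open>x\<^bsup>\<beta>,i\<^esup>\<close> with a given \<open>\<beta>\<close> as \<open>l \<beta>\<close> plus a locally nilpotent operator. Two properties of a family
  make it strong: its weights \<open>l\<close> vanish together at \<open>0\<close> only, and for each variable present it
  contains an operator that acts on polynomials (\<open>\<beta> = 0\<close>) as a nonzero multiple of the partial
  derivative in that variable.\<close>

locale operator_family =
  fixes m :: nat and J :: "nat \<Rightarrow> nat set"
    and S :: "(('g::ab_group_add \<Rightarrow> 'k::field_char_0) \<times> (nat \<Rightarrow> 'k)) set"
  assumes J_choice: "\<forall>p\<in>{1..2 * m}. J p = {0} \<or> J p = UNIV"
    and weight_additive: "(l, c) \<in> S \<Longrightarrow> additive l"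
    and separating: "\<beta> \<noteq> 0 \<Longrightarrow> \<exists>l c. (l, c) \<in> S \<and> l \<beta> \<noteq> 0"
    and lowering: "p \<in> {1..2 * m} \<Longrightarrow> J p = UNIV \<Longrightarrow>
      \<exists>l c. (l, c) \<in> S \<and> c p \<noteq> 0 \<and> (\<forall>q\<in>{1..2 * m}. q \<noteq> p \<longrightarrow> J q = UNIV \<longrightarrow> c q = 0)"
begin

abbreviation "A \<equiv> ham_A m J :: ('g, 'k) monoid_alg set"

abbreviation T :: "('g \<Rightarrow> 'k) \<Rightarrow> (nat \<Rightarrow> 'k) \<Rightarrow> ('g, 'k) monoid_alg \<Rightarrow> ('g, 'k) monoid_alg" where
  "T \<equiv> triangular_op (2 * m)"

definition deg :: "(nat \<Rightarrow> nat) \<Rightarrow> nat" where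
  "deg j = (\<Sum>p\<in>{1..2 * m}. j p)"

lemma deg_upd: "p \<in> {1..2 * m} \<Longrightarrow> deg (j(p := n)) + j p = deg j + n"
  by (simp add: deg_def sum.remove[of _ p])

text \<open>At an index of maximal degree among those that occur with \<open>\<beta>\<close>, the lowering part of an operator
  contributes nothing, since it would come from an index of higher degree.\<close>

lemma top_coefficient:
  assumes u: "u \<in> A" and "Poly_Mapping.lookup u (\<beta>, i) \<noteq> 0"
  obtains j where "Poly_Mapping.lookup u (\<beta>, j) \<noteq> 0"
    "\<And>j'. deg j < deg j' \<Longrightarrow> Poly_Mapping.lookup u (\<beta>, j') = 0"
    "\<And>l c. Poly_Mapping.lookup (T l c u) (\<beta>, j) = l \<beta> * Poly_Mapping.lookup u (\<beta>, j)"
proof -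
  let ?D = "{j. Poly_Mapping.lookup u (\<beta>, j) \<noteq> 0}"
  have "?D \<subseteq> snd ` Poly_Mapping.keys u" by (force simp: in_keys_iff)
  then have "finite ?D" by (rule finite_subset) simp
  moreover have "i \<in> ?D" using assms by simp
  ultimately have "Max (deg ` ?D) \<in> deg ` ?D" by (intro Max_in) auto
  then obtain j where j: "j \<in> ?D" "deg j = Max (deg ` ?D)" by auto
  have max: "deg j' \<le> deg j" if "j' \<in> ?D" for j'
    using that \<open>finite ?D\<close> by (simp only: j(2)) (intro Max_ge; simp)
  have high: "Poly_Mapping.lookup u (\<beta>, j') = 0" if "deg j < deg j'" for j'
    using max[of j'] that by auto
  have up: "Poly_Mapping.lookup u (\<beta>, j(p := Suc (j p))) = 0" if "p \<in> {1..2 * m}" for p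
    using high deg_upd[OF that, of j "Suc (j p)"] by simp
  have "(\<Sum>p\<in>{1..2 * m}. c p * (of_nat (Suc (j p)) * Poly_Mapping.lookup u (\<beta>, j(p := Suc (j p))))) = 0"
    for c
    by (rule sum.neutral) (simp add: up)
  then have "Poly_Mapping.lookup (T l c u) (\<beta>, j) = l \<beta> * Poly_Mapping.lookup u (\<beta>, j)" for l c
    unfolding lookup_triangular_op by (simp only: add_0_right)
  moreover have "Poly_Mapping.lookup u (\<beta>, j) \<noteq> 0" using j(1) by simp
  ultimately show thesis using that high by blast
qed

text \<open>A separating operator excludes all \<open>\<beta> \<noteq> 0\<close> at a top index; what remains is a polynomial with
  vanishing partial derivatives.\<close>

lemma annihilated_is_scalar:
  assumes u: "u \<in> A" and ann: "\<And>l c. (l, c) \<in> S \<Longrightarrow> T l c u = 0"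
  shows "\<exists>c. u = scalar c"
proof -
  have "Poly_Mapping.lookup u (\<beta>, j) = 0" if "(\<beta>, j) \<noteq> 0" for \<beta> j
  proof (rule ccontr)
    assume nz: "Poly_Mapping.lookup u (\<beta>, j) \<noteq> 0"
    show False
    proof (cases "\<beta> = 0")
      case False
      then obtain l c where lc: "(l, c) \<in> S" "l \<beta> \<noteq> 0" using separating by blast
      obtain j' where "Poly_Mapping.lookup u (\<beta>, j') \<noteq> 0"
        "Poly_Mapping.lookup (T l c u) (\<beta>, j') = l \<beta> * Poly_Mapping.lookup u (\<beta>, j')"
        using top_coefficient[OF u nz] by metis
      then show False using ann[OF lc(1)] lc(2) by simp
    next
      case True
      then have "j \<noteq> 0" using that by (auto simp: zero_prod_def)
      then obtain p where p: "j p \<noteq> 0" by (auto simp: fun_eq_iff)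
      have "j \<in> multi_indices m J" using u nz by (auto simp: ham_A_iff)
      then have Jp: "p \<in> {1..2 * m}" "J p = UNIV" using multi_indices_nonzero[OF J_choice, of j p] p by auto
      then obtain l c where lc: "(l, c) \<in> S" "c p \<noteq> 0"
        "\<And>q. q \<in> {1..2 * m} \<Longrightarrow> q \<noteq> p \<Longrightarrow> J q = UNIV \<Longrightarrow> c q = 0"
        using lowering[OF Jp] by blast
      define i where "i = j(p := j p - 1)"
      have i: "i(p := Suc (i p)) = j" using p by (auto simp: i_def)
      have "c q * (of_nat (Suc (i q)) * Poly_Mapping.lookup u (\<beta>, i(q := Suc (i q)))) = 0"
        if "q \<in> {1..2 * m}" "q \<noteq> p" for q
      proof (cases "J q = UNIV")
        case True
        then show ?thesis using lc(3) that by simp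
      next
        case False
        then have "i(q := Suc (i q)) \<notin> multi_indices m J"
          using multi_indices_nonzero[OF J_choice, of "i(q := Suc (i q))" q] by auto
        then show ?thesis using u by (auto simp: ham_A_iff)
      qed
      then have "(\<Sum>q\<in>{1..2 * m}. c q * (of_nat (Suc (i q)) * Poly_Mapping.lookup u (\<beta>, i(q := Suc (i q)))))
          = c p * (of_nat (Suc (i p)) * Poly_Mapping.lookup u (\<beta>, j))"
        using Jp(1) i by (subst sum.remove[of _ p]) (simp_all add: sum.neutral del: of_nat_Suc)
      then have "Poly_Mapping.lookup (T l c u) (\<beta>, i)
          = c p * (of_nat (Suc (i p)) * Poly_Mapping.lookup u (\<beta>, j))"
        using additive.zero[OF weight_additive[OF lc(1)]] True
        by (simp add: lookup_triangular_op)
      then show False using ann[OF lc(1)] lc(2) nz by (simp del: of_nat_Suc)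
    qed
  qed
  then have "u = scalar (Poly_Mapping.lookup u 0)"
    by (intro poly_mapping_eqI) (auto simp: lookup_single when_def split_paired_all)
  then show ?thesis ..
qed

text \<open>The indices obtained by lowering those that occur in \<open>u\<close>. Unlike the set of monomials of \<open>u\<close>, it
  cannot grow under triangular operators, so its cardinality can serve as a measure of \<open>u\<close>.\<close>

definition shadow :: "('g, 'k) monoid_alg \<Rightarrow> ('g \<times> (nat \<Rightarrow> nat)) set" where
  "shadow u = {(\<beta>, i). \<exists>j. (\<beta>, j) \<in> Poly_Mapping.keys u \<and> i \<le> j}"

lemma finite_shadow:
  assumes "u \<in> A"
  shows "finite (shadow u)"
proof -
  have "finite {i. i \<le> j}" if "j \<in> multi_indices m J" for j
  proof -
    have "{i. i \<le> j} \<subseteq> {i. \<forall>p. (p \<in> {1..2 * m} \<longrightarrow> i p \<in> {..Max (j ` {1..2 * m})}) \<and> (p \<notin> {1..2 * m} \<longrightarrow> i p = 0)}"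
    proof (intro subsetI CollectI allI conjI impI)
      fix i p assume i: "i \<in> {i. i \<le> j}"
      then have ip: "i p \<le> j p" by (simp add: le_fun_def)
      show "i p = 0" if "p \<notin> {1..2 * m}"
        using ip that \<open>j \<in> multi_indices m J\<close> unfolding multi_indices_def by fastforce
      assume "p \<in> {1..2 * m}"
      then have "j p \<le> Max (j ` {1..2 * m})" by (intro Max_ge) auto
      then show "i p \<in> {..Max (j ` {1..2 * m})}" using ip by simp
    qed
    then show ?thesis by (rule finite_subset) (intro finite_set_of_finite_funs; simp)
  qed
  then have "finite (\<Union>(\<beta>, j)\<in>Poly_Mapping.keys u. {\<beta>} \<times> {i. i \<le> j})"
    using assms unfolding ham_A_def by fastforce
  moreover have "shadow u \<subseteq> (\<Union>(\<beta>, j)\<in>Poly_Mapping.keys u. {\<beta>} \<times> {i. i \<le> j})"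
    by (auto simp: shadow_def)
  ultimately show ?thesis by (rule finite_subset[rotated])
qed

text \<open>Subtracting \<open>l \<beta>\<close> removes the diagonal action on the terms with \<open>\<beta>\<close>, so their top indices leave the
  shadow.\<close>

lemma shadow_decreases:
  assumes u: "u \<in> A" and "Poly_Mapping.lookup u (\<beta>, i) \<noteq> 0"
  shows "card (shadow (T l c u - scalar (l \<beta>) * u)) < card (shadow u)"
proof (rule psubset_card_mono[OF finite_shadow[OF u]])
  let ?w = "T l c u - scalar (l \<beta>) * u"
  obtain j where j: "Poly_Mapping.lookup u (\<beta>, j) \<noteq> 0"
    and high: "\<And>j'. deg j < deg j' \<Longrightarrow> Poly_Mapping.lookup u (\<beta>, j') = 0"
    using top_coefficient[OF assms] by metis
  have lw: "Poly_Mapping.lookup ?w (\<gamma>, i) = (l \<gamma> - l \<beta>) * Poly_Mapping.lookup u (\<gamma>, i)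
      + (\<Sum>p\<in>{1..2 * m}. c p * (of_nat (Suc (i p)) * Poly_Mapping.lookup u (\<gamma>, i(p := Suc (i p)))))" for \<gamma> i
    unfolding lookup_minus lookup_scalar_mult lookup_triangular_op by (simp only: algebra_simps)
  have below: "\<exists>i'. i \<le> i' \<and> Poly_Mapping.lookup u (\<gamma>, i') \<noteq> 0 \<and> (\<gamma> = \<beta> \<longrightarrow> deg i < deg i')"
    if "Poly_Mapping.lookup ?w (\<gamma>, i) \<noteq> 0" for \<gamma> i
  proof (cases "\<gamma> \<noteq> \<beta> \<and> Poly_Mapping.lookup u (\<gamma>, i) \<noteq> 0")
    case False
    then have "\<exists>p\<in>{1..2 * m}. Poly_Mapping.lookup u (\<gamma>, i(p := Suc (i p))) \<noteq> 0"
      using that unfolding lw by (auto intro: ccontr)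
    then obtain p where "p \<in> {1..2 * m}" "Poly_Mapping.lookup u (\<gamma>, i(p := Suc (i p))) \<noteq> 0" by blast
    then show ?thesis
      using deg_upd[of p i "Suc (i p)"] by (intro exI[of _ "i(p := Suc (i p))"]) (auto simp: le_fun_def)
  qed auto
  show "shadow ?w \<subset> shadow u"
  proof (rule psubsetI)
    show "shadow ?w \<subseteq> shadow u"
      using below unfolding shadow_def by (fastforce simp: in_keys_iff dest: order_trans)
    have "(\<beta>, j) \<in> shadow u" using j by (auto simp: shadow_def in_keys_iff)
    moreover have "(\<beta>, j) \<notin> shadow ?w"
    proof
      assume "(\<beta>, j) \<in> shadow ?w"
      then obtain j' where j': "j \<le> j'" "Poly_Mapping.lookup ?w (\<beta>, j') \<noteq> 0"
        by (auto simp: shadow_def in_keys_iff)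
      then obtain i' where "Poly_Mapping.lookup u (\<beta>, i') \<noteq> 0" "deg j' < deg i'"
        using below by blast
      moreover have "deg j \<le> deg j'"
        unfolding deg_def using j'(1) by (intro sum_mono) (simp add: le_fun_def)
      ultimately show False using high by force
    qed
    ultimately show "shadow ?w \<noteq> shadow u" by blast
  qed
qed

text \<open>In a nonzero element \<open>u\<close> with the smallest shadow no \<open>T l c - l \<beta>\<close> can lower the shadow further, so
  \<open>u\<close> is a common eigenvector with the eigenvalues of \<open>x\<^sup>\<beta>\<close>. Then \<open>x\<^bsup>-\<beta>\<^esup> u\<close> is killed by the family,
  hence a scalar.\<close>

lemma stable_subspace_contains_mon:
  assumes WA: "W \<subseteq> A" and diff: "\<And>u v. u \<in> W \<Longrightarrow> v \<in> W \<Longrightarrow> u - v \<in> W"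
    and scale: "\<And>u c. u \<in> W \<Longrightarrow> scalar c * u \<in> W"
    and stable: "\<And>l c u. (l, c) \<in> S \<Longrightarrow> u \<in> W \<Longrightarrow> T l c u \<in> W"
    and "w \<in> W" "w \<noteq> 0"
  shows "\<exists>\<beta>. mon \<beta> 0 \<in> W"
proof -
  obtain u where u: "u \<in> W" "u \<noteq> 0"
    and min: "\<And>v. v \<in> W \<Longrightarrow> v \<noteq> 0 \<Longrightarrow> card (shadow u) \<le> card (shadow v)"
    using ex_has_least_nat[of "\<lambda>w. w \<in> W \<and> w \<noteq> 0" w "\<lambda>w. card (shadow w)"] assms(5,6) by blast
  obtain \<beta> i where nz: "Poly_Mapping.lookup u (\<beta>, i) \<noteq> 0"
    using \<open>u \<noteq> 0\<close> by (metis lookup_zero poly_mapping_eqI surj_pair)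
  have uA: "u \<in> A" using u WA by auto
  have eigen: "T l c u = scalar (l \<beta>) * u" if "(l, c) \<in> S" for l c
  proof (rule ccontr)
    assume "\<not> ?thesis"
    then have "T l c u - scalar (l \<beta>) * u \<noteq> 0" by simp
    moreover have "T l c u - scalar (l \<beta>) * u \<in> W"
      using that u by (intro diff stable scale)
    ultimately show False using min shadow_decreases[OF uA nz, of l c] by force
  qed
  define v where "v = mon (- \<beta>) 0 * u"
  have "\<exists>c. v = scalar c"
  proof (rule annihilated_is_scalar)
    show "v \<in> A"
      unfolding v_def by (intro ham_A_mult[OF J_choice] ham_A_single zero_multi_indices[OF J_choice] uA)
    fix l c assume lc: "(l, c) \<in> S"
    have "l (- \<beta>) = - l \<beta>" using additive.minus[OF weight_additive[OF lc]] .
    then show "T l c v = 0"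
      unfolding v_def triangular_op_mon_mult[OF weight_additive[OF lc]] eigen[OF lc]
      by (simp add: single_uminus)
  qed
  then obtain d where d: "v = scalar d" ..
  then have u_eq: "u = scalar d * mon \<beta> 0"
    using mon_inverse(2)[of \<beta> u] unfolding v_def[symmetric] by (simp only: mult.commute)
  then have "d \<noteq> 0" using \<open>u \<noteq> 0\<close> by auto
  then have "scalar (inverse d) * u = mon \<beta> 0"
    by (simp add: u_eq mult.assoc[symmetric] mult_single)
  then show ?thesis using scale[OF u(1)] by metis
qed

text \<open>If \<open>\<gamma> \<noteq> 0\<close>, an operator with \<open>l \<gamma> \<noteq> 0\<close> maps \<open>x\<^bsup>\<gamma>,k\<^esup>\<close> to a nonzero multiple of itself plus terms
  of lower degree, which induction on the degree handles. If \<open>\<gamma> = 0\<close> there is a variable, and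
  antidifferentiation in it reaches every polynomial.\<close>

lemma images_contain_mon:
  assumes zero: "0 \<in> V" and add: "\<And>u v. u \<in> V \<Longrightarrow> v \<in> V \<Longrightarrow> u + v \<in> V"
    and scale: "\<And>u c. u \<in> V \<Longrightarrow> scalar c * u \<in> V"
    and image: "\<And>l c u. (l, c) \<in> S \<Longrightarrow> u \<in> A \<Longrightarrow> T l c u \<in> V"
    and k: "k \<in> multi_indices m J" and "\<gamma> \<noteq> 0 \<or> multi_indices m J \<noteq> {0}"
  shows "mon \<gamma> k \<in> V"
proof -
  have divide: "mon \<gamma> k \<in> V" if "scalar d * mon \<gamma> k \<in> V" "d \<noteq> 0" for d k
    using scale[OF that(1), of "inverse d"] that(2) by (simp add: mult.assoc[symmetric] mult_single)
  show ?thesis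
  proof (cases "\<gamma> = 0")
    case False
    then obtain l c where lc: "(l, c) \<in> S" "l \<gamma> \<noteq> 0" using separating by blast
    show ?thesis
      using k
    proof (induction "deg k" arbitrary: k rule: less_induct)
      case less
      have low: "scalar (c p * of_nat (k p)) * mon \<gamma> (k(p := k p - 1)) \<in> V"
        if p: "p \<in> {1..2 * m}" for p
      proof (cases "k p = 0")
        case False
        have "k(p := k p - 1) \<in> multi_indices m J"
          using multi_indices_upd multi_indices_nonzero[OF J_choice less.prems False] less.prems by blast
        moreover have "deg (k(p := k p - 1)) < deg k"
          using deg_upd[OF p, of k "k p - 1"] False by linarith
        ultimately show ?thesis using less.hyps scale by blast
      qed (simp add: zero)
      have "(\<Sum>p\<in>P. scalar (c p * of_nat (k p)) * mon \<gamma> (k(p := k p - 1))) \<in> V"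
        if "finite P" "P \<subseteq> {1..2 * m}" for P
        using that by (induction P rule: finite_induct) (auto simp: zero intro!: add low simp del: One_nat_def)
      then have "T l c (mon \<gamma> k) + scalar (-1) * (\<Sum>p\<in>{1..2 * m}. scalar (c p * of_nat (k p)) * mon \<gamma> (k(p := k p - 1))) \<in> V"
        by (intro add scale image lc ham_A_single less.prems) auto
      also have "T l c (mon \<gamma> k) + scalar (-1) * (\<Sum>p\<in>{1..2 * m}. scalar (c p * of_nat (k p)) * mon \<gamma> (k(p := k p - 1)))
          = scalar (l \<gamma>) * mon \<gamma> k"
        unfolding triangular_op_mon single_uminus[of 0 1] single_one by (simp only: mult_minus1 add_uminus_conv_diff add_diff_cancel)
      finally have "scalar (l \<gamma>) * mon \<gamma> k \<in> V" .
      then show ?case using divide lc(2) by blast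
    qed
  next
    case True
    then obtain i where i: "i \<in> multi_indices m J" "i \<noteq> 0"
      using assms(6) zero_multi_indices[OF J_choice] by blast
    then obtain p where "i p \<noteq> 0" by (auto simp: fun_eq_iff)
    then have p: "p \<in> {1..2 * m}" "J p = UNIV" using multi_indices_nonzero[OF J_choice i(1)] by auto
    then obtain l c where lc: "(l, c) \<in> S" "c p \<noteq> 0"
      "\<And>q. q \<in> {1..2 * m} \<Longrightarrow> q \<noteq> p \<Longrightarrow> J q = UNIV \<Longrightarrow> c q = 0"
      using lowering[OF p] by blast
    define j where "j = k(p := Suc (k p))"
    have j: "j \<in> multi_indices m J" using k multi_indices_upd p by (simp add: j_def)
    have "scalar (c q * of_nat (j q)) * mon \<gamma> (j(q := j q - 1)) = 0"
      if "q \<in> {1..2 * m}" "q \<noteq> p" for q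
    proof (cases "j q = 0")
      case False
      then have "c q = 0" using lc(3)[OF that] multi_indices_nonzero(2)[OF J_choice j] by blast
      then show ?thesis by simp
    qed simp
    then have "(\<Sum>q\<in>{1..2 * m}. scalar (c q * of_nat (j q)) * mon \<gamma> (j(q := j q - 1)))
        = scalar (c p * of_nat (j p)) * mon \<gamma> (j(p := j p - 1))"
      using p(1) by (subst sum.remove[of _ p]) (auto intro!: sum.neutral)
    moreover have "j(p := j p - 1) = k" "j p \<noteq> 0" by (auto simp: j_def)
    ultimately have "T l c (mon \<gamma> j) = scalar (c p * of_nat (j p)) * mon \<gamma> k"
      using True additive.zero[OF weight_additive[OF lc(1)]] by (simp add: triangular_op_mon)
    then show ?thesis
      using divide image[OF lc(1) ham_A_single[OF j]] lc(2) \<open>j p \<noteq> 0\<close>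
      by (metis mult_eq_0_iff of_nat_eq_0_iff)
  qed
qed

end


section \<open>The Hamiltonian bracket as a Poisson bracket\<close>

lemma derivation_wedge: "derivation d \<Longrightarrow> derivation e \<Longrightarrow> derivation (wedge a d e u)"
  by (simp add: derivation_def wedge_def algebra_simps)

lemma d_full_mon_0: "d_full \<phi> p (mon \<alpha> 0) = scalar (\<phi> p \<alpha>) * mon \<alpha> 0"
  by (simp add: d_full_eq weight_derivation_single d_hat_single scalar_mult_single)

lemma form_product_rank_one:
  "form_product (\<lambda>\<alpha> \<beta>. l \<alpha> * l' \<beta>) u v = weight_derivation l u * weight_derivation l' v"
proof (induction u rule: poly_mapping_additive_induct)
  case (single k c)
  show ?case
  proof (induction v rule: poly_mapping_additive_induct)
    case (single k' c')
    show ?case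
      by (cases k; cases k')
        (simp add: form_product_single_single weight_derivation_single mult_single ac_simps)
  qed (simp add: form_product_add_right weight_derivation_add algebra_simps)
qed (simp add: form_product_add_left weight_derivation_add algebra_simps)

lemma form_product_diff:
  "form_product (\<lambda>\<alpha> \<beta>. F \<alpha> \<beta> - G \<alpha> \<beta>) u v = form_product F u v - form_product G u v"
  by (simp add: form_product_def left_diff_distrib single_diff sum_subtractf case_prod_unfold)

lemma form_product_zero: "form_product (\<lambda>_ _. 0) u v = 0"
  by (simp add: form_product_def case_prod_unfold)

lemma form_product_plus:
  "form_product (\<lambda>\<alpha> \<beta>. F \<alpha> \<beta> + G \<alpha> \<beta>) u v = form_product F u v + form_product G u v"
  by (simp add: form_product_def distrib_right single_add sum.distrib case_prod_unfold)

lemma form_product_sum: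
  "finite I \<Longrightarrow> form_product (\<lambda>\<alpha> \<beta>. \<Sum>i\<in>I. F i \<alpha> \<beta>) u v = (\<Sum>i\<in>I. form_product (F i) u v)"
  by (induction I rule: finite_induct) (simp_all add: form_product_plus form_product_zero)

context hamiltonian_data
begin

abbreviation A where "A \<equiv> ham_A m J :: ('g, 'k) monoid_alg set"
abbreviation \<B> where "\<B> \<equiv> ham_bracket m m1 \<phi> \<Phi> \<sigma>"
abbreviation pd where "pd \<equiv> d_full \<phi>"

lemma J_choice: "\<forall>p\<in>{1..2 * m}. J p = {0} \<or> J p = UNIV"
  using J_cases by blast

text \<open>The summand of the bracket for \<open>q > m1\<close> is the wedge of \<open>\<partial>\<^sub>q\<close> and \<open>\<partial>\<^sub>m\<^sub>+\<^sub>q\<close> minus that of their diagonal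
  parts. The latter is a form product, and moving it into \<open>\<Phi>\<close> produces \<open>\<Psi>\<close>; the remaining
  bracket is a sum of \<open>m\<close> wedges of the same shape, with coefficient \<open>1\<close> instead of \<open>x\<^sup>\<sigma>\<close> for \<open>q > m1\<close>.\<close>

definition coef :: "nat \<Rightarrow> ('g, 'k) monoid_alg" where
  "coef p = mon (if p \<le> m1 then \<sigma> p else 0) 0"

definition \<Psi> :: "'g \<Rightarrow> 'g \<Rightarrow> 'k" where
  "\<Psi> \<alpha> \<beta> = \<Phi> \<alpha> \<beta> - (\<Sum>q\<in>{m1 + 1..m}. \<phi> q \<alpha> * \<phi> (m + q) \<beta> - \<phi> (m + q) \<alpha> * \<phi> q \<beta>)"

lemma sum_split:
  "(\<Sum>p\<in>{1..m}. f p) = (\<Sum>p\<in>{1..m1}. f p) + (\<Sum>p\<in>{m1 + 1..m}. f p)"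
  using m1_le_m sum.ub_add_nat[of 1 m1 f "m - m1"] by simp

lemma phi_add: "p \<in> {1..2 * m} \<Longrightarrow> \<phi> p (\<alpha> + \<beta>) = \<phi> p \<alpha> + \<phi> p \<beta>"
  using additive.add[OF phi_additive] .

lemma derivation_partial: "p \<in> {1..2 * m} \<Longrightarrow> derivation (pd p)"
  by (intro derivation_d_full phi_additive)

lemma Psi_additive: "additive (\<Psi> \<alpha>)"
proof
  fix \<beta> \<gamma>
  have "(\<Sum>q\<in>{m1 + 1..m}. \<phi> q \<alpha> * \<phi> (m + q) (\<beta> + \<gamma>) - \<phi> (m + q) \<alpha> * \<phi> q (\<beta> + \<gamma>))
      = (\<Sum>q\<in>{m1 + 1..m}. (\<phi> q \<alpha> * \<phi> (m + q) \<beta> - \<phi> (m + q) \<alpha> * \<phi> q \<beta>)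
          + (\<phi> q \<alpha> * \<phi> (m + q) \<gamma> - \<phi> (m + q) \<alpha> * \<phi> q \<gamma>))"
    by (rule sum.cong) (auto simp: phi_add algebra_simps)
  then show "\<Psi> \<alpha> (\<beta> + \<gamma>) = \<Psi> \<alpha> \<beta> + \<Psi> \<alpha> \<gamma>"
    using additive.add[OF Phi_additive_right] by (simp add: \<Psi>_def sum.distrib)
qed

lemma Psi_skew: "\<Psi> \<alpha> \<beta> = - \<Psi> \<beta> \<alpha>"
proof -
  have "(\<Sum>q\<in>{m1 + 1..m}. \<phi> q \<alpha> * \<phi> (m + q) \<beta> - \<phi> (m + q) \<alpha> * \<phi> q \<beta>)
      = - (\<Sum>q\<in>{m1 + 1..m}. \<phi> q \<beta> * \<phi> (m + q) \<alpha> - \<phi> (m + q) \<beta> * \<phi> q \<alpha>)"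
    unfolding sum_negf[symmetric] by (rule sum.cong) (auto simp: algebra_simps)
  then show ?thesis
    using Phi_skew[of \<alpha> \<beta>] by (simp add: \<Psi>_def)
qed

lemma bracket_eq:
  "\<B> u v = (\<Sum>p\<in>{1..m}. wedge (coef p) (pd p) (pd (m + p)) u v) + form_product \<Psi> u v"
proof -
  have 1: "form_product \<Psi> u v = form_product \<Phi> u v
      - (\<Sum>q\<in>{m1 + 1..m}. d_phi \<phi> q u * d_phi \<phi> (m + q) v - d_phi \<phi> (m + q) u * d_phi \<phi> q v)"
    unfolding \<Psi>_def[abs_def] form_product_diff form_product_sum[OF finite_atLeastAtMost]
      form_product_rank_one d_phi_eq_weight_derivation ..
  have 2: "(\<Sum>p\<in>{1..m}. wedge (coef p) (pd p) (pd (m + p)) u v)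
      = (\<Sum>p\<in>{1..m1}. wedge (coef p) (pd p) (pd (m + p)) u v)
        + (\<Sum>p\<in>{m1 + 1..m}. wedge (coef p) (pd p) (pd (m + p)) u v)"
    by (rule sum_split)
  have 3: "(\<Sum>p\<in>{1..m1}. wedge (coef p) (pd p) (pd (m + p)) u v)
      = (\<Sum>p\<in>{1..m1}. Poly_Mapping.single (\<sigma> p, 0) 1 * (pd p u * pd (m + p) v - pd (m + p) u * pd p v))"
    by (rule sum.cong) (auto simp: wedge_def coef_def)
  have 4: "(\<Sum>q\<in>{m1 + 1..m}. pd q u * d_hat (m + q) v + d_hat q u * d_phi \<phi> (m + q) v
        - d_hat (m + q) u * pd q v - d_phi \<phi> (m + q) u * d_hat q v)
      = (\<Sum>p\<in>{m1 + 1..m}. wedge (coef p) (pd p) (pd (m + p)) u v)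
      - (\<Sum>q\<in>{m1 + 1..m}. d_phi \<phi> q u * d_phi \<phi> (m + q) v - d_phi \<phi> (m + q) u * d_phi \<phi> q v)"
    unfolding sum_subtractf[symmetric]
    by (rule sum.cong) (auto simp: wedge_def coef_def mon_zero d_full_def algebra_simps)
  show ?thesis
    unfolding 1 2 3 ham_bracket_def 4 by (simp add: algebra_simps)
qed

lemma index_range:
  assumes "p \<in> {1..m}"
  shows "p \<in> {1..2 * m}" "m + p \<in> {1..2 * m}"
  using assms by auto

lemma sigma_radical:
  assumes "p \<in> {1..m1}"
  shows "\<Phi> (\<sigma> p) \<alpha> = 0" "\<Phi> \<alpha> (\<sigma> p) = 0"
  using sigma_mem[OF assms] Phi_skew[of \<alpha> "\<sigma> p"] by (auto simp: radical_def)

lemma phi_sigma: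
  assumes "p \<in> {1..m1}" "q \<in> {1..2 * m} - {p, m + p}"
  shows "\<phi> q (\<sigma> p) = 0"
  using sigma_mem[OF assms(1)] assms(2) by (auto simp: ker_def)

lemma Psi_sigma:
  assumes "p \<in> {1..m1}"
  shows "\<Psi> \<alpha> (\<sigma> p) = 0"
proof -
  have "\<phi> q (\<sigma> p) = 0" "\<phi> (m + q) (\<sigma> p) = 0" if "q \<in> {m1 + 1..m}" for q
    using phi_sigma[OF assms, of q] phi_sigma[OF assms, of "m + q"] that assms m1_le_m by auto
  then show ?thesis by (simp add: \<Psi>_def sigma_radical[OF assms])
qed

lemma partial_coef:
  assumes "p \<in> {1..m}" "q \<in> {1..2 * m} - {p, m + p}"
  shows "pd q (coef p) = 0"
  using phi_sigma[of p q] assms additive.zero[OF phi_additive, of q]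
  by (auto simp: coef_def d_full_mon_0)

lemma form_product_coef:
  assumes "p \<in> {1..m}"
  shows "form_product \<Psi> u (coef p) = 0"
proof -
  have z: "\<Psi> \<alpha> (if p \<le> m1 then \<sigma> p else 0) = 0" for \<alpha>
    using assms Psi_sigma[of p] additive.zero[OF Psi_additive] by auto
  show ?thesis
  proof (induction u rule: poly_mapping_additive_induct)
    case (single k c)
    show ?case
      by (cases k) (simp only: coef_def form_product_single_single z mult_zero_left single_zero)
  qed (simp add: form_product_add_left)
qed

lemma derivation_bracket: "derivation (\<B> u)"
proof -
  have "derivation (\<lambda>v. (\<Sum>p\<in>{1..m}. wedge (coef p) (pd p) (pd (m + p)) u v) + form_product \<Psi> u v)"
    by (intro derivation_plus derivation_sum derivation_wedge derivation_partial
        derivation_form_product Psi_additive) (auto dest: index_range)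
  then show ?thesis by (simp add: bracket_eq[abs_def])
qed

lemma bracket_skew: "\<B> u v = - \<B> v u"
proof -
  have "wedge a d e u v = - wedge a d e v u" for a d e and u v :: "('g, 'k) monoid_alg"
    by (simp add: wedge_def algebra_simps)
  then have "(\<Sum>p\<in>{1..m}. wedge (coef p) (pd p) (pd (m + p)) u v)
      = - (\<Sum>p\<in>{1..m}. wedge (coef p) (pd p) (pd (m + p)) v u)"
    unfolding sum_negf[symmetric] by (rule sum.cong[OF refl])
  then show ?thesis
    using form_product_skew[of \<Psi>, OF Psi_skew, of u v] by (simp add: bracket_eq)
qed

text \<open>Distinct wedges are compatible because \<open>\<sigma>\<^sub>p\<close> is killed by all \<open>\<phi>\<^sub>q\<close> with \<open>q \<notin> {p, m + p}\<close>, and a wedge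
  is compatible with the form because \<open>\<sigma>\<^sub>p\<close> is in the radical of \<open>\<Psi>\<close>.\<close>

lemma bracket_compatible: "compatible \<B> \<B>"
proof -
  let ?W = "\<lambda>p. wedge (coef p) (pd p) (pd (m + p))"
  note der = derivation_partial[OF index_range(1)] derivation_partial[OF index_range(2)]
  have W: "compatible (?W p) (?W q)" if pq: "p \<in> {1..m}" "q \<in> {1..m}" for p q
  proof (cases "p = q")
    case True
    then show ?thesis
      by (simp only:) (intro compatible_wedge_self der d_full_commute pq)
  next
    case False
    show ?thesis
      by (intro compatible_wedge_wedge der d_full_commute partial_coef pq)
        (use pq False in auto)
  qed
  have WP: "compatible (?W p) (form_product \<Psi>)" if "p \<in> {1..m}" for p
    by (intro compatible_wedge_form der derivation_form_product Psi_additive d_full_form_product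
        form_product_skew Psi_skew form_product_coef phi_additive index_range that)
  have PP: "compatible (form_product \<Psi>) (form_product \<Psi>)"
    by (intro compatible_form_product_self Psi_skew Psi_additive)
  have addW: "?W p u (v + w) = ?W p u v + ?W p u w" if "p \<in> {1..m}" for p u v w
    by (intro derivation_add derivation_wedge der that)
  have addB: "\<B> u (v + w) = \<B> u v + \<B> u w" for u v w
    by (intro derivation_add derivation_bracket)
  have B: "\<B> = (\<lambda>u v. (\<Sum>p\<in>{1..m}. ?W p u v) + form_product \<Psi> u v)"
    by (intro ext bracket_eq)
  have BW: "compatible \<B> (?W p)" if p: "p \<in> {1..m}" for p
  proof -
    have "compatible (?W p) (\<lambda>u v. (\<Sum>q\<in>{1..m}. ?W q u v) + form_product \<Psi> u v)"
      by (rule compatible_add[OF addW[OF p] compatible_sum[OF addW[OF p] _ W[OF p]] WP[OF p]]) auto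
    then show ?thesis unfolding B by (rule compatible_sym)
  qed
  have BP: "compatible \<B> (form_product \<Psi>)"
  proof -
    have "compatible (form_product \<Psi>) (\<lambda>u v. (\<Sum>q\<in>{1..m}. ?W q u v) + form_product \<Psi> u v)"
      by (rule compatible_add[OF form_product_add_right compatible_sum[OF form_product_add_right _
            compatible_sym[OF WP]] PP]) auto
    then show ?thesis unfolding B by (rule compatible_sym)
  qed
  have "compatible \<B> (\<lambda>u v. \<Sum>p\<in>{1..m}. ?W p u v)"
    by (rule compatible_sum) (simp_all add: addB BW)
  then have "compatible \<B> (\<lambda>u v. (\<Sum>p\<in>{1..m}. ?W p u v) + form_product \<Psi> u v)"
    by (rule compatible_add[rotated]) (simp_all add: addB BP)
  then show ?thesis unfolding B[symmetric] .
qed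

sublocale poisson_bracket \<B>
proof
  fix u v w :: "('g, 'k) monoid_alg"
  show "\<B> u (v + w) = \<B> u v + \<B> u w" "\<B> u (v * w) = v * \<B> u w + w * \<B> u v"
    by (intro derivation_add derivation_mult derivation_bracket)+
  show "\<B> u v = - \<B> v u" by (rule bracket_skew)
  show "u = 0" if "0 < n" "of_nat n * u = 0" for n
    using torsion_free_monoid_alg that .
  have "jacobiator \<B> \<B> u v w + jacobiator \<B> \<B> u v w = 0"
    using bracket_compatible by (simp add: compatible_def)
  then have "of_nat 2 * jacobiator \<B> \<B> u v w = 0"
    by (metis mult_2 of_nat_numeral)
  then have "jacobiator \<B> \<B> u v w = 0"
    by (rule torsion_free_monoid_alg[rotated]) simp
  then show "\<B> u (\<B> v w) + \<B> v (\<B> w u) + \<B> w (\<B> u v) = 0"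
    by (simp add: jacobiator_def)
qed

lemma bracket_closed: "u \<in> A \<Longrightarrow> v \<in> A \<Longrightarrow> \<B> u v \<in> A"
  unfolding bracket_eq wedge_def coef_def
  by (intro ham_A_add ham_A_sum ham_A_mult[OF J_choice] ham_A_diff ham_A_d_full[OF J_choice]
      ham_A_form_product[OF J_choice] ham_A_single zero_multi_indices[OF J_choice])


section \<open>The operators generated by the bracket\<close>

text \<open>The bracket with the unit \<open>x\<^sup>\<alpha>\<close>, shifted back so that it preserves the grading by \<open>\<Gamma>\<close> up to the
  factors \<open>x\<^sup>\<sigma>\<close>.\<close>

definition E :: "'g \<Rightarrow> ('g, 'k) monoid_alg \<Rightarrow> ('g, 'k) monoid_alg" where
  "E \<alpha> u = mon (- \<alpha>) 0 * \<B> (mon \<alpha> 0) u"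

lemma E_eq:
  "E \<alpha> u = (\<Sum>p\<in>{1..m}. coef p * (scalar (\<phi> p \<alpha>) * pd (m + p) u - scalar (\<phi> (m + p) \<alpha>) * pd p u))
    + weight_derivation (\<Psi> \<alpha>) u"
proof -
  have "\<B> (mon \<alpha> 0) u = mon \<alpha> 0 * ((\<Sum>p\<in>{1..m}. coef p * (scalar (\<phi> p \<alpha>) * pd (m + p) u - scalar (\<phi> (m + p) \<alpha>) * pd p u))
      + weight_derivation (\<Psi> \<alpha>) u)"
    unfolding bracket_eq wedge_def d_full_mon_0 form_product_single distrib_left sum_distrib_left
    by (intro arg_cong2[where f = "(+)"] sum.cong refl) (simp add: algebra_simps)
  then show ?thesis unfolding E_def by (simp only: mon_inverse)
qed

text \<open>The polynomial variables; \<open>t p\<close> belongs to \<open>A\<close> if \<open>J p\<close> is the set of all natural numbers.\<close>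

definition t :: "nat \<Rightarrow> ('g, 'k) monoid_alg" where
  "t p = mon 0 (0(p := 1))"

lemma partial_t:
  assumes "q \<in> {1..2 * m}"
  shows "pd q (t p) = (if q = p then 1 else 0)"
proof -
  have "(0(p := 1))(p := 0) = (0 :: nat \<Rightarrow> nat)" by auto
  then show ?thesis
    using additive.zero[OF phi_additive[OF assms]]
    by (simp add: t_def d_full_eq weight_derivation_single d_hat_single mon_zero)
qed

lemma bracket_t:
  assumes "p \<in> {1..m}"
  shows "\<B> (t p) u = coef p * pd (m + p) u" "\<B> (t (m + p)) u = - (coef p * pd p u)"
proof -
  have ft: "form_product \<Psi> (t q) u = 0" for q
  proof -
    have "form_product \<Psi> (t q) u = - form_product \<Psi> u (t q)"
      by (intro form_product_skew Psi_skew)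
    moreover have "form_product \<Psi> u (t q) = 0"
    proof (induction u rule: poly_mapping_additive_induct)
      case (single k c)
      show ?case
        by (cases k) (simp add: t_def form_product_single_single additive.zero[OF Psi_additive])
    qed (simp add: form_product_add_left)
    ultimately show ?thesis by simp
  qed
  have "\<B> (t p) u = (\<Sum>q\<in>{1..m}. if q = p then coef p * pd (m + p) u else 0)"
    unfolding bracket_eq ft add_0_right wedge_def using assms by (intro sum.cong refl) (auto simp: partial_t)
  then show "\<B> (t p) u = coef p * pd (m + p) u" using assms by simp
  have "\<B> (t (m + p)) u = (\<Sum>q\<in>{1..m}. if q = p then - (coef p * pd p u) else 0)"
    unfolding bracket_eq ft add_0_right wedge_def using assms by (intro sum.cong refl) (auto simp: partial_t)
  then show "\<B> (t (m + p)) u = - (coef p * pd p u)" using assms by simp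
qed

text \<open>What is left of \<open>E \<alpha>\<close> when the summands with a factor \<open>x\<^sup>\<sigma>\<close> are removed.\<close>

definition F :: "'g \<Rightarrow> ('g, 'k) monoid_alg \<Rightarrow> ('g, 'k) monoid_alg" where
  "F \<alpha> u = weight_derivation (\<Psi> \<alpha>) u
    + (\<Sum>q\<in>{m1 + 1..m}. scalar (\<phi> q \<alpha>) * pd (m + q) u - scalar (\<phi> (m + q) \<alpha>) * pd q u)"

text \<open>A property of operators is established on the operators that the bracket provides directly and
  then transferred to simpler ones. It is applied to three properties of an operator \<open>f\<close>: \<open>f\<close> kills
  a given element, \<open>f\<close> preserves a given ideal, \<open>f\<close> maps \<open>A\<close> into \<open>{A, A}\<close>.\<close>

definition contains_generators :: "((('g, 'k) monoid_alg \<Rightarrow> ('g, 'k) monoid_alg) \<Rightarrow> bool) \<Rightarrow> bool" where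
  "contains_generators Q \<longleftrightarrow>
    (\<forall>f g. Q f \<longrightarrow> Q g \<longrightarrow> Q (\<lambda>u. f u + g u)) \<and> (\<forall>f c. Q f \<longrightarrow> Q (\<lambda>u. scalar c * f u)) \<and>
    (\<forall>\<alpha>. Q (E \<alpha>)) \<and> (\<forall>p\<in>{1..2 * m}. J p = UNIV \<longrightarrow> Q (\<B> (t p)))"

text \<open>For \<open>p \<le> m1\<close> and \<open>\<phi> p \<noteq> 0\<close>, an \<open>\<alpha>\<close> in the radical on which only \<open>\<phi> p\<close> is nonzero makes \<open>E \<alpha>\<close> a multiple of
  \<open>x\<^sup>\<sigma> \<partial>\<^sub>m\<^sub>+\<^sub>p\<close>; if \<open>\<phi> p = 0\<close>, the variable \<open>t p\<close> exists and its bracket is this operator. These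
  operators serve to clear \<open>E \<alpha>\<close> of its first \<open>m1\<close> summands, which leaves \<open>F \<alpha>\<close>.\<close>

lemma operators_generated:
  assumes Q: "contains_generators Q"
  shows "p \<in> {1..m1} \<Longrightarrow> Q (\<lambda>u. coef p * pd p u)"
    and "p \<in> {1..m1} \<Longrightarrow> Q (\<lambda>u. coef p * pd (m + p) u)"
    and "q \<in> {m1 + 1..m} \<Longrightarrow> J (m + q) = UNIV \<Longrightarrow> Q (pd q)"
    and "q \<in> {m1 + 1..m} \<Longrightarrow> J q = UNIV \<Longrightarrow> Q (pd (m + q))"
    and "Q (F \<alpha>)"
proof -
  have add: "Q (\<lambda>u. f u + g u)" if "Q f" "Q g" for f g
    using Q that by (simp add: contains_generators_def)
  have scale: "Q (\<lambda>u. scalar c * f u)" if "Q f" for f c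
    using Q that by (simp add: contains_generators_def)
  have E: "Q (E \<alpha>)" for \<alpha>
    using Q by (simp add: contains_generators_def)
  have t: "Q (\<B> (t p))" if "p \<in> {1..2 * m}" "J p = UNIV" for p
    using Q that by (simp add: contains_generators_def)
  have uminus: "Q (\<lambda>u. - f u)" if "Q f" for f
    using scale[OF that, of "-1"] by (simp add: single_uminus)
  have cancel: "scalar (inverse x) * (a * (scalar x * u)) = a * u"
    if "x \<noteq> 0" for x and a u :: "('g, 'k) monoid_alg"
  proof -
    have "scalar (inverse x) * (a * (scalar x * u)) = (scalar (inverse x) * scalar x) * (a * u)"
      by (simp only: ac_simps)
    also have "(scalar (inverse x) * scalar x :: ('g, 'k) monoid_alg) = 1"
      using that by (simp add: mult_single)
    finally show ?thesis by simp
  qed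
  have m1: "p \<in> {1..m}" if "p \<in> {1..m1}" for p using that m1_le_m by auto
  have bt: "\<B> (t p) = (\<lambda>u. coef p * pd (m + p) u)" if "p \<in> {1..m}" for p
    using bracket_t(1)[OF that] by blast
  have radical: "\<exists>\<alpha>. \<phi> r \<alpha> \<noteq> 0 \<and> E \<alpha> = (\<lambda>u. \<Sum>p\<in>{1..m}. coef p * (scalar (\<phi> p \<alpha>) * pd (m + p) u - scalar (\<phi> (m + p) \<alpha>) * pd p u))
      \<and> (\<forall>q\<in>{1..2 * m} - {r}. \<phi> q \<alpha> = 0)"
    if r: "r \<in> {1..m1} \<union> {m + 1..m + m1}" "\<phi> r \<noteq> 0" for r
  proof -
    obtain \<alpha> where \<alpha>: "\<alpha> \<in> radical \<Phi>" "\<forall>q\<in>{1..2 * m} - {r}. \<phi> q \<alpha> = 0" "\<phi> r \<alpha> \<noteq> 0"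
      using phi_independent_radical[OF r] by (auto simp: ker_def)
    have "\<phi> q \<alpha> = 0" "\<phi> (m + q) \<alpha> = 0" if "q \<in> {m1 + 1..m}" for q
      using \<alpha>(2) that r(1) m1_le_m by auto
    then have "\<Psi> \<alpha> = (\<lambda>_. 0)"
      using \<alpha>(1) by (auto simp: \<Psi>_def radical_def fun_eq_iff)
    then have "weight_derivation (\<Psi> \<alpha>) u = 0" for u
      by (intro poly_mapping_eqI) (auto simp: lookup_weight_derivation split_paired_all)
    then show ?thesis using \<alpha> by (intro exI[of _ \<alpha>]) (auto simp: E_eq fun_eq_iff)
  qed
  show 1: "Q (\<lambda>u. coef p * pd p u)" if p: "p \<in> {1..m1}" for p
  proof (cases "\<phi> (m + p) = 0")
    case True
    then have "J (m + p) = UNIV" using phi_or_J[of "m + p"] J_cases[of "m + p"] m1[OF p] by auto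
    then show ?thesis
      using uminus[OF t[of "m + p"]] index_range[OF m1[OF p]] bracket_t(2)[OF m1[OF p]] by simp
  next
    case False
    obtain \<alpha> where \<alpha>: "\<phi> (m + p) \<alpha> \<noteq> 0" "\<forall>q\<in>{1..2 * m} - {m + p}. \<phi> q \<alpha> = 0"
      and E\<alpha>: "E \<alpha> = (\<lambda>u. \<Sum>p\<in>{1..m}. coef p * (scalar (\<phi> p \<alpha>) * pd (m + p) u - scalar (\<phi> (m + p) \<alpha>) * pd p u))"
      using radical[of "m + p"] False p by auto
    have "E \<alpha> u = (\<Sum>q\<in>{1..m}. if q = p then - (coef p * (scalar (\<phi> (m + p) \<alpha>) * pd p u)) else 0)" for u
      unfolding E\<alpha> using \<alpha>(2) m1[OF p] by (intro sum.cong refl) auto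
    then have "E \<alpha> = (\<lambda>u. - (coef p * (scalar (\<phi> (m + p) \<alpha>) * pd p u)))"
      using m1[OF p] by (simp add: fun_eq_iff)
    then have "Q (\<lambda>u. scalar (inverse (\<phi> (m + p) \<alpha>)) * (coef p * (scalar (\<phi> (m + p) \<alpha>) * pd p u)))"
      using scale[OF uminus[OF E[of \<alpha>]]] by simp
    also have "(\<lambda>u. scalar (inverse (\<phi> (m + p) \<alpha>)) * (coef p * (scalar (\<phi> (m + p) \<alpha>) * pd p u)))
        = (\<lambda>u. coef p * pd p u)"
      by (simp only: cancel[OF \<alpha>(1)])
    finally show ?thesis .
  qed
  show 2: "Q (\<lambda>u. coef p * pd (m + p) u)" if p: "p \<in> {1..m1}" for p
  proof (cases "\<phi> p = 0")
    case True
    then have "J p = UNIV" using phi_or_J[of p] J_cases[of p] m1[OF p] by auto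
    then show ?thesis
      using t[of p] index_range[OF m1[OF p]] by (simp only: bt[OF m1[OF p]])
  next
    case False
    obtain \<alpha> where \<alpha>: "\<phi> p \<alpha> \<noteq> 0" "\<forall>q\<in>{1..2 * m} - {p}. \<phi> q \<alpha> = 0"
      and E\<alpha>: "E \<alpha> = (\<lambda>u. \<Sum>p\<in>{1..m}. coef p * (scalar (\<phi> p \<alpha>) * pd (m + p) u - scalar (\<phi> (m + p) \<alpha>) * pd p u))"
      using radical[of p] False p by auto
    have "E \<alpha> u = (\<Sum>q\<in>{1..m}. if q = p then coef p * (scalar (\<phi> p \<alpha>) * pd (m + p) u) else 0)" for u
      unfolding E\<alpha> using \<alpha>(2) m1[OF p] by (intro sum.cong refl) auto
    then have "E \<alpha> = (\<lambda>u. coef p * (scalar (\<phi> p \<alpha>) * pd (m + p) u))"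
      using m1[OF p] by (simp add: fun_eq_iff)
    then have "Q (\<lambda>u. scalar (inverse (\<phi> p \<alpha>)) * (coef p * (scalar (\<phi> p \<alpha>) * pd (m + p) u)))"
      using scale[OF E[of \<alpha>]] by simp
    also have "(\<lambda>u. scalar (inverse (\<phi> p \<alpha>)) * (coef p * (scalar (\<phi> p \<alpha>) * pd (m + p) u)))
        = (\<lambda>u. coef p * pd (m + p) u)"
      by (simp only: cancel[OF \<alpha>(1)])
    finally show ?thesis .
  qed
  show "Q (pd q)" if q: "q \<in> {m1 + 1..m}" "J (m + q) = UNIV" for q
    using uminus[OF t[of "m + q"]] bracket_t(2)[of q] q by (simp add: coef_def mon_zero)
  show "Q (pd (m + q))" if q: "q \<in> {m1 + 1..m}" "J q = UNIV" for q
    using t[of q] bt[of q] q by (simp add: coef_def mon_zero)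
  show "Q (F \<alpha>)"
  proof -
    let ?f = "\<lambda>p u. coef p * (scalar (\<phi> p \<alpha>) * pd (m + p) u - scalar (\<phi> (m + p) \<alpha>) * pd p u)"
    have f: "Q (?f p)" if p: "p \<in> {1..m1}" for p
    proof -
      have "Q (\<lambda>u. scalar (\<phi> p \<alpha>) * (coef p * pd (m + p) u) + scalar (- \<phi> (m + p) \<alpha>) * (coef p * pd p u))"
        by (intro add scale 1 2 p)
      then show ?thesis by (simp add: single_uminus algebra_simps)
    qed
    have "P \<subseteq> {1..m1} \<Longrightarrow> Q (\<lambda>u. E \<alpha> u - (\<Sum>p\<in>P. ?f p u))" if "finite P" for P
      using that
    proof (induction P rule: finite_induct)
      case (insert p P)
      have "Q (\<lambda>u. (E \<alpha> u - (\<Sum>p\<in>P. ?f p u)) + - ?f p u)"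
        using insert by (intro add uminus f) auto
      also have "(\<lambda>u. (E \<alpha> u - (\<Sum>p\<in>P. ?f p u)) + - ?f p u) = (\<lambda>u. E \<alpha> u - (\<Sum>p\<in>insert p P. ?f p u))"
        using insert by (simp add: fun_eq_iff)
      finally show ?case .
    qed (simp add: E)
    then have "Q (\<lambda>u. E \<alpha> u - (\<Sum>p\<in>{1..m1}. ?f p u))" by simp
    also have "(\<lambda>u. E \<alpha> u - (\<Sum>p\<in>{1..m1}. ?f p u)) = F \<alpha>"
    proof
      fix u
      have "(\<Sum>p\<in>{1..m}. ?f p u) = (\<Sum>p\<in>{1..m1}. ?f p u) + (\<Sum>p\<in>{m1 + 1..m}. ?f p u)"
        by (rule sum_split)
      moreover have "(\<Sum>p\<in>{m1 + 1..m}. ?f p u)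
          = (\<Sum>q\<in>{m1 + 1..m}. scalar (\<phi> q \<alpha>) * pd (m + q) u - scalar (\<phi> (m + q) \<alpha>) * pd q u)"
        by (rule sum.cong) (auto simp: coef_def mon_zero)
      ultimately show "E \<alpha> u - (\<Sum>p\<in>{1..m1}. ?f p u) = F \<alpha> u"
        by (simp add: E_eq F_def)
    qed
    finally show ?thesis .
  qed
qed

end


interpretation monoid_alg: vector_space
  "\<lambda>c u. scalar c * u :: ('g::ab_group_add, 'k::field_char_0) monoid_alg"
  by unfold_locales (simp_all add: distrib_left distrib_right single_add mult_single mult.assoc[symmetric])

context hamiltonian_data
begin

text \<open>The coefficients of the lowering part of \<open>F \<alpha>\<close>. Its diagonal part is \<open>\<Phi> \<alpha>\<close>: the passage from \<open>\<Phi>\<close> to \<open>\<Psi>\<close> is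
  undone by the diagonal parts of the \<open>\<partial>\<^sub>q\<close> in \<open>F \<alpha>\<close>.\<close>

definition lower_coeffs :: "'g \<Rightarrow> nat \<Rightarrow> 'k" where
  "lower_coeffs \<alpha> r = (if r \<in> {m1 + 1..m} then - \<phi> (m + r) \<alpha>
    else if r \<in> {m + m1 + 1..2 * m} then \<phi> (r - m) \<alpha> else 0)"

text \<open>The indices \<open>p\<close> whose operator \<open>\<partial>\<^sub>p\<close> is provided by \<open>operators_generated\<close>.\<close>

definition dirs :: "nat set" where
  "dirs = {1..m1} \<union> (\<lambda>p. m + p) ` {1..m1} \<union> {q \<in> {m1 + 1..m}. J (m + q) = UNIV}
    \<union> (\<lambda>q. m + q) ` {q \<in> {m1 + 1..m}. J q = UNIV}"

definition ops :: "(('g \<Rightarrow> 'k) \<times> (nat \<Rightarrow> 'k)) set" where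
  "ops = (\<lambda>p. (\<phi> p, \<lambda>q. if q = p then 1 else 0)) ` dirs \<union> range (\<lambda>\<alpha>. (\<Phi> \<alpha>, lower_coeffs \<alpha>))"

lemma dirs_subset: "dirs \<subseteq> {1..2 * m}"
  using m1_le_m by (auto simp: dirs_def)

text \<open>In the missing directions the partner of \<open>p\<close> has no variable, which forces \<open>\<phi> p = 0\<close> and
  \<open>\<phi> \<noteq> 0\<close> at the partner.\<close>

lemma not_in_dirs:
  assumes p: "p \<in> {1..2 * m}" "p \<notin> dirs"
  obtains "p \<in> {m1 + 1..m}" "J (m + p) = {0}"
  | r where "p = m + r" "r \<in> {m1 + 1..m}" "J r = {0}"
proof (cases "p \<le> m")
  case True
  then show ?thesis
    using p that(1) J_cases[of "m + p"] by (auto simp: dirs_def)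
next
  case False
  define r where "r = p - m"
  have r: "p = m + r" "r \<in> {1..m}" using False p(1) by (auto simp: r_def)
  then have "r \<notin> {1..m1}" "\<not> (r \<in> {m1 + 1..m} \<and> J r = UNIV)"
    using p(2) by (auto simp: dirs_def)
  then show ?thesis using r that(2)[of r] J_cases[of r] by auto
qed

lemma partial_triangular:
  assumes "p \<in> {1..2 * m}"
  shows "triangular_op (2 * m) (\<phi> p) (\<lambda>q. if q = p then 1 else 0) = pd p"
proof
  fix u :: "('g, 'k) monoid_alg"
  have "(\<Sum>q\<in>{1..2 * m}. scalar (if q = p then 1 else 0) * d_hat q u)
      = (\<Sum>q\<in>{1..2 * m}. if q = p then d_hat p u else 0)"
    by (rule sum.cong) auto
  then show "triangular_op (2 * m) (\<phi> p) (\<lambda>q. if q = p then 1 else 0) u = pd p u"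
    using assms by (simp add: triangular_op_def d_full_eq)
qed

lemma F_triangular: "triangular_op (2 * m) (\<Phi> \<alpha>) (lower_coeffs \<alpha>) = F \<alpha>"
proof (intro ext poly_mapping_eqI)
  fix u :: "('g, 'k) monoid_alg" and k :: "'g \<times> (nat \<Rightarrow> nat)"
  obtain \<beta> j where k: "k = (\<beta>, j)" by (cases k)
  define x where "x = Poly_Mapping.lookup u (\<beta>, j)"
  define y where "y r = Poly_Mapping.lookup (d_hat r u) (\<beta>, j)" for r
  let ?c = "lower_coeffs \<alpha>"
  have "(\<Sum>r\<in>{1..2 * m}. ?c r * y r) = (\<Sum>r\<in>{1..m}. ?c r * y r) + (\<Sum>r\<in>{1..m}. ?c (m + r) * y (m + r))"
    using sum.ub_add_nat[of 1 m "\<lambda>r. ?c r * y r" m] sum.shift_bounds_cl_nat_ivl[of "\<lambda>r. ?c r * y r" 1 m m]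
    by (simp add: mult_2 add.commute)
  also have "\<dots> = (\<Sum>r\<in>{m1 + 1..m}. ?c r * y r) + (\<Sum>r\<in>{m1 + 1..m}. ?c (m + r) * y (m + r))"
  proof -
    have "(\<Sum>r\<in>{1..m1}. ?c r * y r) = 0" "(\<Sum>r\<in>{1..m1}. ?c (m + r) * y (m + r)) = 0"
      using m1_le_m by (auto simp: lower_coeffs_def intro!: sum.neutral)
    then show ?thesis by (simp only: sum_split add_0)
  qed
  also have "\<dots> = (\<Sum>q\<in>{m1 + 1..m}. \<phi> q \<alpha> * y (m + q) - \<phi> (m + q) \<alpha> * y q)"
    unfolding sum.distrib[symmetric] by (rule sum.cong) (auto simp: lower_coeffs_def)
  finally have 1: "(\<Sum>r\<in>{1..2 * m}. ?c r * y r) = (\<Sum>q\<in>{m1 + 1..m}. \<phi> q \<alpha> * y (m + q) - \<phi> (m + q) \<alpha> * y q)" .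
  have "Poly_Mapping.lookup (F \<alpha> u) k = \<Psi> \<alpha> \<beta> * x
      + (\<Sum>q\<in>{m1 + 1..m}. \<phi> q \<alpha> * (\<phi> (m + q) \<beta> * x + y (m + q)) - \<phi> (m + q) \<alpha> * (\<phi> q \<beta> * x + y q))"
    by (simp add: F_def k lookup_add lookup_sum lookup_minus lookup_scalar_mult d_full_eq
        lookup_weight_derivation x_def y_def)
  also have "\<dots> = \<Phi> \<alpha> \<beta> * x + (\<Sum>q\<in>{m1 + 1..m}. \<phi> q \<alpha> * y (m + q) - \<phi> (m + q) \<alpha> * y q)"
  proof -
    have "(\<Sum>q\<in>{m1 + 1..m}. \<phi> q \<alpha> * (\<phi> (m + q) \<beta> * x + y (m + q)) - \<phi> (m + q) \<alpha> * (\<phi> q \<beta> * x + y q))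
        = (\<Sum>q\<in>{m1 + 1..m}. \<phi> q \<alpha> * \<phi> (m + q) \<beta> - \<phi> (m + q) \<alpha> * \<phi> q \<beta>) * x
          + (\<Sum>q\<in>{m1 + 1..m}. \<phi> q \<alpha> * y (m + q) - \<phi> (m + q) \<alpha> * y q)"
      unfolding sum_distrib_right sum.distrib[symmetric]
      by (rule sum.cong) (simp_all add: algebra_simps)
    then show ?thesis by (simp only: \<Psi>_def left_diff_distrib) simp
  qed
  finally have 2: "Poly_Mapping.lookup (F \<alpha> u) k
      = \<Phi> \<alpha> \<beta> * x + (\<Sum>q\<in>{m1 + 1..m}. \<phi> q \<alpha> * y (m + q) - \<phi> (m + q) \<alpha> * y q)" .
  show "Poly_Mapping.lookup (triangular_op (2 * m) (\<Phi> \<alpha>) ?c u) k = Poly_Mapping.lookup (F \<alpha> u) k"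
    unfolding 2 1[symmetric] unfolding triangular_op_def k lookup_add lookup_sum lookup_scalar_mult
      lookup_weight_derivation x_def y_def ..
qed

text \<open>Transfers the conclusions of \<open>operators_generated\<close> to the members of the family, together with the
  weight of each, which decides whether the operator commutes with a given \<open>x\<^sup>\<beta>\<close>.\<close>

lemma ops_rule:
  assumes "(l, c) \<in> ops"
    and "\<And>p. p \<in> {1..m1} \<Longrightarrow> P (\<phi> p) (pd p)" "\<And>p. p \<in> {1..m1} \<Longrightarrow> P (\<phi> (m + p)) (pd (m + p))"
    and "\<And>q. q \<in> {m1 + 1..m} \<Longrightarrow> J (m + q) = UNIV \<Longrightarrow> P (\<phi> q) (pd q)"
    and "\<And>q. q \<in> {m1 + 1..m} \<Longrightarrow> J q = UNIV \<Longrightarrow> P (\<phi> (m + q)) (pd (m + q))"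
    and "\<And>\<alpha>. P (\<Phi> \<alpha>) (F \<alpha>)"
  shows "P l (triangular_op (2 * m) l c)"
proof -
  consider (phi) p where "p \<in> dirs" "l = \<phi> p" "c = (\<lambda>q. if q = p then 1 else 0)"
    | (form) \<alpha> where "l = \<Phi> \<alpha>" "c = lower_coeffs \<alpha>"
    using assms(1) unfolding ops_def by blast
  then show ?thesis
  proof cases
    case phi
    then have "triangular_op (2 * m) l c = pd p"
      using partial_triangular[of p] dirs_subset by blast
    moreover have "P (\<phi> p) (pd p)" using phi(1) assms(2-5) unfolding dirs_def by blast
    ultimately show ?thesis by (simp add: phi(2))
  next
    case form
    then show ?thesis by (simp add: F_triangular assms(6))
  qed
qed

text \<open>Nondegeneracy gives the separation. The partial derivative in a variable \<open>p\<close> comes from \<open>\<partial>\<^sub>p\<close> if that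
  is available. If not, the partner \<open>r\<close> of \<open>p\<close> has \<open>\<phi> r \<noteq> 0\<close>, and \<open>F \<alpha>\<close> serves, for an \<open>\<alpha>\<close> on which only \<open>\<phi> r\<close>
  is nonzero.\<close>

sublocale ops: operator_family m J ops
proof (rule operator_family.intro)
  show "\<forall>p\<in>{1..2 * m}. J p = {0} \<or> J p = UNIV" by (rule J_choice)
  show "additive l" if lc: "(l, c) \<in> ops" for l c
  proof -
    consider p where "p \<in> dirs" "l = \<phi> p" | \<alpha> where "l = \<Phi> \<alpha>"
      using lc unfolding ops_def by blast
    then show ?thesis
      using phi_additive[OF subsetD[OF dirs_subset]] Phi_additive_right by cases simp_all
  qed
  show "\<exists>l c. (l, c) \<in> ops \<and> l \<beta> \<noteq> 0" if "\<beta> \<noteq> 0" for \<beta>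
  proof (rule ccontr)
    assume none: "\<not> ?thesis"
    have "\<phi> p \<beta> = 0" if "p \<in> {1..2 * m}" for p
    proof (cases "p \<in> dirs")
      case True
      then have "(\<phi> p, \<lambda>q. if q = p then 1 else 0) \<in> ops" by (simp add: ops_def)
      then show ?thesis using none by blast
    next
      case False
      have "\<phi> p = 0"
      proof (rule not_in_dirs[OF that False])
        show "\<phi> p = 0" if "p \<in> {m1 + 1..m}" "J (m + p) = {0}"
          using phi_zero_left that .
        show "\<phi> p = 0" if "p = m + r" "r \<in> {m1 + 1..m}" "J r = {0}" for r
          using phi_zero_right[OF that(2,3)] that(1) by simp
      qed
      then show ?thesis by simp
    qed
    moreover have "\<Phi> \<beta> \<alpha> = 0" for \<alpha>
    proof -
      have "\<Phi> \<alpha> \<beta> = 0" using none unfolding ops_def by blast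
      then show ?thesis using Phi_skew[of \<beta> \<alpha>] by simp
    qed
    ultimately have "\<beta> = 0" using nondegenerate by (auto simp: ker_def)
    then show False using that by simp
  qed
  show "\<exists>l c. (l, c) \<in> ops \<and> c p \<noteq> 0 \<and> (\<forall>q\<in>{1..2 * m}. q \<noteq> p \<longrightarrow> J q = UNIV \<longrightarrow> c q = 0)"
    if p: "p \<in> {1..2 * m}" "J p = UNIV" for p
  proof (cases "p \<in> dirs")
    case True
    then have "(\<phi> p, \<lambda>q. if q = p then 1 else 0) \<in> ops" by (simp add: ops_def)
    then show ?thesis by (intro exI conjI) auto
  next
    case False
    define r where "r = (if p \<le> m then m + p else p - m)"
    have r: "r \<in> {m1 + 1..m} \<union> {m + m1 + 1..2 * m} \<and> J r = {0}"
    proof (rule not_in_dirs[OF p(1) False])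
      assume *: "p \<in> {m1 + 1..m}" "J (m + p) = {0}"
      then have "r = m + p" by (simp add: r_def)
      then show ?thesis using * by simp
    next
      fix q assume *: "p = m + q" "q \<in> {m1 + 1..m}" "J q = {0}"
      then have "r = q" by (auto simp: r_def)
      then show ?thesis using * by simp
    qed
    have "r \<in> {1..2 * m}" using conjunct1[OF r] m1_le_m by auto
    then have "\<phi> r \<noteq> 0" using phi_or_J[of r] r by blast
    then obtain \<alpha> where \<alpha>: "\<phi> r \<alpha> \<noteq> 0" "\<forall>q\<in>{1..2 * m} - {r}. \<phi> q \<alpha> = 0"
      using phi_independent[of r] r by (auto simp: ker_def)
    have "lower_coeffs \<alpha> p \<noteq> 0 \<and> (\<forall>q\<in>{1..2 * m}. q \<noteq> p \<longrightarrow> lower_coeffs \<alpha> q = 0)"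
    proof (cases "p \<le> m")
      case True
      then have rp: "r = m + p" by (simp add: r_def)
      have "p \<in> {m1 + 1..m}" using conjunct1[OF r] p(1) True by (simp add: rp)
      moreover have "\<phi> (m + q) \<alpha> = 0" if "q \<in> {m1 + 1..m}" "q \<noteq> p" for q
        using \<alpha>(2) that by (simp add: rp)
      moreover have "\<phi> (q - m) \<alpha> = 0" if "q \<in> {m + m1 + 1..2 * m}" for q
        using that p(1) by (intro bspec[OF \<alpha>(2)]) (auto simp: rp)
      ultimately show ?thesis using \<alpha>(1) by (simp add: lower_coeffs_def rp)
    next
      case False
      then have rp: "p = m + r" by (simp add: r_def)
      have "p \<in> {m + m1 + 1..2 * m}" using conjunct1[OF r] p(1) False by (simp add: rp)
      moreover have "\<phi> (m + q) \<alpha> = 0" if "q \<in> {m1 + 1..m}" for q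
        using that p(1) by (intro bspec[OF \<alpha>(2)]) (simp add: rp)
      moreover have "\<phi> (q - m) \<alpha> = 0" if "q \<in> {m + m1 + 1..2 * m}" "q \<noteq> p" for q
        using that by (intro bspec[OF \<alpha>(2)]) (auto simp: rp)
      ultimately show ?thesis using \<alpha>(1) by (simp add: lower_coeffs_def rp)
    qed
    moreover have "(\<Phi> \<alpha>, lower_coeffs \<alpha>) \<in> ops" by (simp add: ops_def)
    ultimately show ?thesis by blast
  qed
qed

definition s :: 'g where
  "s = (\<Sum>p\<in>{1..m1}. \<sigma> p)"

lemma Phi_s: "\<Phi> \<alpha> s = 0"
  unfolding s_def additive.sum[OF Phi_additive_right] by (rule sum.neutral) (simp add: sigma_radical)

lemma phi_s:
  assumes "p \<in> {1..m1}" "r = p \<or> r = m + p"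
  shows "\<phi> r s = \<phi> r (\<sigma> p)"
proof -
  have r: "r \<in> {1..2 * m}" using assms m1_le_m by auto
  have "\<phi> r s = (\<Sum>q\<in>{1..m1}. if q = p then \<phi> r (\<sigma> p) else 0)"
    unfolding s_def additive.sum[OF phi_additive[OF r]]
    using assms r m1_le_m by (intro sum.cong refl) (auto intro: phi_sigma)
  then show ?thesis using assms by simp
qed

lemma phi_s_zero:
  assumes "q \<in> {m1 + 1..m}" "r = q \<or> r = m + q"
  shows "\<phi> r s = 0"
proof -
  have r: "r \<in> {1..2 * m}" using assms m1_le_m by auto
  show ?thesis
    unfolding s_def additive.sum[OF phi_additive[OF r]]
    using assms r m1_le_m by (intro sum.neutral ballI) (auto intro: phi_sigma)
qed

lemma t_A: "p \<in> {1..2 * m} \<Longrightarrow> J p = UNIV \<Longrightarrow> t p \<in> A"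
  unfolding t_def by (intro ham_A_single multi_indices_upd zero_multi_indices[OF J_choice])

lemma mon_A: "mon \<alpha> 0 \<in> A"
  by (intro ham_A_single zero_multi_indices[OF J_choice])

lemma triangular_commute_mon:
  assumes "(l, c) \<in> ops" "l \<beta> = 0"
  shows "ops.T l c (mon \<beta> 0 * u) = mon \<beta> 0 * ops.T l c u"
  using triangular_op_mon_mult[OF ops.weight_additive[OF assms(1)]] assms(2) by simp

lemma central_is_scalar:
  assumes u: "u \<in> A" and central: "\<And>a. a \<in> A \<Longrightarrow> \<B> u a = 0"
  shows "\<exists>c. u = scalar c"
proof (rule ops.annihilated_is_scalar[OF u])
  have central': "\<B> a u = 0" if "a \<in> A" for a
    using central[OF that] skew[of a u] by simp
  have "contains_generators (\<lambda>f. f u = 0)"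
    by (simp add: contains_generators_def E_def central'[OF mon_A] central'[OF t_A])
  note gen = operators_generated[OF this]
  fix l c assume "(l, c) \<in> ops"
  then show "ops.T l c u = 0"
  proof (rule ops_rule[where P = "\<lambda>_ f. f u = 0"])
    show "pd p u = 0" "pd (m + p) u = 0" if "p \<in> {1..m1}" for p
      using gen(1,2)[of p] that by (simp_all add: coef_def mon_mult_cancel)
  qed (use gen(3-5) in auto)
qed

definition D :: "('g, 'k) monoid_alg set" where
  "D = monoid_alg.span {\<B> u v | u v. u \<in> A \<and> v \<in> A}"

lemma D_bracket: "u \<in> A \<Longrightarrow> v \<in> A \<Longrightarrow> \<B> u v \<in> D"
  unfolding D_def by (rule monoid_alg.span_base) blast

lemma subspace_A: "monoid_alg.subspace A"
  by (simp add: monoid_alg.subspace_def ham_A_zero ham_A_add ham_A_scalar_mult)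

lemma D_subset_A: "D \<subseteq> A"
  unfolding D_def by (rule monoid_alg.span_minimal) (auto simp: subspace_A bracket_closed)

text \<open>\<open>E \<alpha>\<close> multiplies by \<open>x\<^bsup>-\<alpha>\<^esup>\<close> outside the bracket, but since \<open>x\<^sup>\<alpha>\<close> and its inverse commute the factor can be moved
  inside.\<close>

lemma E_in_D: "u \<in> A \<Longrightarrow> E \<alpha> u \<in> D"
proof -
  assume u: "u \<in> A"
  have "\<B> (mon \<alpha> 0) (mon (- \<alpha>) 0 * mon \<alpha> 0) = 0"
    using zero_right leibniz[of "mon \<alpha> 0" 1 1] by (simp add: mon_mult_mon mon_zero)
  then have "mon \<alpha> 0 * \<B> (mon \<alpha> 0) (mon (- \<alpha>) 0) = 0"
    by (simp only: leibniz self mult_zero_right add_0)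
  then have z: "\<B> (mon \<alpha> 0) (mon (- \<alpha>) 0) = 0" by (simp only: mon_mult_cancel)
  have "E \<alpha> u = \<B> (mon \<alpha> 0) (mon (- \<alpha>) 0 * u)"
    by (simp add: leibniz z E_def)
  then show ?thesis using D_bracket mon_A ham_A_mult[OF J_choice mon_A u] by simp
qed

text \<open>The bracket yields \<open>x\<^sup>\<sigma> \<partial>\<^sub>p\<close> with \<open>\<sigma> = \<sigma>\<^sub>p\<close>, which maps \<open>x\<^bsup>s-\<sigma>\<^esup> u\<close> to \<open>x\<^sup>s \<partial>\<^sub>p u\<close> because \<open>\<phi>\<^sub>p\<close> vanishes on
  \<open>s - \<sigma>\<^sub>p\<close>; the other operators of the family commute with \<open>x\<^sup>s\<close>. So \<open>D\<close> contains \<open>x\<^sup>s\<close> times the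
  images of the family.\<close>

lemma mon_in_D:
  assumes k: "k \<in> multi_indices m J" and "\<gamma> \<noteq> s \<or> multi_indices m J \<noteq> {0}"
  shows "mon \<gamma> k \<in> D"
proof -
  note D_add = monoid_alg.span_add[of _ "{\<B> u v | u v. u \<in> A \<and> v \<in> A}", folded D_def]
  note D_scale = monoid_alg.span_scale[of _ "{\<B> u v | u v. u \<in> A \<and> v \<in> A}", folded D_def]
  have "contains_generators (\<lambda>f. \<forall>u\<in>A. f u \<in> D)"
    by (simp add: contains_generators_def D_add D_scale E_in_D D_bracket[OF t_A])
  note gen = operators_generated[OF this]
  have "mon (\<gamma> - s) k \<in> {u. mon s 0 * u \<in> D}"
  proof (rule ops.images_contain_mon[OF _ _ _ _ k])
    show "0 \<in> {u. mon s 0 * u \<in> D}" by (simp add: D_def monoid_alg.span_zero)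
    show "u + v \<in> {u. mon s 0 * u \<in> D}" if "u \<in> {u. mon s 0 * u \<in> D}" "v \<in> {u. mon s 0 * u \<in> D}" for u v
      using that D_add by (simp add: distrib_left)
    show "scalar c * u \<in> {u. mon s 0 * u \<in> D}" if "u \<in> {u. mon s 0 * u \<in> D}" for u c
      using that D_scale by (simp add: mult.left_commute[of _ "scalar c"])
    show "\<gamma> - s \<noteq> 0 \<or> multi_indices m J \<noteq> {0}" using assms(2) by simp
    fix l c u assume lc: "(l, c) \<in> ops" and u: "u \<in> A"
    define P where "P l f \<longleftrightarrow> (\<forall>\<beta> u. l \<beta> = 0 \<longrightarrow> f (mon \<beta> 0 * u) = mon \<beta> 0 * f u)
        \<longrightarrow> (\<forall>u\<in>A. mon s 0 * f u \<in> D)" for l :: "'g \<Rightarrow> 'k" and f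
    have P1: "P l f" if "\<forall>u\<in>A. f u \<in> D" "l s = 0" for l f
      unfolding P_def using that ham_A_mult[OF J_choice mon_A[of s]] by metis
    have P2: "P (\<phi> r) f" if "\<forall>u\<in>A. coef p * f u \<in> D" and p: "p \<in> {1..m1}" "r = p \<or> r = m + p" for p r f
      unfolding P_def
    proof (intro impI ballI)
      fix u assume c: "\<forall>\<beta> u. \<phi> r \<beta> = 0 \<longrightarrow> f (mon \<beta> 0 * u) = mon \<beta> 0 * f u" and u: "u \<in> A"
      have "r \<in> {1..2 * m}" using p m1_le_m by auto
      then have "\<phi> r (s - \<sigma> p) = 0"
        using phi_s[OF p] additive.diff[OF phi_additive, of r s "\<sigma> p"] by simp
      then have "coef p * f (mon (s - \<sigma> p) 0 * u) = (coef p * mon (s - \<sigma> p) 0) * f u"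
        using c by (simp add: mult.assoc)
      also have "coef p * mon (s - \<sigma> p) 0 = mon s 0"
        using p(1) by (simp add: coef_def mon_mult_mon)
      finally show "mon s 0 * f u \<in> D"
        using that(1) ham_A_mult[OF J_choice mon_A[of "s - \<sigma> p"] u] by metis
    qed
    have "P l (ops.T l c)"
      using lc
    proof (rule ops_rule)
      show "P (\<phi> p) (pd p)" "P (\<phi> (m + p)) (pd (m + p))" if "p \<in> {1..m1}" for p
        by (rule P2[OF gen(1)[OF that] that]; simp) (rule P2[OF gen(2)[OF that] that]; simp)
      show "P (\<phi> q) (pd q)" if "q \<in> {m1 + 1..m}" "J (m + q) = UNIV" for q
        using gen(3)[OF that] phi_s_zero[OF that(1)] by (intro P1) auto
      show "P (\<phi> (m + q)) (pd (m + q))" if "q \<in> {m1 + 1..m}" "J q = UNIV" for q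
        using gen(4)[OF that] phi_s_zero[OF that(1)] by (intro P1) auto
      show "P (\<Phi> \<alpha>) (F \<alpha>)" for \<alpha>
        using gen(5) by (intro P1 Phi_s)
    qed
    then show "ops.T l c u \<in> {u. mon s 0 * u \<in> D}"
      using triangular_commute_mon[OF lc] u by (simp add: P_def)
  qed
  then show ?thesis by (simp add: mon_mult_mon)
qed

end


context hamiltonian_data
begin

lemma E_add: "E (\<alpha> + \<beta>) u = E \<alpha> u + E \<beta> u"
proof -
  have "mon (\<alpha> + \<beta>) 0 = (mon \<alpha> 0 * mon \<beta> 0 :: ('g, 'k) monoid_alg)"
    by (simp add: mon_mult_mon)
  then have "\<B> (mon (\<alpha> + \<beta>) 0) u = mon \<alpha> 0 * \<B> (mon \<beta> 0) u + mon \<beta> 0 * \<B> (mon \<alpha> 0) u"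
    using skew[of "mon \<alpha> 0 * mon \<beta> 0" u] skew[of u "mon \<alpha> 0"] skew[of u "mon \<beta> 0"]
    by (simp only: leibniz) (simp add: algebra_simps)
  moreover have "mon (- (\<alpha> + \<beta>)) 0 = (mon (- \<alpha>) 0 * mon (- \<beta>) 0 :: ('g, 'k) monoid_alg)"
    by (simp add: mon_mult_mon)
  ultimately have "E (\<alpha> + \<beta>) u = mon (- \<beta>) 0 * (mon (- \<alpha>) 0 * (mon \<alpha> 0 * \<B> (mon \<beta> 0) u))
      + mon (- \<alpha>) 0 * (mon (- \<beta>) 0 * (mon \<beta> 0 * \<B> (mon \<alpha> 0) u))"
    by (simp only: E_def distrib_left ac_simps)
  then show ?thesis by (simp only: mon_inverse E_def) simp
qed

lemma E_zero: "E 0 u = 0"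
  using E_add[of 0 0 u] by simp

lemma E_uminus: "E (- \<alpha>) u = - E \<alpha> u"
  using E_add[of "- \<alpha>" \<alpha> u] by (simp add: E_zero eq_neg_iff_add_eq_0)

lemma uminus_neq: "\<alpha> \<noteq> 0 \<Longrightarrow> - \<alpha> \<noteq> (\<alpha> :: 'g)"
  using torsion_free[of 2 \<alpha>] by (auto simp: neg_eq_iff_add_eq_0 numeral_2_eq_2)

text \<open>The only \<open>x\<^sup>\<alpha>\<close> that may be missing from \<open>D\<close> is \<open>x\<^sup>s\<close>, and \<open>E s = - E (- s)\<close> makes up for it. An ideal
  absorbs the factor \<open>x\<^bsup>-\<sigma>\<^esup>\<close>, so it is stable under the whole family and contains a unit.\<close>

lemma no_proper_stable_ideal:
  assumes K: "K \<subseteq> A" "add_subgroup K" and ideal: "\<And>a k. a \<in> A \<Longrightarrow> k \<in> K \<Longrightarrow> a * k \<in> K"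
    and stable: "\<And>d k. d \<in> D \<Longrightarrow> k \<in> K \<Longrightarrow> \<B> d k \<in> K" and "K \<noteq> {0}"
  shows "1 \<in> K"
proof -
  have scalar: "scalar c * k \<in> K" if "k \<in> K" for c k
    using ideal[OF ham_A_scalar_mult[OF mon_A[of 0]] that, of c] by (simp add: mon_zero)
  have E_D: "E \<alpha> k \<in> K" if "\<alpha> \<noteq> s \<or> multi_indices m J \<noteq> {0}" "k \<in> K" for \<alpha> k
    unfolding E_def by (intro ideal mon_A stable mon_in_D zero_multi_indices[OF J_choice] that)
  have E: "E \<alpha> k \<in> K" if k: "k \<in> K" for \<alpha> k
  proof (cases "\<alpha> \<noteq> s \<or> \<alpha> = 0")
    case True
    then show ?thesis
      using E_D[OF _ k] add_subgroup_zero[OF K(2)] E_zero by metis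
  next
    case False
    then have "E (- \<alpha>) k \<in> K" using E_D[OF _ k] uminus_neq by blast
    then show ?thesis using add_subgroup_uminus[OF K(2)] E_uminus by fastforce
  qed
  have t: "\<B> (t p) k \<in> K" if p: "p \<in> {1..2 * m}" "J p = UNIV" and k: "k \<in> K" for p k
  proof -
    have e: "0(p := 1) \<in> multi_indices m J"
      by (intro multi_indices_upd zero_multi_indices[OF J_choice] p)
    moreover have "0(p := 1) \<noteq> (0 :: nat \<Rightarrow> nat)" by (auto simp: fun_eq_iff)
    ultimately have "multi_indices m J \<noteq> {0}" by blast
    then show ?thesis unfolding t_def by (intro stable mon_in_D e k) simp
  qed
  have "contains_generators (\<lambda>f. \<forall>k\<in>K. f k \<in> K)"
    by (simp add: contains_generators_def add_subgroup_add[OF K(2)] scalar E t)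
  note gen = operators_generated[OF this]
  have T: "ops.T l c k \<in> K" if "(l, c) \<in> ops" and k: "k \<in> K" for l c k
  proof -
    have "\<forall>k\<in>K. ops.T l c k \<in> K"
      using that(1)
    proof (rule ops_rule[where P = "\<lambda>_ f. \<forall>k\<in>K. f k \<in> K"])
      have "x \<in> K" if "coef p * x \<in> K" for p x
        using ideal[OF mon_A that, of "- (if p \<le> m1 then \<sigma> p else 0)"]
        unfolding coef_def mon_inverse .
      then show "\<forall>k\<in>K. pd p k \<in> K" "\<forall>k\<in>K. pd (m + p) k \<in> K" if "p \<in> {1..m1}" for p
        using gen(1,2)[OF that] by blast+
    qed (use gen(3-5) in blast)+
    then show ?thesis using k by blast
  qed
  obtain w where "w \<in> K" "w \<noteq> 0" using \<open>K \<noteq> {0}\<close> add_subgroup_zero[OF K(2)] by blast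
  then obtain \<beta> where "mon \<beta> 0 \<in> K"
    using ops.stable_subspace_contains_mon[OF K(1) add_subgroup_diff[OF K(2)] scalar T] by metis
  then have "mon (- \<beta>) 0 * mon \<beta> 0 \<in> K" by (intro ideal mon_A)
  then show ?thesis by (simp add: mon_mult_mon mon_zero)
qed

sublocale poisson_simple \<B> A D
proof (rule poisson_simple.intro[OF poisson_bracket_axioms poisson_simple_axioms.intro])
  show "add_subgroup A" by (simp add: add_subgroup_def ham_A_zero ham_A_diff)
  show "1 \<in> A" using mon_A[of 0] by (simp add: mon_zero)
  show "u * v \<in> A" if "u \<in> A" "v \<in> A" for u v
    using ham_A_mult[OF J_choice that] .
  show "D \<subseteq> A" by (rule D_subset_A)
  show "\<B> u v \<in> D" if "u \<in> A" "v \<in> A" for u v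
    using D_bracket[OF that] .
qed (rule no_proper_stable_ideal)

theorem ideal_dichotomy:
  assumes "I \<subseteq> A" "monoid_alg.subspace I" "\<And>d u. d \<in> D \<Longrightarrow> u \<in> I \<Longrightarrow> \<B> d u \<in> I"
  shows "I \<subseteq> range scalar \<or> D \<subseteq> I"
proof -
  have "add_subgroup I"
    using monoid_alg.subspace_0 monoid_alg.subspace_diff assms(2) by (auto simp: add_subgroup_def)
  then consider "\<forall>u\<in>I. \<forall>a\<in>A. \<B> u a = 0" | "\<forall>a\<in>A. \<forall>b\<in>A. \<B> a b \<in> I"
    using lie_ideal_dichotomy assms(1,3) by blast
  then show ?thesis
  proof cases
    case 1
    then have "I \<subseteq> range scalar" using central_is_scalar assms(1) by blast
    then show ?thesis ..
  next
    case 2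
    then have "D \<subseteq> I" unfolding D_def by (intro monoid_alg.span_minimal assms(2)) auto
    then show ?thesis ..
  qed
qed

text \<open>The bracket of \<open>x\<^sup>\<alpha>\<close> and \<open>x\<^sup>\<beta>\<close> can reach \<open>x\<^sup>s\<close> only if \<open>\<alpha> + \<beta> = s\<close> or \<open>\<sigma>\<^sub>p + \<alpha> + \<beta> = s\<close>. In the first
  case \<open>\<Phi> \<alpha> \<beta> = \<Phi> \<alpha> (s - \<alpha>)\<close> vanishes; in the second \<open>\<beta>\<close> and \<open>- \<alpha>\<close> have the same values under \<open>\<phi>\<^sub>p\<close> and
  \<open>\<phi>\<^sub>m\<^sub>+\<^sub>p\<close>, so the determinant vanishes.\<close>

lemma lookup_D:
  assumes triv: "multi_indices m J = {0}" and "u \<in> D"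
  shows "Poly_Mapping.lookup u (s, 0) = 0"
proof -
  let ?Z = "{u :: ('g, 'k) monoid_alg. Poly_Mapping.lookup u (s, 0) = 0}"
  have J0: "J p = {0}" if "p \<in> {1..2 * m}" for p
  proof (rule ccontr)
    assume "J p \<noteq> {0}"
    then have "J p = UNIV" using J_choice that by blast
    then have "0(p := 1) \<in> multi_indices m J"
      by (intro multi_indices_upd zero_multi_indices[OF J_choice] that)
    then have "0(p := 1) = (0 :: nat \<Rightarrow> nat)" using triv by blast
    then show False by (metis fun_upd_same zero_fun_apply zero_neq_one)
  qed
  have empty: "{m1 + 1..m} = {}"
  proof (rule ccontr)
    assume "{m1 + 1..m} \<noteq> {}"
    then have m: "m \<in> {m1 + 1..m}" "m + m \<in> {1..2 * m}" "m \<in> {1..2 * m}" by auto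
    show False
      using phi_zero_right[OF m(1) J0[OF m(3)]] phi_or_J[OF m(2)] J0[OF m(2)] by blast
  qed
  have dh: "d_hat p (Poly_Mapping.single (\<alpha>, 0) c) = 0" for p \<alpha> and c :: 'k
    by (simp add: d_hat_single)
  have mono: "\<B> (Poly_Mapping.single (\<alpha>, 0) c) (Poly_Mapping.single (\<beta>, 0) d) \<in> ?Z" for \<alpha> \<beta> c d
  proof -
    have 1: "\<phi> p \<alpha> * \<phi> (m + p) \<beta> - \<phi> (m + p) \<alpha> * \<phi> p \<beta> = 0"
      if p: "p \<in> {1..m1}" and s: "\<sigma> p + (\<alpha> + \<beta>) = s" for p
    proof -
      have "\<phi> r \<beta> = - \<phi> r \<alpha>" if r: "r = p \<or> r = m + p" for r
      proof -
        have "r \<in> {1..2 * m}" using p r m1_le_m by auto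
        then have "\<phi> r s = \<phi> r (\<sigma> p) + (\<phi> r \<alpha> + \<phi> r \<beta>)"
          unfolding s[symmetric] by (simp only: phi_add)
        then have "\<phi> r \<beta> + \<phi> r \<alpha> = 0"
          unfolding phi_s[OF p r] by (simp add: add.commute)
        then show ?thesis by (rule iffD2[OF eq_neg_iff_add_eq_0])
      qed
      then show ?thesis by simp
    qed
    have 2: "\<Phi> \<alpha> \<beta> = 0" if "\<alpha> + \<beta> = s"
    proof -
      have "2 * \<Phi> \<alpha> \<alpha> = 0"
        using iffD1[OF eq_neg_iff_add_eq_0 Phi_skew[of \<alpha> \<alpha>]] by (simp only: mult_2)
      then have "\<Phi> \<alpha> \<alpha> = 0" by simp
      then show ?thesis
        using Phi_s[of \<alpha>] additive.add[OF Phi_additive_right, of \<alpha> \<alpha> \<beta>] that by simp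
    qed
    have pdS: "pd p (Poly_Mapping.single (\<gamma>, 0) e) = Poly_Mapping.single (\<gamma>, 0) (\<phi> p \<gamma> * e)" for p \<gamma> e
      by (simp add: d_full_eq weight_derivation_single dh)
    let ?u = "Poly_Mapping.single (\<alpha>, 0) c" and ?v = "Poly_Mapping.single (\<beta>, 0) d"
    have lk: "Poly_Mapping.lookup (Poly_Mapping.single (\<gamma>, 0) x) (s, 0) = (if \<gamma> = s then 1 else 0) * x"
      for \<gamma> and x :: 'k
      by (simp add: lookup_single when_def)
    have 3: "Poly_Mapping.single (\<sigma> p, 0) 1 * (pd p ?u * pd (m + p) ?v - pd (m + p) ?u * pd p ?v)
        = Poly_Mapping.single (\<sigma> p + (\<alpha> + \<beta>), 0)
            ((\<phi> p \<alpha> * \<phi> (m + p) \<beta> - \<phi> (m + p) \<alpha> * \<phi> p \<beta>) * (c * d))" for p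
    proof -
      have "1 * (\<phi> p \<alpha> * c * (\<phi> (m + p) \<beta> * d) - \<phi> (m + p) \<alpha> * c * (\<phi> p \<beta> * d))
          = (\<phi> p \<alpha> * \<phi> (m + p) \<beta> - \<phi> (m + p) \<alpha> * \<phi> p \<beta>) * (c * d)"
        by (simp add: algebra_simps)
      then show ?thesis
        unfolding pdS mult_single single_diff[symmetric] add_Pair by (simp only: add_0)
    qed
    have "\<B> ?u ?v = (\<Sum>p\<in>{1..m1}. Poly_Mapping.single (\<sigma> p + (\<alpha> + \<beta>), 0)
            ((\<phi> p \<alpha> * \<phi> (m + p) \<beta> - \<phi> (m + p) \<alpha> * \<phi> p \<beta>) * (c * d)))
          + Poly_Mapping.single (\<alpha> + \<beta>, 0) (\<Phi> \<alpha> \<beta> * (c * d))"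
      unfolding ham_bracket_def empty 3 form_product_single_single by simp
    then have "Poly_Mapping.lookup (\<B> ?u ?v) (s, 0)
        = (\<Sum>p\<in>{1..m1}. (if \<sigma> p + (\<alpha> + \<beta>) = s then 1 else 0) *
            ((\<phi> p \<alpha> * \<phi> (m + p) \<beta> - \<phi> (m + p) \<alpha> * \<phi> p \<beta>) * (c * d)))
          + (if \<alpha> + \<beta> = s then 1 else 0) * (\<Phi> \<alpha> \<beta> * (c * d))"
      by (simp only: lookup_add lookup_sum lk)
    also have "(\<Sum>p\<in>{1..m1}. (if \<sigma> p + (\<alpha> + \<beta>) = s then 1 else 0) *
            ((\<phi> p \<alpha> * \<phi> (m + p) \<beta> - \<phi> (m + p) \<alpha> * \<phi> p \<beta>) * (c * d))) = 0"
      by (rule sum.neutral) (use 1 in auto)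
    finally have 4: "Poly_Mapping.lookup (\<B> ?u ?v) (s, 0) = 0 + (if \<alpha> + \<beta> = s then 1 else 0) * (\<Phi> \<alpha> \<beta> * (c * d))" .
    have "0 + (if \<alpha> + \<beta> = s then 1 else 0) * (\<Phi> \<alpha> \<beta> * (c * d)) = 0"
      using 2 by (cases "\<alpha> + \<beta> = s") simp_all
    then show ?thesis unfolding mem_Collect_eq 4 .
  qed
  have "\<B> u v \<in> ?Z" if uv: "u \<in> A" "v \<in> A" for u v
  proof -
    have "u \<in> {u. \<B> u v \<in> ?Z}"
      using uv(1)
    proof (induction rule: ham_A_subspace_induct)
      case (mon \<alpha> i c)
      have "v \<in> {v. \<B> (Poly_Mapping.single (\<alpha>, 0) c) v \<in> ?Z}"
        using uv(2)
      proof (induction rule: ham_A_subspace_induct)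
        case (mon \<beta> j d)
        then show ?case using mono triv by auto
      qed (auto simp: zero_right add_right lookup_add)
      then show ?case using mon triv by auto
    qed (auto simp: zero_left add_left lookup_add)
    then show ?thesis by simp
  qed
  then have "D \<subseteq> ?Z"
    unfolding D_def
    by (intro monoid_alg.span_minimal) (auto simp: monoid_alg.subspace_def lookup_add lookup_scalar_mult)
  then show ?thesis using \<open>u \<in> D\<close> by blast
qed

end


section \<open>Passage to the quotient\<close>

lemma to_mod_add: "to_mod_scalars (u + v) = to_mod_scalars u + to_mod_scalars v"
  by (simp add: plus_mod_scalars.abs_eq)

lemma to_mod_zero: "to_mod_scalars 0 = 0"
  by (simp add: zero_mod_scalars_def)

lemma to_mod_scale: "to_mod_scalars (scalar c * u) = scale_mod_scalars c (to_mod_scalars u)"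
  by (simp add: scale_mod_scalars.abs_eq)

lemma to_mod_eq_iff: "to_mod_scalars u = to_mod_scalars v \<longleftrightarrow> (\<exists>c. u - v = scalar c)"
  by (rule mod_scalars.abs_eq_iff)

lemma to_mod_eq_zero_iff: "to_mod_scalars u = 0 \<longleftrightarrow> u \<in> range scalar"
  using to_mod_eq_iff[of u 0] by (auto simp: to_mod_zero)

lemma to_mod_surj: "\<exists>u. X = to_mod_scalars u"
  by (induction X rule: mod_scalars.abs_induct) blast

interpretation mod_scalars: vector_space
  "scale_mod_scalars :: 'k::field_char_0 \<Rightarrow> ('g::ab_group_add, 'k) mod_scalars \<Rightarrow> _"
proof
  fix a b :: 'k and X Y :: "('g, 'k) mod_scalars"
  obtain u v where X: "X = to_mod_scalars u" and Y: "Y = to_mod_scalars v"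
    using to_mod_surj by metis
  show "scale_mod_scalars a (X + Y) = scale_mod_scalars a X + scale_mod_scalars a Y"
    "scale_mod_scalars (a + b) X = scale_mod_scalars a X + scale_mod_scalars b X"
    "scale_mod_scalars a (scale_mod_scalars b X) = scale_mod_scalars (a * b) X"
    "scale_mod_scalars 1 X = X"
    unfolding X Y to_mod_add[symmetric] to_mod_scale[symmetric]
    by (simp_all add: distrib_left distrib_right single_add mult_single mult.assoc[symmetric])
qed

interpretation to_mod: Vector_Spaces.linear
  "\<lambda>c u. scalar c * u :: ('g::ab_group_add, 'k::field_char_0) monoid_alg" scale_mod_scalars to_mod_scalars
  by unfold_locales (simp_all add: to_mod_add to_mod_scale)

context hamiltonian_data
begin

abbreviation H where "H \<equiv> ham_H m J :: ('g, 'k) mod_scalars set"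
abbreviation \<B>\<^sub>H where "\<B>\<^sub>H \<equiv> ham_bracket_H m m1 \<phi> \<Phi> \<sigma>"

lemmas bracket_H = ham_bracket_H_to_mod_scalars

lemma derived_eq: "derived_algebra scale_mod_scalars \<B>\<^sub>H H = to_mod_scalars ` D"
proof -
  have "{\<B>\<^sub>H X Y | X Y. X \<in> H \<and> Y \<in> H} = to_mod_scalars ` {\<B> u v | u v. u \<in> A \<and> v \<in> A}"
    by (auto simp: ham_H_def bracket_H image_iff) (metis bracket_H)+
  then show ?thesis
    unfolding derived_algebra_def D_def by (simp add: to_mod.span_image)
qed

lemma lie_algebra_image:
  assumes L: "monoid_alg.subspace L" "\<And>u v. u \<in> L \<Longrightarrow> v \<in> L \<Longrightarrow> \<B> u v \<in> L"
  shows "lie_algebra scale_mod_scalars \<B>\<^sub>H (to_mod_scalars ` L)"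
proof -
  have scale_right: "\<B> u (scalar c * v) = scalar c * \<B> u v" for u v c
  proof -
    have "\<B> u (scalar c) = 0" using ham_bracket_scalar_right[of u 0 c] zero_right by simp
    then show ?thesis by (simp add: leibniz)
  qed
  have scale_left: "\<B> (scalar c * u) v = scalar c * \<B> u v" for u v c
    using scale_right[of v c u] skew[of "scalar c * u" v] skew[of u v] by simp
  have sub: "mod_scalars.subspace (to_mod_scalars ` L)"
    by (intro to_mod.subspace_image L)
  show ?thesis
  proof (rule lie_algebra.intro[OF mod_scalars.vector_space_axioms], rule lie_algebra_axioms.intro)
    fix X Y Z assume "X \<in> to_mod_scalars ` L" "Y \<in> to_mod_scalars ` L" "Z \<in> to_mod_scalars ` L"
    then obtain u v w where X: "X = to_mod_scalars u" and Y: "Y = to_mod_scalars v" and Z: "Z = to_mod_scalars w"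
      by blast
    show "\<B>\<^sub>H (X + Y) Z = \<B>\<^sub>H X Z + \<B>\<^sub>H Y Z" "\<B>\<^sub>H X (Y + Z) = \<B>\<^sub>H X Y + \<B>\<^sub>H X Z"
      unfolding X Y Z to_mod_add[symmetric] bracket_H by (simp_all only: add_left add_right)
    show "\<B>\<^sub>H X (\<B>\<^sub>H Y Z) + \<B>\<^sub>H Y (\<B>\<^sub>H Z X) + \<B>\<^sub>H Z (\<B>\<^sub>H X Y) = 0"
      unfolding X Y Z bracket_H to_mod_add[symmetric] by (simp only: jacobi to_mod_zero)
  next
    fix X Y assume "X \<in> to_mod_scalars ` L" "Y \<in> to_mod_scalars ` L"
    then obtain u v where uv: "u \<in> L" "v \<in> L" and X: "X = to_mod_scalars u" and Y: "Y = to_mod_scalars v"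
      by blast
    show "\<B>\<^sub>H X Y \<in> to_mod_scalars ` L" unfolding X Y bracket_H using L(2)[OF uv] by blast
    show "\<B>\<^sub>H (scale_mod_scalars c X) Y = scale_mod_scalars c (\<B>\<^sub>H X Y)"
      "\<B>\<^sub>H X (scale_mod_scalars c Y) = scale_mod_scalars c (\<B>\<^sub>H X Y)" for c
      unfolding X Y bracket_H to_mod_scale[symmetric] by (simp_all only: scale_left scale_right)
    show "\<B>\<^sub>H X X = 0" unfolding X bracket_H by (simp only: self to_mod_zero)
  qed (rule sub)
qed

text \<open>The cases of interest are \<open>L = A\<close> and \<open>L = D\<close>. An ideal of the quotient is pulled back to \<open>A\<close>, where it
  is stable under \<open>D\<close>; it consists of scalars only if it is zero in the quotient.\<close>

lemma simple_image:
  assumes L: "monoid_alg.subspace L" "D \<subseteq> L" "L \<subseteq> A"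
    and D_L: "to_mod_scalars ` D = to_mod_scalars ` L"
  shows "simple_lie_algebra scale_mod_scalars \<B>\<^sub>H (to_mod_scalars ` L)"
  unfolding simple_lie_algebra_def
proof (intro conjI allI impI)
  show "lie_algebra scale_mod_scalars \<B>\<^sub>H (to_mod_scalars ` L)"
    by (rule lie_algebra_image[OF L(1)]) (use L(2,3) D_bracket in blast)
  fix X assume "lie_ideal scale_mod_scalars \<B>\<^sub>H (to_mod_scalars ` L) X \<and> X \<noteq> {0}"
  then have X: "mod_scalars.subspace X" "X \<subseteq> to_mod_scalars ` L"
    "\<And>Y Z. Y \<in> to_mod_scalars ` L \<Longrightarrow> Z \<in> X \<Longrightarrow> \<B>\<^sub>H Y Z \<in> X" and "X \<noteq> {0}"
    by (auto simp: lie_ideal_def)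
  define I where "I = A \<inter> to_mod_scalars -` X"
  have "monoid_alg.subspace I"
    unfolding I_def by (intro monoid_alg.subspace_inter subspace_A to_mod.subspace_vimage X)
  moreover have "\<B> d u \<in> I" if "d \<in> D" "u \<in> I" for d u
    using that bracket_A D_subset_A X(3)[of "to_mod_scalars d" "to_mod_scalars u"] L(2)
    by (auto simp: I_def bracket_H)
  ultimately have "I \<subseteq> range scalar \<or> D \<subseteq> I"
    by (intro ideal_dichotomy) (auto simp: I_def)
  moreover have "X = to_mod_scalars ` I"
    using X(2) L(3) unfolding I_def by blast
  moreover have "to_mod_scalars ` I \<subseteq> {0}" if "I \<subseteq> range scalar"
    using that to_mod_eq_zero_iff by blast
  ultimately have "D \<subseteq> I"
    using \<open>X \<noteq> {0}\<close> mod_scalars.subspace_0[OF X(1)] by blast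
  then have "to_mod_scalars ` D \<subseteq> X" using \<open>X = to_mod_scalars ` I\<close> by blast
  then show "X = to_mod_scalars ` L" using X(2) D_L by blast
qed

lemma decomposition:
  assumes "u \<in> A"
  shows "\<exists>d\<in>D. \<exists>c e. u = d + scalar c * mon s 0 + scalar e \<and>
    (multi_indices m J \<noteq> {0} \<or> s = 0 \<longrightarrow> c = 0)"
proof -
  have sub: "monoid_alg.subspace D" unfolding D_def by (rule monoid_alg.subspace_span)
  let ?P = "\<lambda>u c. \<exists>d\<in>D. \<exists>e. u = d + scalar c * mon s 0 + scalar e"
  let ?c0 = "multi_indices m J \<noteq> {0} \<or> s = 0"
  have "u \<in> {u. \<exists>c. ?P u c \<and> (?c0 \<longrightarrow> c = 0)}"
    using assms
  proof (induction rule: ham_A_subspace_induct)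
    case zero
    have "?P 0 0" using monoid_alg.subspace_0[OF sub] by (intro bexI[of _ 0] exI[of _ 0]) auto
    then show ?case by blast
  next
    case (add u v)
    then obtain c c' d d' e e' where *: "d \<in> D" "d' \<in> D" "?c0 \<longrightarrow> c = 0" "?c0 \<longrightarrow> c' = 0"
      "u = d + scalar c * mon s 0 + scalar e" "v = d' + scalar c' * mon s 0 + scalar e'"
      by blast
    have "u + v = (d + d') + scalar (c + c') * mon s 0 + scalar (e + e')"
      using * by (simp only: single_add distrib_right) (simp add: algebra_simps)
    then have "?P (u + v) (c + c')" using monoid_alg.subspace_add[OF sub] * by blast
    moreover have "?c0 \<longrightarrow> c + c' = 0" using * by auto
    ultimately show ?case by blast
  next
    case (mon \<alpha> i c)
    consider "\<alpha> \<noteq> s \<or> multi_indices m J \<noteq> {0}" | "\<alpha> = s" "i = 0" "s = 0" | "\<alpha> = s" "i = 0" "\<not> ?c0"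
      using mon by blast
    then show ?case
    proof cases
      case 1
      then have "Poly_Mapping.single (\<alpha>, i) c \<in> D"
        using monoid_alg.subspace_scale[OF sub mon_in_D[OF mon]] single_eq_scalar_mult_mon by metis
      then have "?P (Poly_Mapping.single (\<alpha>, i) c) 0"
        by (intro bexI[of _ "Poly_Mapping.single (\<alpha>, i) c"] exI[of _ 0]) auto
      then show ?thesis by blast
    next
      case 2
      then have "?P (Poly_Mapping.single (\<alpha>, i) c) 0"
        using monoid_alg.subspace_0[OF sub]
        by (intro bexI[of _ 0] exI[of _ c]) (auto simp: zero_prod_def)
      then show ?thesis by blast
    next
      case 3
      then have "?P (Poly_Mapping.single (\<alpha>, i) c) c"
        using monoid_alg.subspace_0[OF sub]
        by (intro bexI[of _ 0] exI[of _ 0]) (auto simp: single_eq_scalar_mult_mon[of _ _ c])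
      then show ?thesis using 3 by blast
    qed
  qed
  then show ?thesis by blast
qed

lemma simple_H:
  assumes "multi_indices m J \<noteq> {0} \<or> s = 0"
  shows "simple_lie_algebra scale_mod_scalars \<B>\<^sub>H H"
proof -
  have "to_mod_scalars u \<in> to_mod_scalars ` D" if u: "u \<in> A" for u
  proof -
    obtain d e where "d \<in> D" "u = d + scalar e"
      using decomposition[OF u] assms by auto
    then have "to_mod_scalars u = to_mod_scalars d" by (auto simp: to_mod_eq_iff)
    then show ?thesis using \<open>d \<in> D\<close> by blast
  qed
  then show ?thesis
    unfolding ham_H_def using D_subset_A by (intro simple_image subspace_A) auto
qed

lemma simple_H1:
  "simple_lie_algebra scale_mod_scalars \<B>\<^sub>H (derived_algebra scale_mod_scalars \<B>\<^sub>H H)"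
  unfolding derived_eq using D_subset_A
  by (intro simple_image) (auto simp: D_def monoid_alg.subspace_span)

lemma direct_sum:
  assumes triv: "multi_indices m J = {0}" and s: "s \<noteq> 0"
  shows "internal_direct_sum scale_mod_scalars H (derived_algebra scale_mod_scalars \<B>\<^sub>H H)
    (to_mod_scalars ` {Poly_Mapping.single (s, 0) c + scalar d | c d. True})" (is "internal_direct_sum _ _ _ ?W")
  unfolding internal_direct_sum_def derived_eq
proof (intro conjI)
  let ?S = "{Poly_Mapping.single (s, 0) c + scalar d | c d. True} :: ('g, 'k) monoid_alg set"
  have "monoid_alg.subspace ?S"
  proof (rule monoid_alg.subspaceI)
    have "0 = Poly_Mapping.single (s, 0) 0 + (scalar 0 :: ('g, 'k) monoid_alg)" by simp
    then show "0 \<in> ?S"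
      by (intro CollectI exI conjI TrueI)
    have "Poly_Mapping.single (s, 0) c + scalar d + (Poly_Mapping.single (s, 0) c' + scalar d')
        = Poly_Mapping.single (s, 0) (c + c') + scalar (d + d')" for c c' d d' :: 'k
      by (simp add: single_add ac_simps)
    then show "u + v \<in> ?S"
      if "u \<in> ?S"
        "v \<in> ?S" for u v :: "('g, 'k) monoid_alg"
      using that by blast
    have "scalar a * (Poly_Mapping.single (s, 0) c + scalar d)
        = Poly_Mapping.single (s, 0) (a * c) + scalar (a * d)" for a c d :: 'k
      by (simp add: distrib_left scalar_mult_single)
    then show "scalar a * u \<in> ?S"
      if "u \<in> ?S" for a and u :: "('g, 'k) monoid_alg"
      using that by blast
  qed
  then show "mod_scalars.subspace ?W" by (rule to_mod.subspace_image)
  show "mod_scalars.subspace (to_mod_scalars ` D)"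
    unfolding D_def by (intro to_mod.subspace_image monoid_alg.subspace_span)
  have W_A: "Poly_Mapping.single (s, 0) c + scalar d \<in> A" for c d
    unfolding zero_prod_def by (intro ham_A_add ham_A_single zero_multi_indices[OF J_choice])
  show "H = {u + w | u w. u \<in> to_mod_scalars ` D \<and> w \<in> ?W}"
  proof (intro subset_antisym subsetI)
    fix X assume "X \<in> H"
    then obtain u where u: "u \<in> A" "X = to_mod_scalars u" by (auto simp: ham_H_def)
    obtain d c e where "d \<in> D" "u = d + scalar c * mon s 0 + scalar e"
      using decomposition[OF u(1)] by blast
    then have "X = to_mod_scalars d + to_mod_scalars (Poly_Mapping.single (s, 0) c + scalar e)"
      by (simp add: u(2) to_mod_add[symmetric] single_eq_scalar_mult_mon[of s 0 c] add.assoc)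
    then show "X \<in> {u + w | u w. u \<in> to_mod_scalars ` D \<and> w \<in> ?W}" using \<open>d \<in> D\<close> by blast
  next
    fix X assume "X \<in> {u + w | u w. u \<in> to_mod_scalars ` D \<and> w \<in> ?W}"
    then obtain d c e where "d \<in> D" "X = to_mod_scalars d + to_mod_scalars (Poly_Mapping.single (s, 0) c + scalar e)"
      by blast
    then show "X \<in> H"
      using ham_A_add[OF _ W_A] D_subset_A by (auto simp: ham_H_def to_mod_add[symmetric])
  qed
  have "X = 0" if X: "X \<in> to_mod_scalars ` D" "X \<in> ?W" for X
  proof -
    obtain d c e where d: "d \<in> D" "X = to_mod_scalars d" and X: "X = to_mod_scalars (Poly_Mapping.single (s, 0) c + scalar e)"
      using X by blast
    then obtain f where "d - (Poly_Mapping.single (s, 0) c + scalar e) = scalar f"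
      using to_mod_eq_iff by metis
    then have "Poly_Mapping.lookup (d - (Poly_Mapping.single (s, 0) c + scalar e)) (s, 0) = Poly_Mapping.lookup (scalar f) (s, 0)"
      by simp
    then have "c = 0"
      using lookup_D[OF triv d(1)] s by (simp add: lookup_minus lookup_add lookup_single when_def zero_prod_def)
    then show ?thesis using X to_mod_eq_zero_iff[of "scalar e"] by simp
  qed
  moreover have "0 \<in> to_mod_scalars ` D" "0 \<in> ?W"
    using mod_scalars.subspace_0 \<open>mod_scalars.subspace ?W\<close> \<open>mod_scalars.subspace (to_mod_scalars ` D)\<close> by blast+
  ultimately show "to_mod_scalars ` D \<inter> ?W = {0}" by blast
qed

end

theorem theorem4p2:
  fixes m m1 :: nat
    and J :: "nat \<Rightarrow> nat set"
    and \<phi> :: "nat \<Rightarrow> 'g::ab_group_add \<Rightarrow> 'k::field_char_0"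
    and \<Phi> :: "'g \<Rightarrow> 'g \<Rightarrow> 'k"
    and \<sigma> :: "nat \<Rightarrow> 'g"
  assumes "hamiltonian_data m m1 J \<phi> \<Phi> \<sigma>"
  shows "let H = (ham_H m J :: ('g, 'k) mod_scalars set);
             B = ham_bracket_H m m1 \<phi> \<Phi> \<sigma>;
             H1 = derived_algebra scale_mod_scalars B H;
             s = (\<Sum>p\<in>{1..m1}. \<sigma> p)
         in (multi_indices m J \<noteq> {0} \<or> s = 0 \<longrightarrow> simple_lie_algebra scale_mod_scalars B H) \<and>
            (multi_indices m J = {0} \<and> s \<noteq> 0 \<longrightarrow>
               simple_lie_algebra scale_mod_scalars B H1 \<and>
               internal_direct_sum scale_mod_scalars H H1
                 (to_mod_scalars `
                   {Poly_Mapping.single (s, 0) c + Poly_Mapping.single 0 d | c d. True}))"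
proof -
  interpret hamiltonian_data m m1 J \<phi> \<Phi> \<sigma> by fact
  show ?thesis
    unfolding Let_def s_def[symmetric] using simple_H simple_H1 direct_sum by blast
qed

end
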